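(* Let $G=\mathbf{SL}_3$ and let $B$ be the Borel subgroup of upper triangular matrices in $G$. Then every Schubert variety $X_{wB}$ in $G/B$ ($w\in W$) is a spherical $L(w)$-variety.
   Context: Everything is over $\mathbb{C}$. $T\subset B$ is the diagonal torus, $W=N_G(T)/T$ is the Weyl group, and for $w\in W$, $X_{wB}$ is the Zariski closure of $BwB/B$ in $G/B$. $P(w)=\mathrm{Stab}_G(X_{wB})$ is the stabilizer under left multiplication (a parabolic subgroup containing $B$), and $L(w)$ is the Levi subgroup of $P(w)$ containing $T$. For a connected reductive group $H$, a normal variety $Y$ with an algebraic $H$-action is a spherical $H$-variety if a Borel subgroup of $H$ has a dense open orbit in $Y$. *)

theory Defs
  imports
    "HOL-Analysis.Analysis"
    "HOL-Algebra.Group_Action"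
    "HOL-Algebra.Left_Coset"
    "HOL-Algebra.Solvable_Groups"
begin

section \<open>Spaces with functions over the complex numbers\<close>

text \<open>
  Varieties are treated as spaces with functions: a topological space with a sheaf of
  complex-valued functions.  In \<open>regular X U f\<close> the function \<open>f\<close> is total, but only its values on
  the open set \<open>U\<close> matter.
\<close>

record 'a fspace =
  zariski :: "'a topology"
  regular :: "'a set \<Rightarrow> ('a \<Rightarrow> complex) \<Rightarrow> bool"

abbreviation points :: "'a fspace \<Rightarrow> 'a set"
  where "points X \<equiv> topspace (zariski X)"

inductive_set polys :: "('a \<Rightarrow> complex) set \<Rightarrow> ('a \<Rightarrow> complex) set"
  for C :: "('a \<Rightarrow> complex) set" where
  const: "(\<lambda>_. c) \<in> polys C"
| coord: "f \<in> C \<Longrightarrow> f \<in> polys C"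
| add: "f \<in> polys C \<Longrightarrow> g \<in> polys C \<Longrightarrow> (\<lambda>x. f x + g x) \<in> polys C"
| mult: "f \<in> polys C \<Longrightarrow> g \<in> polys C \<Longrightarrow> (\<lambda>x. f x * g x) \<in> polys C"

definition zariski_topology :: "'a set \<Rightarrow> ('a \<Rightarrow> complex) set \<Rightarrow> 'a topology"
  where "zariski_topology S C = topology (\<lambda>U. \<exists>F \<subseteq> polys C. U = S - {x \<in> S. \<forall>f\<in>F. f x = 0})"

lemma openin_zariski_topology:
  "openin (zariski_topology S C) U \<longleftrightarrow> (\<exists>F \<subseteq> polys C. U = S - {x \<in> S. \<forall>f\<in>F. f x = 0})"
proof -
  define Op where "Op = (\<lambda>U. \<exists>F \<subseteq> polys C. U = S - {x \<in> S. \<forall>f\<in>F. f x = 0})"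
  have Op_iff: "Op U \<longleftrightarrow> U \<subseteq> S \<and>
      (\<forall>x\<in>U. \<exists>f \<in> polys C. f x \<noteq> 0 \<and> (\<forall>y\<in>S. f y \<noteq> 0 \<longrightarrow> y \<in> U))" for U
  proof
    assume "Op U"
    then obtain F where F: "F \<subseteq> polys C" and U: "U = S - {x \<in> S. \<forall>f\<in>F. f x = 0}"
      unfolding Op_def by (elim exE conjE)
    have mem: "x \<in> U \<longleftrightarrow> x \<in> S \<and> (\<exists>f\<in>F. f x \<noteq> 0)" for x
      unfolding U by blast
    show "U \<subseteq> S \<and> (\<forall>x\<in>U. \<exists>f \<in> polys C. f x \<noteq> 0 \<and> (\<forall>y\<in>S. f y \<noteq> 0 \<longrightarrow> y \<in> U))"
    proof (intro conjI ballI)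
      show "U \<subseteq> S" using mem by auto
      fix x assume "x \<in> U"
      then obtain f where "f \<in> F" "f x \<noteq> 0" using mem by auto
      then show "\<exists>f \<in> polys C. f x \<noteq> 0 \<and> (\<forall>y\<in>S. f y \<noteq> 0 \<longrightarrow> y \<in> U)"
        using F mem by (intro bexI[where x = f]) auto
    qed
  next
    assume R: "U \<subseteq> S \<and> (\<forall>x\<in>U. \<exists>f \<in> polys C. f x \<noteq> 0 \<and> (\<forall>y\<in>S. f y \<noteq> 0 \<longrightarrow> y \<in> U))"
    define F where "F = {f \<in> polys C. \<forall>y\<in>S. f y \<noteq> 0 \<longrightarrow> y \<in> U}"
    have "x \<in> U \<longleftrightarrow> x \<in> S \<and> (\<exists>f\<in>F. f x \<noteq> 0)" for x
      using R unfolding F_def by (simp add: subset_iff) meson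
    then have "U = S - {x \<in> S. \<forall>f\<in>F. f x = 0}"
      by blast
    moreover have "F \<subseteq> polys C" unfolding F_def by blast
    ultimately show "Op U"
      unfolding Op_def by (intro exI[where x = F] conjI)
  qed
  have "istopology Op"
    unfolding istopology_def
  proof (intro conjI allI impI)
    fix U V assume UV: "Op U" "Op V"
    show "Op (U \<inter> V)"
      unfolding Op_iff
    proof (intro conjI ballI)
      show "U \<inter> V \<subseteq> S" using UV(1) by (auto simp: Op_iff)
      fix x assume "x \<in> U \<inter> V"
      then have x: "x \<in> U" "x \<in> V" by auto
      obtain f where f: "f \<in> polys C" "f x \<noteq> 0" "\<forall>y\<in>S. f y \<noteq> 0 \<longrightarrow> y \<in> U"
        using conjunct2[OF UV(1)[unfolded Op_iff], THEN bspec, OF x(1)] by (elim bexE conjE)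
      obtain g where g: "g \<in> polys C" "g x \<noteq> 0" "\<forall>y\<in>S. g y \<noteq> 0 \<longrightarrow> y \<in> V"
        using conjunct2[OF UV(2)[unfolded Op_iff], THEN bspec, OF x(2)] by (elim bexE conjE)
      show "\<exists>h \<in> polys C. h x \<noteq> 0 \<and> (\<forall>y\<in>S. h y \<noteq> 0 \<longrightarrow> y \<in> U \<inter> V)"
        using polys.mult[OF f(1) g(1)] f g by (intro bexI[where x = "\<lambda>x. f x * g x"]) auto
    qed
  next
    fix K assume K: "\<forall>U\<in>K. Op U"
    show "Op (\<Union>K)"
      unfolding Op_iff
    proof (intro conjI ballI)
      show "\<Union>K \<subseteq> S" using K by (auto simp: Op_iff)
      fix x assume "x \<in> \<Union>K"
      then obtain U where U: "U \<in> K" "x \<in> U" by (elim UnionE)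
      obtain f where f: "f \<in> polys C" "f x \<noteq> 0" "\<forall>y\<in>S. f y \<noteq> 0 \<longrightarrow> y \<in> U"
        using conjunct2[OF bspec[OF K U(1), unfolded Op_iff], THEN bspec, OF U(2)]
        by (elim bexE conjE)
      show "\<exists>h \<in> polys C. h x \<noteq> 0 \<and> (\<forall>y\<in>S. h y \<noteq> 0 \<longrightarrow> y \<in> \<Union>K)"
        using f U(1) by (intro bexI[where x = f]) auto
    qed
  qed
  then have "openin (topology Op) U \<longleftrightarrow> Op U"
    by (simp only: topology_inverse')
  then show ?thesis
    unfolding zariski_topology_def Op_def .
qed

text \<open>\<open>C\<close> is the set of coordinate functions on the affine space \<open>S\<close>.\<close>

definition coordinate_space :: "'a set \<Rightarrow> ('a \<Rightarrow> complex) set \<Rightarrow> 'a fspace"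
  where "coordinate_space S C =
    \<lparr>zariski = zariski_topology S C,
     regular = (\<lambda>U f. openin (zariski_topology S C) U \<and>
       (\<forall>x\<in>U. \<exists>V p q. openin (zariski_topology S C) V \<and> x \<in> V \<and> V \<subseteq> U \<and>
          p \<in> polys C \<and> q \<in> polys C \<and> (\<forall>y\<in>V. q y \<noteq> 0 \<and> f y = p y / q y)))\<rparr>"

definition affine_space :: "nat \<Rightarrow> (nat \<Rightarrow> complex) fspace"
  where "affine_space n = coordinate_space ({..<n} \<rightarrow>\<^sub>E UNIV) {\<lambda>x. x i | i. i < n}"

definition matrix_space :: "(complex^'n^'n) fspace"
  where "matrix_space = coordinate_space UNIV {\<lambda>A. A $ i $ j | i j. True}"

text \<open>For closed \<open>Y\<close> this is the reduced closed subspace, for open \<open>Y\<close> the open subspace.\<close>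

definition induced :: "'a set \<Rightarrow> 'a fspace \<Rightarrow> 'a fspace"
  where "induced Y X =
    \<lparr>zariski = subtopology (zariski X) Y,
     regular = (\<lambda>V f. openin (subtopology (zariski X) Y) V \<and>
       (\<forall>x\<in>V. \<exists>U g. openin (zariski X) U \<and> x \<in> U \<and> regular X U g \<and>
          (\<forall>y \<in> U \<inter> V. f y = g y)))\<rparr>"

definition quotient_topology :: "'a topology \<Rightarrow> ('a \<Rightarrow> 'b) \<Rightarrow> 'b topology"
  where "quotient_topology X \<pi> =
    topology (\<lambda>U. U \<subseteq> \<pi> ` topspace X \<and> openin X {x \<in> topspace X. \<pi> x \<in> U})"

lemma openin_quotient_topology:
  "openin (quotient_topology X \<pi>) U \<longleftrightarrow>
     U \<subseteq> \<pi> ` topspace X \<and> openin X {x \<in> topspace X. \<pi> x \<in> U}"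
proof -
  have "istopology (\<lambda>U. U \<subseteq> \<pi> ` topspace X \<and> openin X {x \<in> topspace X. \<pi> x \<in> U})"
    unfolding istopology_def
  proof (intro conjI allI impI)
    fix U V
    assume "U \<subseteq> \<pi> ` topspace X \<and> openin X {x \<in> topspace X. \<pi> x \<in> U}"
      and "V \<subseteq> \<pi> ` topspace X \<and> openin X {x \<in> topspace X. \<pi> x \<in> V}"
    moreover have "{x \<in> topspace X. \<pi> x \<in> U \<inter> V} =
        {x \<in> topspace X. \<pi> x \<in> U} \<inter> {x \<in> topspace X. \<pi> x \<in> V}" by auto
    ultimately show "U \<inter> V \<subseteq> \<pi> ` topspace X" "openin X {x \<in> topspace X. \<pi> x \<in> U \<inter> V}"
      by (auto simp only: openin_Int)
  next
    fix K
    assume K: "\<forall>U\<in>K. U \<subseteq> \<pi> ` topspace X \<and> openin X {x \<in> topspace X. \<pi> x \<in> U}"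
    then show "\<Union>K \<subseteq> \<pi> ` topspace X" by (simp add: Sup_le_iff)
    have "{x \<in> topspace X. \<pi> x \<in> \<Union>K} = (\<Union>U\<in>K. {x \<in> topspace X. \<pi> x \<in> U})" by auto
    then show "openin X {x \<in> topspace X. \<pi> x \<in> \<Union>K}" using K by (simp only:) (rule openin_Union, auto)
  qed
  then show ?thesis
    unfolding quotient_topology_def by (simp only: topology_inverse')
qed

definition quotient_space :: "'a fspace \<Rightarrow> ('a \<Rightarrow> 'b) \<Rightarrow> 'b fspace"
  where "quotient_space X \<pi> =
    \<lparr>zariski = quotient_topology (zariski X) \<pi>,
     regular = (\<lambda>U f. openin (quotient_topology (zariski X) \<pi>) U \<and>
       regular X {x \<in> points X. \<pi> x \<in> U} (f \<circ> \<pi>))\<rparr>"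

text \<open>
  The product in the category of spaces with functions; on varieties it is the product of
  varieties.  Its topology is generated by the non-vanishing loci of sums of products of regular
  functions on the factors, and is finer than the product topology.
\<close>

definition tensors :: "'a fspace \<Rightarrow> 'b fspace \<Rightarrow> 'a set \<Rightarrow> 'b set \<Rightarrow> ('a \<times> 'b \<Rightarrow> complex) set"
  where "tensors X Y U V =
    {\<lambda>z. \<Sum>i<n. g i (fst z) * h i (snd z) | (n::nat) g h.
       \<forall>i<n. regular X U (g i) \<and> regular Y V (h i)}"

definition product_zariski :: "'a fspace \<Rightarrow> 'b fspace \<Rightarrow> ('a \<times> 'b) topology"
  where "product_zariski X Y = topology_generated_by
    {{z \<in> U \<times> V. p z \<noteq> 0} | U V p.
       openin (zariski X) U \<and> openin (zariski Y) V \<and> p \<in> tensors X Y U V}"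

definition product_space :: "'a fspace \<Rightarrow> 'b fspace \<Rightarrow> ('a \<times> 'b) fspace"
  where "product_space X Y =
    \<lparr>zariski = product_zariski X Y,
     regular = (\<lambda>W f. openin (product_zariski X Y) W \<and>
       (\<forall>z\<in>W. \<exists>U V p q. openin (zariski X) U \<and> openin (zariski Y) V \<and>
          p \<in> tensors X Y U V \<and> q \<in> tensors X Y U V \<and> z \<in> U \<times> V \<and> q z \<noteq> 0 \<and>
          (\<forall>y \<in> W \<inter> U \<times> V. q y \<noteq> 0 \<longrightarrow> f y = p y / q y)))\<rparr>"

definition morphism :: "'a fspace \<Rightarrow> 'b fspace \<Rightarrow> ('a \<Rightarrow> 'b) \<Rightarrow> bool"
  where "morphism X Y \<phi> \<longleftrightarrow> continuous_map (zariski X) (zariski Y) \<phi> \<and>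
    (\<forall>V f. openin (zariski Y) V \<and> regular Y V f \<longrightarrow>
       regular X {x \<in> points X. \<phi> x \<in> V} (f \<circ> \<phi>))"

definition isomorphic_spaces :: "'a fspace \<Rightarrow> 'b fspace \<Rightarrow> bool"
  where "isomorphic_spaces X Y \<longleftrightarrow> (\<exists>\<phi> \<psi>. morphism X Y \<phi> \<and> morphism Y X \<psi> \<and>
    (\<forall>x \<in> points X. \<psi> (\<phi> x) = x) \<and> (\<forall>y \<in> points Y. \<phi> (\<psi> y) = y))"

section \<open>Normal varieties\<close>

text \<open>Affine varieties are not required to be irreducible here.\<close>

definition affine_variety :: "'a fspace \<Rightarrow> bool"
  where "affine_variety X \<longleftrightarrow> (\<exists>n Z. closedin (zariski (affine_space n)) Z \<and>
    isomorphic_spaces X (induced Z (affine_space n)))"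

definition irreducible_topology :: "'a topology \<Rightarrow> bool"
  where "irreducible_topology T \<longleftrightarrow> topspace T \<noteq> {} \<and>
    (\<forall>A B. closedin T A \<and> closedin T B \<and> A \<union> B = topspace T \<longrightarrow>
       A = topspace T \<or> B = topspace T)"

text \<open>Varieties are irreducible, separated and of finite type.\<close>

definition variety :: "'a fspace \<Rightarrow> bool"
  where "variety X \<longleftrightarrow>
    irreducible_topology (zariski X) \<and>
    (\<exists>\<U>. finite \<U> \<and> \<Union>\<U> = points X \<and>
       (\<forall>U\<in>\<U>. openin (zariski X) U \<and> affine_variety (induced U X))) \<and>
    closedin (zariski (product_space X X)) {(x, x) | x. x \<in> points X}"

text \<open>
  Every local ring is integrally closed in its field of fractions, which for a variety is the
  function field.  A rational function is given by \<open>f\<close> regular on a nonempty open \<open>U\<close>; the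
  coefficients \<open>a i\<close> of the monic equation are regular on a neighbourhood \<open>V\<close> of \<open>x\<close>.
\<close>

definition normal_variety :: "'a fspace \<Rightarrow> bool"
  where "normal_variety X \<longleftrightarrow> variety X \<and>
    (\<forall>x \<in> points X. \<forall>U V f (n::nat) a.
       openin (zariski X) U \<and> U \<noteq> {} \<and> regular X U f \<and>
       openin (zariski X) V \<and> x \<in> V \<and> (\<forall>i<n. regular X V (a i)) \<and>
       (\<forall>y \<in> U \<inter> V. f y ^ n + (\<Sum>i<n. a i y * f y ^ i) = 0) \<longrightarrow>
       (\<exists>V' g. openin (zariski X) V' \<and> x \<in> V' \<and> regular X V' g \<and>
          (\<forall>y \<in> U \<inter> V'. g y = f y)))"

section \<open>Linear algebraic groups\<close>

definition SL :: "(complex^'n^'n) monoid"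
  where "SL = \<lparr>carrier = {A. det A = 1}, mult = (**), one = mat 1\<rparr>"

text \<open>Linear algebraic groups are Zariski closed subgroups of a special linear group.\<close>

definition algebraic_group :: "(complex^'n^'n) set \<Rightarrow> bool"
  where "algebraic_group H \<longleftrightarrow> subgroup H SL \<and> closedin (zariski matrix_space) H"

definition connected_group :: "(complex^'n^'n) set \<Rightarrow> bool"
  where "connected_group H \<longleftrightarrow> algebraic_group H \<and> connectedin (zariski matrix_space) H"

text \<open>
  The power of \<open>A - mat 1\<close> is spelled out, since \<open>^\<close> on vectors is the componentwise power.
\<close>

definition unipotent :: "complex^'n^'n \<Rightarrow> bool"
  where "unipotent A \<longleftrightarrow> (\<exists>k. (((**) (A - mat 1)) ^^ k) (mat 1) = 0)"

definition unipotent_radical :: "(complex^'n^'n) set \<Rightarrow> (complex^'n^'n) set"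
  where "unipotent_radical H =
    (GREATEST U. connected_group U \<and> U \<lhd> SL\<lparr>carrier := H\<rparr> \<and> (\<forall>A\<in>U. unipotent A))"

definition connected_reductive :: "(complex^'n^'n) set \<Rightarrow> bool"
  where "connected_reductive H \<longleftrightarrow> connected_group H \<and> unipotent_radical H = {mat 1}"

definition borel_subgroup :: "(complex^'n^'n) set \<Rightarrow> (complex^'n^'n) set \<Rightarrow> bool"
  where "borel_subgroup K H \<longleftrightarrow>
    K \<subseteq> H \<and> connected_group K \<and> solvable (SL\<lparr>carrier := K\<rparr>) \<and>
    (\<forall>K'. K \<subseteq> K' \<and> K' \<subseteq> H \<and> connected_group K' \<and> solvable (SL\<lparr>carrier := K'\<rparr>) \<longrightarrow> K' = K)"

text \<open>
  \<open>P\<close> is the semidirect product of \<open>L\<close> and its unipotent radical.  In characteristic zero the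
  bijective product morphism is automatically an isomorphism of varieties.
\<close>

definition levi_subgroup :: "(complex^'n^'n) set \<Rightarrow> (complex^'n^'n) set \<Rightarrow> bool"
  where "levi_subgroup L P \<longleftrightarrow> algebraic_group L \<and>
    L \<inter> unipotent_radical P = {mat 1} \<and> L <#>\<^bsub>SL\<^esub> unipotent_radical P = P"

definition algebraic_action ::
    "(complex^'n^'n) set \<Rightarrow> 'x fspace \<Rightarrow> (complex^'n^'n \<Rightarrow> 'x \<Rightarrow> 'x) \<Rightarrow> bool"
  where "algebraic_action H Y act \<longleftrightarrow>
    group_action (SL\<lparr>carrier := H\<rparr>) (points Y) (\<lambda>h. restrict (act h) (points Y)) \<and>
    morphism (product_space (induced H matrix_space) Y) Y (\<lambda>(h, y). act h y)"

definition spherical_variety ::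
    "(complex^'n^'n) set \<Rightarrow> 'x fspace \<Rightarrow> (complex^'n^'n \<Rightarrow> 'x \<Rightarrow> 'x) \<Rightarrow> bool"
  where "spherical_variety H Y act \<longleftrightarrow>
    connected_reductive H \<and> normal_variety Y \<and> algebraic_action H Y act \<and>
    (\<exists>K. borel_subgroup K H \<and>
       (\<exists>y \<in> points Y. openin (zariski Y) (orbit (SL\<lparr>carrier := K\<rparr>) act y) \<and>
          zariski Y closure_of orbit (SL\<lparr>carrier := K\<rparr>) act y = points Y))"

section \<open>Schubert varieties in the flag variety of \<open>SL\<^sub>3\<close>\<close>

abbreviation SL3 :: "(complex^3^3) monoid"
  where "SL3 \<equiv> SL"

text \<open>Rows and columns are numbered 1, 2, 3 as usual (in the type \<open>3\<close> the index 3 equals 0).\<close>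

definition upper_triangular :: "(complex^3^3) set"
  where "upper_triangular = {A \<in> carrier SL3. A $ 2 $ 1 = 0 \<and> A $ 3 $ 1 = 0 \<and> A $ 3 $ 2 = 0}"

definition diagonal_torus :: "(complex^3^3) set"
  where "diagonal_torus = {A \<in> carrier SL3. \<forall>i j. i \<noteq> j \<longrightarrow> A $ i $ j = 0}"

text \<open>Elements of the Weyl group are cosets of \<open>diagonal_torus\<close>, that is, sets of matrices.\<close>

definition weyl_group :: "(complex^3^3) set monoid"
  where "weyl_group = SL3\<lparr>carrier := normalizer SL3 diagonal_torus\<rparr> Mod diagonal_torus"

definition flag_variety :: "(complex^3^3) set fspace"
  where "flag_variety = quotient_space (induced (carrier SL3) matrix_space)
    (\<lambda>g. g <#\<^bsub>SL3\<^esub> upper_triangular)"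

definition translate :: "complex^3^3 \<Rightarrow> (complex^3^3) set \<Rightarrow> (complex^3^3) set"
  where "translate g x = g <#\<^bsub>SL3\<^esub> x"

definition schubert_set :: "(complex^3^3) set \<Rightarrow> (complex^3^3) set set"
  where "schubert_set w =
    zariski flag_variety closure_of
      (\<lambda>g. g <#\<^bsub>SL3\<^esub> upper_triangular) `
        (upper_triangular <#>\<^bsub>SL3\<^esub> w <#>\<^bsub>SL3\<^esub> upper_triangular)"

definition schubert_variety :: "(complex^3^3) set \<Rightarrow> (complex^3^3) set fspace"
  where "schubert_variety w = induced (schubert_set w) flag_variety"

definition schubert_stabilizer :: "(complex^3^3) set \<Rightarrow> (complex^3^3) set"
  where "schubert_stabilizer w = stabilizer SL3 (\<lambda>g X. translate g ` X) (schubert_set w)"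

definition schubert_levi :: "(complex^3^3) set \<Rightarrow> (complex^3^3) set"
  where "schubert_levi w = (THE M. levi_subgroup M (schubert_stabilizer w) \<and> diagonal_torus \<subseteq> M)"

end

theory Submission
  imports
    Defs
    "HOL-Computational_Algebra.Polynomial_Factorial"
    "HOL-Computational_Algebra.Field_as_Ring"
    "HOL-Computational_Algebra.Fundamental_Theorem_Algebra"
begin

text \<open>
  A Schubert variety is the image in \<open>G/B\<close> of a closed irreducible set \<open>S\<close> of matrices with
  \<open>S B = S\<close>.  In each of the six translates of the opposite big cell, which are affine
  three-spaces, it is the image of a polynomial retraction; pulling fractions back along the
  retraction reduces normality to unique factorization in three variables.  Local sections of
  \<open>G \<rightarrow> G/B\<close> give separatedness and the algebraicity of the action.

  The stabilizer of \<open>X\<^sub>w\<close> consists of the matrices of determinant one supported on a preorder \<open>R\<close>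
  of the indices.  Its unipotent radical and its Levi subgroup correspond to the strict and the
  symmetric part of \<open>R\<close>, and the upper triangular matrices of the Levi subgroup form a Borel
  subgroup of it: any larger group contains two transvections that generate a copy of \<open>SL\<^sub>2\<close>.  The
  dense orbit of this Borel subgroup is the locus in \<open>S\<close> where a product of semi-invariants does
  not vanish.
\<close>

text \<open>A retraction is used rather than an isomorphism with a smaller affine space, so that the
  coordinate subspaces and the graph \<open>x 2 = x 0 * x 1\<close> that occur in the charts are all
  treated in one fixed polynomial ring.

  The group theory is shaped by extremal definitions: the unipotent radical is a greatest subgroup,
  the Levi subgroup a unique one and a Borel subgroup a maximal one, so every competitor has to be
  excluded. Unipotent normal subgroups are bounded by traces: a unipotent matrix has trace 3, and
  comparing \<open>A ** A\<close> with \<open>A\<close> times a conjugate of \<open>A\<close>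
  isolates the square of a single entry. A Levi subgroup is pinned down by a diagonal matrix whose
  entries agree exactly within its blocks.

  The semi-invariants express the position of a flag relative to the lines and planes fixed by the
  Borel subgroup of the Levi subgroup. On the two surfaces the representative \<open>n\<close> of
  \<open>w\<close> is itself in special position, and a factor from \<open>B\<close> has to move it
  into the open orbit.\<close>

lemma polys_sum: "(\<And>i. i \<in> I \<Longrightarrow> f i \<in> polys C) \<Longrightarrow> (\<lambda>x. \<Sum>i\<in>I. f i x) \<in> polys C"
  by (induction I rule: infinite_finite_induct) (auto intro: polys.const polys.add)

lemma polys_prod: "(\<And>i. i \<in> I \<Longrightarrow> f i \<in> polys C) \<Longrightarrow> (\<lambda>x. \<Prod>i\<in>I. f i x) \<in> polys C"
  by (induction I rule: infinite_finite_induct) (auto intro: polys.const polys.mult)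

lemma polys_power: "f \<in> polys C \<Longrightarrow> (\<lambda>x. f x ^ n) \<in> polys C"
  by (induction n) (auto intro: polys.const polys.mult)

lemma polys_uminus: "f \<in> polys C \<Longrightarrow> (\<lambda>x. - f x) \<in> polys C"
  using polys.mult[OF polys.const[of "-1"], of f C] by simp

lemma polys_diff: "f \<in> polys C \<Longrightarrow> g \<in> polys C \<Longrightarrow> (\<lambda>x. f x - g x) \<in> polys C"
  using polys.add[OF _ polys_uminus, of f C g] by simp

lemmas polys_intros = polys.const polys.add polys.mult polys_sum polys_prod
  polys_power polys_uminus polys_diff

lemma polys_comp:
  assumes "f \<in> polys C" and "\<And>c. c \<in> C \<Longrightarrow> (\<lambda>x. c (\<phi> x)) \<in> polys D"
  shows "(\<lambda>x. f (\<phi> x)) \<in> polys D"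
  using assms by (induction) (auto intro: polys_intros)

subsection \<open>Polynomials in three variables\<close>

text \<open>Nested univariate polynomials have gcds, because factoriality is inherited layer by
  layer. The outermost layer is the variable \<open>x 2\<close>, the innermost
  \<open>x 0\<close>.\<close>

definition peval :: "complex poly poly poly \<Rightarrow> (nat \<Rightarrow> complex) \<Rightarrow> complex"
  where "peval P x = poly (poly (poly P [:[:x 2:]:]) [:x 1:]) (x 0)"

lemma peval_simps [simp]:
  "peval (P + Q) x = peval P x + peval Q x"
  "peval (P * Q) x = peval P x * peval Q x"
  "peval 0 x = 0" "peval 1 x = 1"
  "peval (P ^ n) x = peval P x ^ n"
  by (simp_all add: peval_def)

lemma peval_sum [simp]: "peval (\<Sum>i\<in>I. f i) x = (\<Sum>i\<in>I. peval (f i) x)"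
  by (induction I rule: infinite_finite_induct) auto

lemma poly_zero_const_args:
  fixes P :: "'a::{idom} poly"
  assumes "infinite S" "\<And>a. a \<in> S \<Longrightarrow> poly P a = 0"
  shows "P = 0"
  using assms poly_roots_finite[of P] by (metis (mono_tags, lifting) finite_subset mem_Collect_eq subsetI)

text \<open>A nonzero univariate polynomial over a domain has finitely many roots, so the three
  layers can be peeled off by substituting constants, the outermost first. The value
  \<open>undefined\<close> from 3 on singles out the points of \<open>A3\<close>.\<close>

lemma peval_eq_0_imp:
  assumes "\<And>x. (\<And>i. i \<ge> 3 \<Longrightarrow> x i = undefined) \<Longrightarrow> peval P x = 0"
  shows "P = 0"
proof (rule poly_zero_const_args)
  show "infinite (range (\<lambda>a::complex. [:[:a:]:]))"
    by (subst finite_image_iff) (auto simp: infinite_UNIV_char_0 inj_def)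
  fix A assume "A \<in> range (\<lambda>a::complex. [:[:a:]:])"
  then obtain a where A: "A = [:[:a:]:]" by auto
  show "poly P A = 0"
  proof (rule poly_zero_const_args)
    show "infinite (range (\<lambda>a::complex. [:a:]))"
      by (subst finite_image_iff) (auto simp: infinite_UNIV_char_0 inj_def)
    fix B assume "B \<in> range (\<lambda>a::complex. [:a:])"
    then obtain b where B: "B = [:b:]" by auto
    show "poly (poly P A) B = 0"
    proof (rule poly_zero_const_args)
      show "infinite (UNIV :: complex set)" by (simp add: infinite_UNIV_char_0)
      fix c :: complex
      have "peval P (\<lambda>i. if i = 0 then c else if i = 1 then b else if i = 2 then a else undefined) = 0"
        by (rule assms) auto
      then show "poly (poly (poly P A) B) c = 0"
        by (simp add: peval_def A B)
    qed
  qed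
qed

abbreviation A3 :: "(nat \<Rightarrow> complex) set" where "A3 \<equiv> {..<3} \<rightarrow>\<^sub>E UNIV"

abbreviation coords3 :: "((nat \<Rightarrow> complex) \<Rightarrow> complex) set"
  where "coords3 \<equiv> {\<lambda>x. x i | i. i < (3::nat)}"

lemma coord3_polys: "i < 3 \<Longrightarrow> (\<lambda>x. x i) \<in> polys coords3"
  by (rule polys.coord) auto

lemma coord3_cases: "c \<in> coords3 \<Longrightarrow> c = (\<lambda>x. x 0) \<or> c = (\<lambda>x. x 1) \<or> c = (\<lambda>x. x 2)"
proof -
  assume "c \<in> coords3"
  then obtain i where "c = (\<lambda>x. x i)" "i < 3" by auto
  then show ?thesis by (auto simp: less_Suc_eq numeral_3_eq_3 numeral_2_eq_2)
qed

lemma polys_imp_peval: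
  assumes "f \<in> polys coords3" shows "\<exists>P. f = peval P"
  using assms
proof induction
  case (const c)
  show ?case by (rule exI[of _ "[:[:[:c:]:]:]"]) (auto simp: peval_def)
next
  case (coord f)
  have "(\<lambda>x. x 0) = peval [:[:[:0,1:]:]:]" "(\<lambda>x. x 1) = peval [:[:0,1:]:]"
    "(\<lambda>x. x 2) = peval [:0,1:]"
    by (auto simp: peval_def)
  with coord3_cases[OF coord] show ?case by metis
next
  case (add f g)
  then obtain P Q where "f = peval P" "g = peval Q" by blast
  then show ?case by (intro exI[of _ "P + Q"]) auto
next
  case (mult f g)
  then obtain P Q where "f = peval P" "g = peval Q" by blast
  then show ?case by (intro exI[of _ "P * Q"]) auto
qed

lemma peval_polys: "peval P \<in> polys coords3"
proof -
  have x: "(\<lambda>x. x 0) \<in> polys coords3" "(\<lambda>x. x (Suc 0)) \<in> polys coords3" "(\<lambda>x. x 2) \<in> polys coords3"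
    by (auto intro: coord3_polys)
  have 1: "(\<lambda>x. poly p (x 0)) \<in> polys coords3" for p :: "complex poly"
    by (induction p) (auto intro!: polys_intros(1,2,3) x)
  have 2: "(\<lambda>x. poly (poly p [:x 1:]) (x 0)) \<in> polys coords3" for p :: "complex poly poly"
    by (induction p) (auto intro!: polys_intros(1,2,3) x 1)
  have 3: "(\<lambda>x. poly (poly (poly p [:[:x 2:]:]) [:x 1:]) (x 0)) \<in> polys coords3"
    for p :: "complex poly poly poly"
    by (induction p) (use 2 in \<open>auto intro!: polys_intros(1,2,3) x\<close>)
  show ?thesis
    unfolding peval_def using 3 .
qed

text \<open>This is the rational root theorem with denominators cleared. In the proof of normality
  \<open>C\<close> is a common denominator of the coefficients, nonzero at the point in question, so
  \<open>Q' dvd C\<close> keeps the reduced denominator nonzero there.\<close>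

lemma reduced_fraction:
  fixes P Q C :: "complex poly poly poly"
  assumes "Q \<noteq> 0"
  obtains D P' Q' where "P = D * P'" "Q = D * Q'" "D \<noteq> 0"
    "\<And>n b. P ^ n * C + (\<Sum>i<n. b i * P ^ i * Q ^ (n - i)) = 0 \<Longrightarrow> Q' dvd C"
proof -
  define D where "D = gcd P Q"
  have D: "D \<noteq> 0" using assms by (simp add: D_def)
  obtain P' Q' where PQ: "P = P' * D" "Q = Q' * D" "coprime P' Q'"
    using gcd_coprime_exists[of P Q] D unfolding D_def by metis
  have "Q' dvd C" if eq: "P ^ n * C + (\<Sum>i<n. b i * P ^ i * Q ^ (n - i)) = 0" for n b
  proof -
    \<comment> \<open>The equation is homogeneous of degree \<open>n\<close> in \<open>P\<close> and
      \<open>Q\<close>, so the common factor \<open>D ^ n\<close> can be cancelled.\<close>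
    have "b i * P ^ i * Q ^ (n - i) = D ^ n * (b i * P' ^ i * Q' ^ (n - i))" if "i < n" for i
    proof -
      have "D ^ n = D ^ i * D ^ (n - i)" using that by (simp flip: power_add)
      then show ?thesis by (simp add: PQ(1,2) power_mult_distrib)
    qed
    then have "(\<Sum>i<n. b i * P ^ i * Q ^ (n - i)) = (\<Sum>i<n. D ^ n * (b i * P' ^ i * Q' ^ (n - i)))"
      by (intro sum.cong) auto
    moreover have "P ^ n * C = D ^ n * (P' ^ n * C)"
      by (simp add: PQ(1) power_mult_distrib)
    ultimately have "D ^ n * (P' ^ n * C + (\<Sum>i<n. b i * P' ^ i * Q' ^ (n - i))) = 0"
      using eq by (simp only: distrib_left sum_distrib_left)
    then have "P' ^ n * C = - (\<Sum>i<n. b i * P' ^ i * Q' ^ (n - i))"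
      using D by (simp only: eq_neg_iff_add_eq_0 mult_eq_0_iff power_not_zero) simp
    moreover have "Q' dvd (\<Sum>i<n. b i * P' ^ i * Q' ^ (n - i))"
      by (rule dvd_sum) (intro dvd_mult dvd_power, auto)
    ultimately have "Q' dvd P' ^ n * C" by (simp only: dvd_minus_iff)
    moreover have "coprime Q' (P' ^ n)" using PQ(3) by (simp add: coprime_commute)
    ultimately show ?thesis by (simp add: coprime_dvd_mult_right_iff)
  qed
  moreover have "P = D * P'" "Q = D * Q'" using PQ(1,2) by (simp_all only: mult.commute)
  ultimately show thesis using that D by blast
qed

subsection \<open>Sheaves of functions\<close>

text \<open>The sheaf properties shared by coordinate spaces, subspaces and quotients, so that these
  constructions can be iterated. \<open>regular_local\<close> also lets a function be changed
  outside \<open>U\<close>, where its values carry no meaning.\<close>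

locale ringed =
  fixes X :: "'a fspace"
  assumes regular_open: "regular X U f \<Longrightarrow> openin (zariski X) U"
    and regular_restrict: "regular X U f \<Longrightarrow> openin (zariski X) V \<Longrightarrow> V \<subseteq> U \<Longrightarrow> regular X V f"
    and regular_local: "openin (zariski X) U \<Longrightarrow>
      (\<And>x. x \<in> U \<Longrightarrow> \<exists>V g. x \<in> V \<and> V \<subseteq> U \<and> regular X V g \<and> (\<forall>y\<in>V. g y = f y)) \<Longrightarrow> regular X U f"
    and regular_const: "openin (zariski X) U \<Longrightarrow> regular X U (\<lambda>_. c)"
    and regular_add: "regular X U f \<Longrightarrow> regular X U g \<Longrightarrow> regular X U (\<lambda>x. f x + g x)"
    and regular_mult: "regular X U f \<Longrightarrow> regular X U g \<Longrightarrow> regular X U (\<lambda>x. f x * g x)"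
    and regular_nonzero_open: "regular X U f \<Longrightarrow> openin (zariski X) {x \<in> U. f x \<noteq> 0}"
    and regular_inverse: "regular X U f \<Longrightarrow> (\<And>x. x \<in> U \<Longrightarrow> f x \<noteq> 0) \<Longrightarrow> regular X U (\<lambda>x. 1 / f x)"
begin

lemma regular_cong:
  assumes "regular X U f" "\<And>x. x \<in> U \<Longrightarrow> f x = g x"
  shows "regular X U g"
  using assms regular_open by (intro regular_local) blast+

lemma regular_polys:
  assumes "f \<in> polys C" "openin (zariski X) U" "\<And>c. c \<in> C \<Longrightarrow> regular X U (\<lambda>x. c (\<phi> x))"
  shows "regular X U (\<lambda>x. f (\<phi> x))"
  using assms by induction (auto intro: regular_const regular_add regular_mult)

lemma regular_divide:
  assumes "regular X U f" "regular X U g" "\<And>x. x \<in> U \<Longrightarrow> g x \<noteq> 0"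
  shows "regular X U (\<lambda>x. f x / g x)"
  using regular_mult[OF assms(1) regular_inverse[OF assms(2)]] assms(3) by simp

end

section \<open>Coordinate spaces, subspaces and quotients\<close>

lemma openin_zariski_iff:
  "openin (zariski_topology S C) U \<longleftrightarrow>
    U \<subseteq> S \<and> (\<forall>x\<in>U. \<exists>f\<in>polys C. f x \<noteq> 0 \<and> (\<forall>y\<in>S. f y \<noteq> 0 \<longrightarrow> y \<in> U))"
proof
  assume "openin (zariski_topology S C) U"
  then obtain F where F: "F \<subseteq> polys C" "U = S - {x \<in> S. \<forall>f\<in>F. f x = 0}"
    unfolding openin_zariski_topology by blast
  then show "U \<subseteq> S \<and> (\<forall>x\<in>U. \<exists>f\<in>polys C. f x \<noteq> 0 \<and> (\<forall>y\<in>S. f y \<noteq> 0 \<longrightarrow> y \<in> U))"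
    by blast
next
  assume R: "U \<subseteq> S \<and> (\<forall>x\<in>U. \<exists>f\<in>polys C. f x \<noteq> 0 \<and> (\<forall>y\<in>S. f y \<noteq> 0 \<longrightarrow> y \<in> U))"
  show "openin (zariski_topology S C) U"
    unfolding openin_zariski_topology
    by (rule exI[of _ "{f \<in> polys C. \<forall>y\<in>S. f y \<noteq> 0 \<longrightarrow> y \<in> U}"]) (use R in blast)
qed

lemma topspace_zariski [simp]: "topspace (zariski_topology S C) = S"
proof -
  have "openin (zariski_topology S C) S"
    unfolding openin_zariski_iff using polys.const[of 1 C] by (intro conjI ballI bexI[of _ "\<lambda>_. 1"]) auto
  moreover have "topspace (zariski_topology S C) \<subseteq> S"
    using openin_topspace[of "zariski_topology S C", unfolded openin_zariski_iff] by (rule conjunct1)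
  ultimately show ?thesis by (intro subset_antisym openin_subset)
qed

lemma openin_zariski_nonzero:
  assumes "f \<in> polys C" "openin (zariski_topology S C) U"
  shows "openin (zariski_topology S C) {x \<in> U. f x \<noteq> 0}"
proof -
  have "openin (zariski_topology S C) {x \<in> S. f x \<noteq> 0}"
    unfolding openin_zariski_iff using assms by blast
  moreover have "{x \<in> U. f x \<noteq> 0} = U \<inter> {x \<in> S. f x \<noteq> 0}"
    using openin_subset[OF assms(2)] by auto
  ultimately show ?thesis using assms(2) by (metis openin_Int)
qed

lemma closedin_zariski_zeros:
  "F \<subseteq> polys C \<Longrightarrow> closedin (zariski_topology S C) {x \<in> S. \<forall>f\<in>F. f x = 0}"
  unfolding closedin_def openin_zariski_topology by auto

lemma coordinate_space_simps:
  "zariski (coordinate_space S C) = zariski_topology S C"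
  "regular (coordinate_space S C) U f \<longleftrightarrow> openin (zariski_topology S C) U \<and>
       (\<forall>x\<in>U. \<exists>V p q. openin (zariski_topology S C) V \<and> x \<in> V \<and> V \<subseteq> U \<and>
          p \<in> polys C \<and> q \<in> polys C \<and> (\<forall>y\<in>V. q y \<noteq> 0 \<and> f y = p y / q y))"
  by (simp_all add: coordinate_space_def)

declare coordinate_space_simps(1) [simp]

lemma regular_coordinate_polys:
  assumes "p \<in> polys C" "openin (zariski_topology S C) U"
  shows "regular (coordinate_space S C) U p"
  unfolding coordinate_space_simps
proof (intro conjI ballI assms(2))
  fix x assume "x \<in> U"
  then show "\<exists>V pa q. openin (zariski_topology S C) V \<and> x \<in> V \<and> V \<subseteq> U \<and>
          pa \<in> polys C \<and> q \<in> polys C \<and> (\<forall>y\<in>V. q y \<noteq> 0 \<and> p y = pa y / q y)"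
    using assms polys.const[of 1 C] by (intro exI[of _ U] exI[of _ p] exI[of _ "\<lambda>_. 1"]) auto
qed

lemma ringed_coordinate_space: "ringed (coordinate_space S C)"
proof
  let ?X = "coordinate_space S C"
  let ?T = "zariski_topology S C"
  have two: "\<exists>V p q p' q'. openin ?T V \<and> x \<in> V \<and> V \<subseteq> U \<and> p \<in> polys C \<and> q \<in> polys C \<and>
      p' \<in> polys C \<and> q' \<in> polys C \<and>
      (\<forall>y\<in>V. q y \<noteq> 0 \<and> f y = p y / q y \<and> q' y \<noteq> 0 \<and> g y = p' y / q' y)"
    if fg: "regular ?X U f" "regular ?X U g" and x: "x \<in> U" for U f g x
  proof -
    obtain V p q where 1: "openin ?T V" "x \<in> V" "V \<subseteq> U" "p \<in> polys C" "q \<in> polys C"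
      "\<forall>y\<in>V. q y \<noteq> 0 \<and> f y = p y / q y"
      using fg(1) x unfolding coordinate_space_simps by blast
    obtain V' p' q' where 2: "openin ?T V'" "x \<in> V'" "V' \<subseteq> U" "p' \<in> polys C" "q' \<in> polys C"
      "\<forall>y\<in>V'. q' y \<noteq> 0 \<and> g y = p' y / q' y"
      using fg(2) x unfolding coordinate_space_simps by blast
    show ?thesis
      by (rule exI[of _ "V \<inter> V'"], rule exI[of _ p], rule exI[of _ q], rule exI[of _ p'],
          rule exI[of _ q']) (use 1 2 in auto)
  qed
  fix U V :: "'a set" and f g :: "'a \<Rightarrow> complex" and c
  show "regular ?X U f \<Longrightarrow> openin (zariski ?X) U" by (simp add: coordinate_space_simps)
  show "openin (zariski ?X) U \<Longrightarrow> regular ?X U (\<lambda>_. c)"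
    using regular_coordinate_polys[OF polys.const] by (simp only: coordinate_space_simps(1))
  show "regular ?X V f" if r: "regular ?X U f" "openin (zariski ?X) V" "V \<subseteq> U"
    unfolding coordinate_space_simps
  proof (intro conjI ballI)
    show "openin ?T V" using r by (simp add: coordinate_space_simps)
    fix x assume x: "x \<in> V"
    then obtain W p q where "openin ?T W" "x \<in> W" "W \<subseteq> U" "p \<in> polys C" "q \<in> polys C"
      "\<forall>y\<in>W. q y \<noteq> 0 \<and> f y = p y / q y"
      using r unfolding coordinate_space_simps by blast
    then show "\<exists>V' p q. openin ?T V' \<and> x \<in> V' \<and> V' \<subseteq> V \<and> p \<in> polys C \<and> q \<in> polys C \<and>
        (\<forall>y\<in>V'. q y \<noteq> 0 \<and> f y = p y / q y)"
      using r x by (intro exI[of _ "W \<inter> V"] exI[of _ p] exI[of _ q]) auto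
  qed
  show "regular ?X U f" if r: "openin (zariski ?X) U"
      "\<And>x. x \<in> U \<Longrightarrow> \<exists>V g. x \<in> V \<and> V \<subseteq> U \<and> regular ?X V g \<and> (\<forall>y\<in>V. g y = f y)"
    unfolding coordinate_space_simps
  proof (intro conjI ballI)
    show "openin ?T U" using r by (simp add: coordinate_space_simps)
    fix x assume x: "x \<in> U"
    then obtain V g where V: "x \<in> V" "V \<subseteq> U" "regular ?X V g" "\<forall>y\<in>V. g y = f y"
      using r(2) by blast
    then obtain W p q where W: "openin ?T W" "x \<in> W" "W \<subseteq> V" "p \<in> polys C" "q \<in> polys C"
      "\<forall>y\<in>W. q y \<noteq> 0 \<and> g y = p y / q y"
      unfolding coordinate_space_simps by blast
    have "f y = p y / q y" if "y \<in> W" for y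
      using V(2,4) W(3,6) that by (metis subsetD)
    then show "\<exists>V' p q. openin ?T V' \<and> x \<in> V' \<and> V' \<subseteq> U \<and> p \<in> polys C \<and> q \<in> polys C \<and>
        (\<forall>y\<in>V'. q y \<noteq> 0 \<and> f y = p y / q y)"
      using V W by (intro exI[of _ W] exI[of _ p] exI[of _ q]) auto
  qed
  show "regular ?X U (\<lambda>x. f x + g x)" if r: "regular ?X U f" "regular ?X U g"
    unfolding coordinate_space_simps
  proof (intro conjI ballI)
    show "openin ?T U" using r by (simp add: coordinate_space_simps)
    fix x assume x: "x \<in> U"
    obtain V p q p' q' where V: "openin ?T V" "x \<in> V" "V \<subseteq> U" "p \<in> polys C" "q \<in> polys C"
      "p' \<in> polys C" "q' \<in> polys C"
      "\<And>y. y \<in> V \<Longrightarrow> q y \<noteq> 0 \<and> f y = p y / q y \<and> q' y \<noteq> 0 \<and> g y = p' y / q' y"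
      using two[OF r x] by (elim exE conjE) blast
    have "(\<lambda>x. p x * q' x + p' x * q x) \<in> polys C" "(\<lambda>x. q x * q' x) \<in> polys C"
      using V by (auto intro!: polys_intros)
    then show "\<exists>V p q. openin ?T V \<and> x \<in> V \<and> V \<subseteq> U \<and> p \<in> polys C \<and> q \<in> polys C \<and>
        (\<forall>y\<in>V. q y \<noteq> 0 \<and> f y + g y = p y / q y)"
      using V by (intro exI[of _ V] exI[of _ "\<lambda>x. p x * q' x + p' x * q x"]
          exI[of _ "\<lambda>x. q x * q' x"]) (auto simp: add_frac_eq)
  qed
  show "regular ?X U (\<lambda>x. f x * g x)" if r: "regular ?X U f" "regular ?X U g"
    unfolding coordinate_space_simps
  proof (intro conjI ballI)
    show "openin ?T U" using r by (simp add: coordinate_space_simps)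
    fix x assume x: "x \<in> U"
    obtain V p q p' q' where V: "openin ?T V" "x \<in> V" "V \<subseteq> U" "p \<in> polys C" "q \<in> polys C"
      "p' \<in> polys C" "q' \<in> polys C"
      "\<And>y. y \<in> V \<Longrightarrow> q y \<noteq> 0 \<and> f y = p y / q y \<and> q' y \<noteq> 0 \<and> g y = p' y / q' y"
      using two[OF r x] by (elim exE conjE) blast
    have "(\<lambda>x. p x * p' x) \<in> polys C" "(\<lambda>x. q x * q' x) \<in> polys C"
      using V by (auto intro!: polys_intros)
    then show "\<exists>V p q. openin ?T V \<and> x \<in> V \<and> V \<subseteq> U \<and> p \<in> polys C \<and> q \<in> polys C \<and>
        (\<forall>y\<in>V. q y \<noteq> 0 \<and> f y * g y = p y / q y)"
      using V by (intro exI[of _ V] exI[of _ "\<lambda>x. p x * p' x"]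
          exI[of _ "\<lambda>x. q x * q' x"]) auto
  qed
  show "openin (zariski ?X) {x \<in> U. f x \<noteq> 0}" if r: "regular ?X U f"
    unfolding coordinate_space_simps
  proof (subst openin_subopen, intro ballI)
    fix x assume x: "x \<in> {x \<in> U. f x \<noteq> 0}"
    then have "x \<in> U" by simp
    then obtain W p q where W: "openin ?T W" "x \<in> W" "W \<subseteq> U" "p \<in> polys C" "q \<in> polys C"
      "\<forall>y\<in>W. q y \<noteq> 0 \<and> f y = p y / q y"
      using r unfolding coordinate_space_simps by blast
    then show "\<exists>T. openin ?T T \<and> x \<in> T \<and> T \<subseteq> {x \<in> U. f x \<noteq> 0}"
      using openin_zariski_nonzero[OF W(4,1)] x
      by (intro exI[of _ "{x \<in> W. p x \<noteq> 0}"]) auto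
  qed
  show "regular ?X U (\<lambda>x. 1 / f x)" if r: "regular ?X U f" "\<And>x. x \<in> U \<Longrightarrow> f x \<noteq> 0"
    unfolding coordinate_space_simps
  proof (intro conjI ballI)
    show "openin ?T U" using r by (simp add: coordinate_space_simps)
    fix x assume x: "x \<in> U"
    then obtain W p q where W: "openin ?T W" "x \<in> W" "W \<subseteq> U" "p \<in> polys C" "q \<in> polys C"
      "\<forall>y\<in>W. q y \<noteq> 0 \<and> f y = p y / q y"
      using r(1) unfolding coordinate_space_simps by blast
    have "p y \<noteq> 0 \<and> 1 / f y = q y / p y" if "y \<in> W" for y
    proof -
      have "y \<in> U" using W(3) that by blast
      then have "f y \<noteq> 0" by (rule r(2))
      moreover have "f y = p y / q y" using W(6) that by blast
      ultimately have "f y \<noteq> 0" "f y = p y / q y" .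
      then show ?thesis by auto
    qed
    then show "\<exists>V p q. openin ?T V \<and> x \<in> V \<and> V \<subseteq> U \<and> p \<in> polys C \<and> q \<in> polys C \<and>
        (\<forall>y\<in>V. q y \<noteq> 0 \<and> 1 / f y = p y / q y)"
      using W by blast
  qed
qed

lemma induced_simps:
  "zariski (induced Y X) = subtopology (zariski X) Y"
  "regular (induced Y X) V f \<longleftrightarrow> openin (subtopology (zariski X) Y) V \<and>
       (\<forall>x\<in>V. \<exists>U g. openin (zariski X) U \<and> x \<in> U \<and> regular X U g \<and>
          (\<forall>y \<in> U \<inter> V. f y = g y))"
  by (simp_all add: induced_def)

declare induced_simps(1) [simp]

lemma regular_induced_openin: "regular (induced Y X) V f \<Longrightarrow> openin (subtopology (zariski X) Y) V"
  by (simp add: induced_simps)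

lemma (in ringed) regular_induced:
  assumes "regular X U f" "V \<subseteq> U" "openin (subtopology (zariski X) Y) V"
  shows "regular (induced Y X) V f"
  using assms regular_open[OF assms(1)] unfolding induced_simps by blast

text \<open>The neighbourhood is shrunk until \<open>Y \<inter> U\<close> lies in \<open>V\<close>;
  then the local extension \<open>g\<close> agrees with \<open>f\<close> on all of
  \<open>Y \<inter> U\<close>.\<close>

lemma (in ringed) regular_inducedE:
  assumes "regular (induced Y X) V f" "x \<in> V"
  obtains U g where "openin (zariski X) U" "x \<in> U" "Y \<inter> U \<subseteq> V" "regular X U g" "\<And>y. y \<in> U \<inter> Y \<Longrightarrow> f y = g y"
proof -
  obtain U g where U: "openin (zariski X) U" "x \<in> U" "regular X U g" "\<forall>y \<in> U \<inter> V. f y = g y"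
    using assms unfolding induced_simps by blast
  obtain W where W: "openin (zariski X) W" "V = W \<inter> Y"
    using regular_induced_openin[OF assms(1)] by (auto simp: openin_subtopology)
  show thesis
    by (rule that[of "U \<inter> W" g]) (use U W assms(2) regular_restrict[OF U(3)] in auto)
qed

lemma (in ringed) ringed_induced: "ringed (induced Y X)"
proof
  let ?Y = "induced Y X"
  let ?T = "subtopology (zariski X) Y"
  have I: "regular ?Y U f" if o: "openin ?T U"
    and l: "\<And>x. x \<in> U \<Longrightarrow> \<exists>V g. x \<in> V \<and> regular X V g \<and> (\<forall>y\<in>V \<inter> U. f y = g y)" for U f
    unfolding induced_simps
  proof (intro conjI ballI o)
    fix x assume "x \<in> U"
    then obtain V g where "x \<in> V" "regular X V g" "\<forall>y\<in>V \<inter> U. f y = g y" using l by blast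
    then show "\<exists>V g. openin (zariski X) V \<and> x \<in> V \<and> regular X V g \<and> (\<forall>y\<in>V \<inter> U. f y = g y)"
      using regular_open by blast
  qed
  have two: "\<exists>V g g'. x \<in> V \<and> Y \<inter> V \<subseteq> U \<and> regular X V g \<and> regular X V g' \<and>
      (\<forall>y\<in>V \<inter> Y. f y = g y \<and> f' y = g' y)"
    if ff: "regular ?Y U f" "regular ?Y U f'" and x: "x \<in> U" for U f f' x
  proof -
    obtain V g where V: "openin (zariski X) V" "x \<in> V" "Y \<inter> V \<subseteq> U" "regular X V g" "\<And>y. y \<in> V \<inter> Y \<Longrightarrow> f y = g y"
      using regular_inducedE[OF ff(1) x] by blast
    obtain V' g' where V': "openin (zariski X) V'" "x \<in> V'" "Y \<inter> V' \<subseteq> U" "regular X V' g'" "\<And>y. y \<in> V' \<inter> Y \<Longrightarrow> f' y = g' y"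
      using regular_inducedE[OF ff(2) x] by blast
    have "openin (zariski X) (V \<inter> V')" using V V' by auto
    then show ?thesis
      using V V' by (intro exI[of _ "V \<inter> V'"] exI[of _ g] exI[of _ g'] conjI)
        (auto intro: regular_restrict)
  qed
  fix U V :: "'a set" and f g :: "'a \<Rightarrow> complex" and c
  show O: "regular ?Y U f \<Longrightarrow> openin (zariski ?Y) U" for U f
    using regular_induced_openin by simp
  have sub: "U \<subseteq> Y" if "openin ?T U" for U using openin_imp_subset[OF that] by simp
  show "openin (zariski ?Y) U \<Longrightarrow> regular ?Y U (\<lambda>_. c)"
  proof (rule I)
    fix x assume "openin (zariski ?Y) U" "x \<in> U"
    then have "x \<in> topspace (zariski X)" using openin_subset by fastforce
    then show "\<exists>V g. x \<in> V \<and> regular X V g \<and> (\<forall>y\<in>V \<inter> U. c = g y)"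
      by (intro exI[of _ "topspace (zariski X)"] exI[of _ "\<lambda>_. c"]) (auto intro: regular_const)
  qed simp
  show "regular ?Y V f" if r: "regular ?Y U f" "openin (zariski ?Y) V" "V \<subseteq> U"
  proof (rule I)
    show "openin ?T V" using r(2) by simp
    fix x assume "x \<in> V"
    then obtain W g where "openin (zariski X) W" "x \<in> W" "Y \<inter> W \<subseteq> U" "regular X W g" "\<And>y. y \<in> W \<inter> Y \<Longrightarrow> f y = g y"
      using regular_inducedE[OF r(1)] r(3) by blast
    then show "\<exists>W g. x \<in> W \<and> regular X W g \<and> (\<forall>y\<in>W \<inter> V. f y = g y)"
      using sub[of V] r(2) by (intro exI[of _ W] exI[of _ g]) auto
  qed
  show "regular ?Y U f" if r: "openin (zariski ?Y) U"
      "\<And>x. x \<in> U \<Longrightarrow> \<exists>V g. x \<in> V \<and> V \<subseteq> U \<and> regular ?Y V g \<and> (\<forall>y\<in>V. g y = f y)"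
  proof (rule I)
    fix x assume x: "x \<in> U"
    then obtain V g where V: "x \<in> V" "V \<subseteq> U" "regular ?Y V g" "\<forall>y\<in>V. g y = f y"
      using r(2) by blast
    obtain W h where "openin (zariski X) W" "x \<in> W" "Y \<inter> W \<subseteq> V" "regular X W h" "\<And>y. y \<in> W \<inter> Y \<Longrightarrow> g y = h y"
      using regular_inducedE[OF V(3,1)] by blast
    moreover from this have "f y = h y" if "y \<in> W \<inter> U" for y
    proof -
      have "y \<in> W \<inter> Y" using that sub[of U] r(1) by auto
      then show ?thesis
        using V(4) \<open>Y \<inter> W \<subseteq> V\<close> \<open>\<And>y. y \<in> W \<inter> Y \<Longrightarrow> g y = h y\<close> by (metis IntD1 IntD2 IntI subsetD)
    qed
    ultimately show "\<exists>V g. x \<in> V \<and> regular X V g \<and> (\<forall>y\<in>V \<inter> U. f y = g y)"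
      by blast
  qed (use r in simp)
  show "regular ?Y U (\<lambda>x. f x + g x)" if r: "regular ?Y U f" "regular ?Y U g"
  proof (rule I)
    fix x assume "x \<in> U"
    then obtain V h h' where "x \<in> V" "regular X V h" "regular X V h'" "\<forall>y\<in>V \<inter> Y. f y = h y \<and> g y = h' y"
      using two[OF r] by blast
    moreover have "V \<inter> U \<subseteq> V \<inter> Y" using sub[OF O[OF r(1), simplified]] by blast
    ultimately show "\<exists>V h. x \<in> V \<and> regular X V h \<and> (\<forall>y\<in>V \<inter> U. f y + g y = h y)"
      by (intro exI[of _ V] exI[of _ "\<lambda>y. h y + h' y"]) (auto intro: regular_add)
  qed (use O[OF r(1)] in simp)
  show "regular ?Y U (\<lambda>x. f x * g x)" if r: "regular ?Y U f" "regular ?Y U g"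
  proof (rule I)
    fix x assume "x \<in> U"
    then obtain V h h' where "x \<in> V" "regular X V h" "regular X V h'" "\<forall>y\<in>V \<inter> Y. f y = h y \<and> g y = h' y"
      using two[OF r] by blast
    moreover have "V \<inter> U \<subseteq> V \<inter> Y" using sub[OF O[OF r(1), simplified]] by blast
    ultimately show "\<exists>V h. x \<in> V \<and> regular X V h \<and> (\<forall>y\<in>V \<inter> U. f y * g y = h y)"
      by (intro exI[of _ V] exI[of _ "\<lambda>y. h y * h' y"]) (auto intro: regular_mult)
  qed (use O[OF r(1)] in simp)
  show "openin (zariski ?Y) {x \<in> U. f x \<noteq> 0}" if r: "regular ?Y U f"
  proof (subst openin_subopen, intro ballI)
    fix x assume x: "x \<in> {x \<in> U. f x \<noteq> 0}"
    obtain W h where W: "openin (zariski X) W" "x \<in> W" "Y \<inter> W \<subseteq> U" "regular X W h" "\<And>y. y \<in> W \<inter> Y \<Longrightarrow> f y = h y"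
      using regular_inducedE[OF r] x by blast
    have xY: "x \<in> Y" using x sub[of U] O r by auto
    have "openin ?T ({x \<in> W. h x \<noteq> 0} \<inter> Y)"
      using regular_nonzero_open[OF W(4)] by (auto simp: openin_subtopology)
    then show "\<exists>T. openin (zariski ?Y) T \<and> x \<in> T \<and> T \<subseteq> {x \<in> U. f x \<noteq> 0}"
      using W x xY by (intro exI[of _ "{x \<in> W. h x \<noteq> 0} \<inter> Y"]) auto
  qed
  show "regular ?Y U (\<lambda>x. 1 / f x)" if r: "regular ?Y U f" "\<And>x. x \<in> U \<Longrightarrow> f x \<noteq> 0"
  proof (rule I)
    fix x assume x: "x \<in> U"
    obtain W h where W: "openin (zariski X) W" "x \<in> W" "Y \<inter> W \<subseteq> U" "regular X W h" "\<And>y. y \<in> W \<inter> Y \<Longrightarrow> f y = h y"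
      using regular_inducedE[OF r(1)] x by blast
    have xY: "x \<in> Y" using x sub[of U] O r by auto
    have "regular X {x \<in> W. h x \<noteq> 0} (\<lambda>x. 1 / h x)"
      using regular_nonzero_open[OF W(4)] W(4) by (intro regular_inverse) (auto intro: regular_restrict)
    moreover have "h x \<noteq> 0" using r(2)[OF x] W(5)[of x] W(2) xY by auto
    ultimately show "\<exists>V g. x \<in> V \<and> regular X V g \<and> (\<forall>y\<in>V \<inter> U. 1 / f y = g y)"
      using W x xY sub[OF O[OF r(1), simplified]] by (intro exI[of _ "{x \<in> W. h x \<noteq> 0}"] exI[of _ "\<lambda>x. 1 / h x"]) auto
  qed (use O[OF r(1)] in simp)
qed

text \<open>Equality, not just isomorphism, lets a chart of a subvariety be rewritten as a subspace
  of a chart of the flag variety.\<close>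

lemma (in ringed) induced_induced: "induced U (induced Y X) = induced (Y \<inter> U) X"
proof (rule fspace.equality)
  show "zariski (induced U (induced Y X)) = zariski (induced (Y \<inter> U) X)"
    by (simp add: subtopology_subtopology)
  interpret Y: ringed "induced Y X" by (rule ringed_induced)
  show "regular (induced U (induced Y X)) = regular (induced (Y \<inter> U) X)"
  proof (intro ext iffI)
    fix V f assume r: "regular (induced U (induced Y X)) V f"
    have o: "openin (subtopology (zariski X) (Y \<inter> U)) V"
      using regular_induced_openin[OF r] by (simp add: subtopology_subtopology)
    from openin_imp_subset[OF this] have s: "V \<subseteq> Y \<inter> U" .
    show "regular (induced (Y \<inter> U) X) V f"
      unfolding induced_simps
    proof (intro conjI ballI o)
      fix x assume x: "x \<in> V"
      obtain W g where W: "openin (zariski (induced Y X)) W" "x \<in> W" "U \<inter> W \<subseteq> V" "regular (induced Y X) W g"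
        "\<And>y. y \<in> W \<inter> U \<Longrightarrow> f y = g y"
        using Y.regular_inducedE[OF r x] by blast
      obtain W' h where W': "openin (zariski X) W'" "x \<in> W'" "Y \<inter> W' \<subseteq> W" "regular X W' h"
        "\<And>y. y \<in> W' \<inter> Y \<Longrightarrow> g y = h y"
        using regular_inducedE[OF W(4,2)] by blast
      have "f y = h y" if "y \<in> W' \<inter> V" for y
      proof -
        have "y \<in> W' \<inter> Y" "y \<in> U" using that s by auto
        then show ?thesis using W'(3,5) W(5) by (metis IntD1 IntD2 IntI subsetD)
      qed
      then show "\<exists>U g. openin (zariski X) U \<and> x \<in> U \<and> regular X U g \<and> (\<forall>y\<in>U \<inter> V. f y = g y)"
        using W' by blast
    qed
  next
    fix V f assume r: "regular (induced (Y \<inter> U) X) V f"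
    have o: "openin (subtopology (zariski (induced Y X)) U) V"
      using regular_induced_openin[OF r] by (simp add: subtopology_subtopology)
    then have s: "V \<subseteq> Y \<inter> U" using regular_induced_openin[OF r] openin_imp_subset[of "zariski X" "Y \<inter> U" V] by simp
    show "regular (induced U (induced Y X)) V f"
      unfolding induced_simps(2)[of U]
    proof (intro conjI ballI o)
      fix x assume x: "x \<in> V"
      obtain W g where W: "openin (zariski X) W" "x \<in> W" "Y \<inter> U \<inter> W \<subseteq> V" "regular X W g"
        "\<And>y. y \<in> W \<inter> (Y \<inter> U) \<Longrightarrow> f y = g y"
        using regular_inducedE[OF r x] by blast
      have o: "openin (subtopology (zariski X) Y) (W \<inter> Y)" using W(1) by (auto simp: openin_subtopology)
      then have "regular (induced Y X) (W \<inter> Y) g" using W by (intro regular_induced) auto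
      then show "\<exists>U g. openin (zariski (induced Y X)) U \<and> x \<in> U \<and> regular (induced Y X) U g \<and> (\<forall>y\<in>U \<inter> V. f y = g y)"
        using o W s x by (intro exI[of _ "W \<inter> Y"] exI[of _ g]) auto
    qed
  qed
qed simp

lemma quotient_space_simps [simp]:
  "zariski (quotient_space X \<pi>) = quotient_topology (zariski X) \<pi>"
  "regular (quotient_space X \<pi>) U f \<longleftrightarrow> openin (quotient_topology (zariski X) \<pi>) U \<and>
       regular X {x \<in> points X. \<pi> x \<in> U} (f \<circ> \<pi>)"
  by (simp_all add: quotient_space_def)

lemma topspace_quotient_topology [simp]: "topspace (quotient_topology X \<pi>) = \<pi> ` topspace X"
proof -
  have "openin (quotient_topology X \<pi>) (\<pi> ` topspace X)"
    unfolding openin_quotient_topology by (simp flip: Collect_mem_eq cong: conj_cong)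
  moreover have "topspace (quotient_topology X \<pi>) \<subseteq> \<pi> ` topspace X"
    using openin_topspace[of "quotient_topology X \<pi>", unfolded openin_quotient_topology] by (rule conjunct1)
  ultimately show ?thesis by (intro subset_antisym openin_subset)
qed

lemma (in ringed) ringed_quotient: "ringed (quotient_space X \<pi>)"
proof
  let ?Y = "quotient_space X \<pi>"
  let ?T = "quotient_topology (zariski X) \<pi>"
  let ?p = "\<lambda>U. {x \<in> points X. \<pi> x \<in> U}"
  fix U V :: "'b set" and f g :: "'b \<Rightarrow> complex" and c
  have op: "openin (zariski X) (?p U)" if "openin ?T U" for U
    using that by (simp add: openin_quotient_topology)
  show "regular ?Y U f \<Longrightarrow> openin (zariski ?Y) U" by simp
  show "openin (zariski ?Y) U \<Longrightarrow> regular ?Y U (\<lambda>_. c)"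
    using op by (auto simp: o_def intro: regular_const)
  show "regular ?Y V f" if r: "regular ?Y U f" "openin (zariski ?Y) V" "V \<subseteq> U"
  proof -
    have "?p V \<subseteq> ?p U" using r(3) by auto
    then show ?thesis using r op[of V] by (auto intro: regular_restrict)
  qed
  show "regular ?Y U f" if r: "openin (zariski ?Y) U"
      "\<And>x. x \<in> U \<Longrightarrow> \<exists>V g. x \<in> V \<and> V \<subseteq> U \<and> regular ?Y V g \<and> (\<forall>y\<in>V. g y = f y)"
    unfolding quotient_space_simps
  proof
    show "openin ?T U" using r by simp
    show "regular X (?p U) (f \<circ> \<pi>)"
    proof (rule regular_local)
      fix x assume "x \<in> ?p U"
      then obtain V g where "\<pi> x \<in> V" "V \<subseteq> U" "regular ?Y V g" "\<forall>y\<in>V. g y = f y" "x \<in> points X"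
        using r(2) by blast
      then show "\<exists>V g. x \<in> V \<and> V \<subseteq> ?p U \<and> regular X V g \<and> (\<forall>y\<in>V. g y = (f \<circ> \<pi>) y)"
        by (intro exI[of _ "?p V"] exI[of _ "g \<circ> \<pi>"]) auto
    qed (use r op in simp)
  qed
  show "regular ?Y U f \<Longrightarrow> regular ?Y U g \<Longrightarrow> regular ?Y U (\<lambda>x. f x + g x)"
    using regular_add[of "?p U" "f \<circ> \<pi>" "g \<circ> \<pi>"] by (auto simp: o_def)
  show "regular ?Y U f \<Longrightarrow> regular ?Y U g \<Longrightarrow> regular ?Y U (\<lambda>x. f x * g x)"
    using regular_mult[of "?p U" "f \<circ> \<pi>" "g \<circ> \<pi>"] by (auto simp: o_def)
  show "openin (zariski ?Y) {x \<in> U. f x \<noteq> 0}" if r: "regular ?Y U f"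
  proof -
    have "{x \<in> ?p U. (f \<circ> \<pi>) x \<noteq> 0} = ?p {x \<in> U. f x \<noteq> 0}" by auto
    then show ?thesis
      using r regular_nonzero_open[of "?p U" "f \<circ> \<pi>"] by (auto simp: openin_quotient_topology)
  qed
  show "regular ?Y U (\<lambda>x. 1 / f x)" if r: "regular ?Y U f" "\<And>x. x \<in> U \<Longrightarrow> f x \<noteq> 0"
    using r regular_inverse[of "?p U" "f \<circ> \<pi>"] by (auto simp: o_def)
qed

subsection \<open>Morphisms\<close>

lemma morphism_continuous: "morphism X Y \<phi> \<Longrightarrow> continuous_map (zariski X) (zariski Y) \<phi>"
  by (simp add: morphism_def)

lemma morphism_regular:
  assumes "morphism X Y \<phi>" "openin (zariski Y) V" "regular Y V f"
  shows "regular X {x \<in> points X. \<phi> x \<in> V} (f \<circ> \<phi>)"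
  using assms(1)[unfolded morphism_def, THEN conjunct2, rule_format, of V f] assms(2,3) by blast

lemma morphism_points: "morphism X Y \<phi> \<Longrightarrow> x \<in> points X \<Longrightarrow> \<phi> x \<in> points Y"
  using morphism_continuous[of X Y \<phi>] by (auto simp: continuous_map_def)

lemma morphism_openin:
  "morphism X Y \<phi> \<Longrightarrow> openin (zariski Y) V \<Longrightarrow> openin (zariski X) {x \<in> points X. \<phi> x \<in> V}"
  by (rule openin_continuous_map_preimage[OF morphism_continuous])

lemma morphism_comp:
  assumes "morphism X Y \<phi>" "morphism Y Z \<psi>"
  shows "morphism X Z (\<psi> \<circ> \<phi>)"
  unfolding morphism_def
proof (intro conjI allI impI)
  show "continuous_map (zariski X) (zariski Z) (\<psi> \<circ> \<phi>)"
    by (rule continuous_map_compose[OF assms[THEN morphism_continuous]])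
  fix V f assume V: "openin (zariski Z) V \<and> regular Z V f"
  then have "openin (zariski Y) {y \<in> points Y. \<psi> y \<in> V}" "regular Y {y \<in> points Y. \<psi> y \<in> V} (f \<circ> \<psi>)"
    using morphism_openin[OF assms(2)] morphism_regular[OF assms(2)] by blast+
  then have "regular X {x \<in> points X. \<phi> x \<in> {y \<in> points Y. \<psi> y \<in> V}} ((f \<circ> \<psi>) \<circ> \<phi>)"
    by (rule morphism_regular[OF assms(1)])
  moreover have "{x \<in> points X. \<phi> x \<in> {y \<in> points Y. \<psi> y \<in> V}} = {x \<in> points X. (\<psi> \<circ> \<phi>) x \<in> V}"
    using morphism_points[OF assms(1)] by auto
  ultimately show "regular X {x \<in> points X. (\<psi> \<circ> \<phi>) x \<in> V} (f \<circ> (\<psi> \<circ> \<phi>))"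
    by (simp add: o_assoc)
qed

lemma morphism_quotient: "morphism X (quotient_space X \<pi>) \<pi>"
  by (auto simp: morphism_def continuous_map openin_quotient_topology)

lemma (in ringed) morphism_restrict:
  assumes "morphism X Y \<phi>"
  shows "morphism (induced S X) Y \<phi>"
  unfolding morphism_def
proof (intro conjI allI impI)
  show c: "continuous_map (zariski (induced S X)) (zariski Y) \<phi>"
    using continuous_map_from_subtopology[OF morphism_continuous[OF assms]] by simp
  fix V f assume V: "openin (zariski Y) V \<and> regular Y V f"
  then have "regular X {x \<in> points X. \<phi> x \<in> V} (f \<circ> \<phi>)"
    using morphism_regular[OF assms] by blast
  then show "regular (induced S X) {x \<in> points (induced S X). \<phi> x \<in> V} (f \<circ> \<phi>)"
    using V openin_continuous_map_preimage[OF c] by (intro regular_induced) auto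
qed

lemma (in ringed) morphism_corestrict:
  assumes "morphism X Y \<phi>" "\<phi> ` points X \<subseteq> S" "ringed Y"
  shows "morphism X (induced S Y) \<phi>"
  unfolding morphism_def
proof (intro conjI allI impI)
  interpret Y: ringed Y by fact
  have c: "continuous_map (zariski X) (zariski Y) \<phi>" by (rule morphism_continuous[OF assms(1)])
  show c': "continuous_map (zariski X) (zariski (induced S Y)) \<phi>"
    using c assms(2) by (auto simp: continuous_map_in_subtopology)
  fix V f assume V: "openin (zariski (induced S Y)) V \<and> regular (induced S Y) V f"
  show "regular X {x \<in> points X. \<phi> x \<in> V} (f \<circ> \<phi>)"
  proof (rule regular_local)
    show "openin (zariski X) {x \<in> points X. \<phi> x \<in> V}"
      using openin_continuous_map_preimage[OF c'] V by blast
    fix x assume x: "x \<in> {x \<in> points X. \<phi> x \<in> V}"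
    obtain U g where U: "openin (zariski Y) U" "\<phi> x \<in> U" "S \<inter> U \<subseteq> V" "regular Y U g"
        "\<And>y. y \<in> U \<inter> S \<Longrightarrow> f y = g y"
      using Y.regular_inducedE[of S V f "\<phi> x"] V x by blast
    have "regular X {x \<in> points X. \<phi> x \<in> U} (g \<circ> \<phi>)"
      using morphism_regular[OF assms(1) U(1,4)] .
    then show "\<exists>W h. x \<in> W \<and> W \<subseteq> {x \<in> points X. \<phi> x \<in> V} \<and> regular X W h \<and> (\<forall>y\<in>W. h y = (f \<circ> \<phi>) y)"
      using U x assms(2) by (intro exI[of _ "{x \<in> points X. \<phi> x \<in> U}"] exI[of _ "g \<circ> \<phi>"]) auto
  qed
qed

text \<open>Polynomials in the coordinates pull back to regular functions; hence principal open sets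
  pull back to non-vanishing loci, and local fractions to quotients of regular functions.\<close>

lemma (in ringed) morphism_coordinate_space:
  assumes "\<And>x. x \<in> points X \<Longrightarrow> \<phi> x \<in> S" "\<And>c. c \<in> C \<Longrightarrow> regular X (points X) (\<lambda>x. c (\<phi> x))"
  shows "morphism X (coordinate_space S C) \<phi>"
  unfolding morphism_def
proof (intro conjI allI impI)
  have pol: "regular X (points X) (\<lambda>x. f (\<phi> x))" if "f \<in> polys C" for f
    using regular_polys[OF that _ assms(2)] by simp
  show c: "continuous_map (zariski X) (zariski (coordinate_space S C)) \<phi>"
    unfolding continuous_map
  proof (intro conjI allI impI)
    show "\<phi> ` points X \<subseteq> points (coordinate_space S C)" using assms(1) by auto
    fix U assume U: "openin (zariski (coordinate_space S C)) U"
    show "openin (zariski X) {x \<in> points X. \<phi> x \<in> U}"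
    proof (subst openin_subopen, intro ballI)
      fix x assume x: "x \<in> {x \<in> points X. \<phi> x \<in> U}"
      have "\<phi> x \<in> U" using x by simp
      then obtain f where "f \<in> polys C" "f (\<phi> x) \<noteq> 0" "\<forall>y\<in>S. f y \<noteq> 0 \<longrightarrow> y \<in> U"
        using U unfolding coordinate_space_simps openin_zariski_iff by meson
      then show "\<exists>T. openin (zariski X) T \<and> x \<in> T \<and> T \<subseteq> {x \<in> points X. \<phi> x \<in> U}"
        using regular_nonzero_open[OF pol[of f]] x assms(1)
        by (intro exI[of _ "{x \<in> points X. f (\<phi> x) \<noteq> 0}"]) auto
    qed
  qed
  fix V f assume V: "openin (zariski (coordinate_space S C)) V \<and> regular (coordinate_space S C) V f"
  show "regular X {x \<in> points X. \<phi> x \<in> V} (f \<circ> \<phi>)"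
  proof (rule regular_local)
    show "openin (zariski X) {x \<in> points X. \<phi> x \<in> V}"
      using openin_continuous_map_preimage[OF c] V by blast
    fix x assume x: "x \<in> {x \<in> points X. \<phi> x \<in> V}"
    obtain W p q where W: "openin (zariski_topology S C) W" "\<phi> x \<in> W" "W \<subseteq> V" "p \<in> polys C" "q \<in> polys C"
      "\<forall>y\<in>W. q y \<noteq> 0 \<and> f y = p y / q y"
      using V x unfolding coordinate_space_simps(2) by blast
    let ?W = "{x \<in> points X. \<phi> x \<in> W}"
    have o: "openin (zariski X) ?W" using openin_continuous_map_preimage[OF c] W(1) by simp
    have "regular X ?W (\<lambda>x. p (\<phi> x) / q (\<phi> x))"
      by (rule regular_divide) (use W o in \<open>auto intro: regular_restrict[OF pol]\<close>)
    then show "\<exists>W h. x \<in> W \<and> W \<subseteq> {x \<in> points X. \<phi> x \<in> V} \<and> regular X W h \<and> (\<forall>y\<in>W. h y = (f \<circ> \<phi>) y)"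
      using W x by (intro exI[of _ "?W"] exI[of _ "\<lambda>x. p (\<phi> x) / q (\<phi> x)"]) auto
  qed
qed

lemma isomorphic_spaces_induced:
  assumes "ringed X" "ringed Y" "morphism X Y \<phi>" "morphism Y X \<psi>"
    "\<And>x. x \<in> points X \<Longrightarrow> \<psi> (\<phi> x) = x" "\<And>y. y \<in> points Y \<Longrightarrow> \<phi> (\<psi> y) = y"
    "\<And>x. x \<in> points X \<Longrightarrow> x \<in> S \<longleftrightarrow> \<phi> x \<in> T"
  shows "morphism (induced S X) (induced T Y) \<phi>" "morphism (induced T Y) (induced S X) \<psi>"
proof -
  interpret X: ringed X by fact
  interpret Y: ringed Y by fact
  have m: "\<psi> y \<in> points X" if "y \<in> points Y" for y
    using assms(4) that by (auto simp: morphism_def continuous_map_def)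
  show "morphism (induced S X) (induced T Y) \<phi>"
    by (rule ringed.morphism_corestrict[OF X.ringed_induced X.morphism_restrict[OF assms(3)] _ assms(2)])
      (use assms(7) in auto)
  show "morphism (induced T Y) (induced S X) \<psi>"
    by (rule ringed.morphism_corestrict[OF Y.ringed_induced Y.morphism_restrict[OF assms(4)] _ assms(1)])
      (use assms(6,7) m in auto)
qed

lemma openin_induced_coordinateE:
  assumes "openin (subtopology (zariski_topology S C) Y) U" "x \<in> U" "Y \<subseteq> S"
  obtains h where "h \<in> polys C" "h x \<noteq> 0" "\<And>y. y \<in> Y \<Longrightarrow> h y \<noteq> 0 \<Longrightarrow> y \<in> U"
proof -
  obtain W where W: "openin (zariski_topology S C) W" "U = W \<inter> Y"
    using assms(1) by (auto simp: openin_subtopology)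
  obtain h where h: "h \<in> polys C" "h x \<noteq> 0" "\<forall>y\<in>S. h y \<noteq> 0 \<longrightarrow> y \<in> W"
    using W(1)[unfolded openin_zariski_iff] assms(2) W(2) by (meson IntD1)
  show thesis
    by (rule that[OF h(1,2)]) (use h(3) W(2) assms(3) in auto)
qed

text \<open>The domain on which a fraction represents \<open>f\<close> is absorbed into the
  denominator: numerator and denominator are multiplied by a polynomial \<open>h\<close> that
  vanishes off this domain, and \<open>q y \<noteq> 0\<close> remains as the only condition.\<close>

lemma regular_induced_coordinateE:
  assumes "regular (induced Y (coordinate_space S C)) U f" "x \<in> U" "Y \<subseteq> S"
  obtains p q where "p \<in> polys C" "q \<in> polys C" "q x \<noteq> 0"
    "\<And>y. y \<in> Y \<Longrightarrow> q y \<noteq> 0 \<Longrightarrow> y \<in> U \<and> f y = p y / q y"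
proof -
  interpret ringed "coordinate_space S C" by (rule ringed_coordinate_space)
  obtain W g where W: "openin (zariski_topology S C) W" "x \<in> W" "Y \<inter> W \<subseteq> U"
    "regular (coordinate_space S C) W g" "\<And>y. y \<in> W \<inter> Y \<Longrightarrow> f y = g y"
    using regular_inducedE[OF assms(1,2)] by auto
  obtain W' p q where W': "openin (zariski_topology S C) W'" "x \<in> W'" "W' \<subseteq> W" "p \<in> polys C" "q \<in> polys C"
      "\<forall>y\<in>W'. q y \<noteq> 0 \<and> g y = p y / q y"
    using W(4)[unfolded coordinate_space_simps(2)] W(2) by meson
  obtain h where h: "h \<in> polys C" "h x \<noteq> 0" "\<forall>y\<in>S. h y \<noteq> 0 \<longrightarrow> y \<in> W'"
    using W'(1)[unfolded openin_zariski_iff] W'(2) by meson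
  show thesis
  proof (rule that[of "\<lambda>x. p x * h x" "\<lambda>x. q x * h x"])
    show "q x * h x \<noteq> 0" using W'(2,6) h(2) by simp
    fix y assume y: "y \<in> Y" "q y * h y \<noteq> 0"
    then have "y \<in> W'" using h(3) assms(3) by auto
    moreover from this have "y \<in> W \<inter> Y" using W'(3) y(1) by blast
    ultimately have "y \<in> U" "f y = g y" "g y = p y / q y" using W(3) W(5) W'(6) by blast+
    then show "y \<in> U \<and> f y = p y * h y / (q y * h y)" using y by simp
  qed (use W'(4,5) h(1) in \<open>auto intro: polys.mult\<close>)
qed

text \<open>The pointwise half of \<open>normal_variety\<close>, separated so that it can be proved
  for charts and carried over to the glued space.\<close>

definition normal_points :: "'a fspace \<Rightarrow> bool"
  where "normal_points X \<longleftrightarrow>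
    (\<forall>x \<in> points X. \<forall>U V f (n::nat) a.
       openin (zariski X) U \<and> U \<noteq> {} \<and> regular X U f \<and>
       openin (zariski X) V \<and> x \<in> V \<and> (\<forall>i<n. regular X V (a i)) \<and>
       (\<forall>y \<in> U \<inter> V. f y ^ n + (\<Sum>i<n. a i y * f y ^ i) = 0) \<longrightarrow>
       (\<exists>V' g. openin (zariski X) V' \<and> x \<in> V' \<and> regular X V' g \<and>
          (\<forall>y \<in> U \<inter> V'. g y = f y)))"

lemma normal_pointsD:
  assumes "normal_points X" "x \<in> points X" "openin (zariski X) U" "U \<noteq> {}" "regular X U f"
    "openin (zariski X) V" "x \<in> V" "\<And>i. i < n \<Longrightarrow> regular X V (a i)"
    "\<And>y. y \<in> U \<Longrightarrow> y \<in> V \<Longrightarrow> f y ^ n + (\<Sum>i<n. a i y * f y ^ i) = 0"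
  obtains V' g where "openin (zariski X) V'" "x \<in> V'" "regular X V' g"
    "\<And>y. y \<in> U \<Longrightarrow> y \<in> V' \<Longrightarrow> g y = f y"
proof -
  have "\<exists>V' g. openin (zariski X) V' \<and> x \<in> V' \<and> regular X V' g \<and> (\<forall>y \<in> U \<inter> V'. g y = f y)"
    by (rule assms(1)[unfolded normal_points_def, rule_format, where V = V and n = n and a = a])
      (use assms in auto)
  then show thesis using that by blast
qed

section \<open>Retracts of affine three-space and their normality\<close>

lemma affine_space_3: "affine_space 3 = coordinate_space A3 coords3"
  by (simp add: affine_space_def)

lemma polys_A3_domain:
  assumes "f \<in> polys coords3" "g \<in> polys coords3" "\<And>x. x \<in> A3 \<Longrightarrow> f x * g x = 0"
  shows "(\<forall>x\<in>A3. f x = 0) \<or> (\<forall>x\<in>A3. g x = 0)"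
proof -
  obtain P Q where PQ: "f = peval P" "g = peval Q"
    using polys_imp_peval[OF assms(1)] polys_imp_peval[OF assms(2)] by blast
  have "P * Q = 0"
  proof (rule peval_eq_0_imp)
    fix x :: "nat \<Rightarrow> complex" assume "\<And>i. i \<ge> 3 \<Longrightarrow> x i = undefined"
    then have "x \<in> A3" by (auto simp: PiE_def extensional_def)
    then show "peval (P * Q) x = 0" using assms(3) by (simp add: PQ)
  qed
  then have "P = 0 \<or> Q = 0" by (rule mult_eq_0_iff[THEN iffD1])
  then show ?thesis unfolding PQ by (elim disjE) simp_all
qed

text \<open>Composition with \<open>\<rho>\<close> extends a function on \<open>Z\<close> to
  \<open>A3\<close> without changing it on \<open>Z\<close>. Identities on \<open>Z\<close> thus
  become identities between polynomials in three variables.\<close>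

definition retraction3 :: "((nat \<Rightarrow> complex) \<Rightarrow> nat \<Rightarrow> complex) \<Rightarrow> (nat \<Rightarrow> complex) set \<Rightarrow> bool"
  where "retraction3 \<rho> Z \<longleftrightarrow> (\<forall>i<3. (\<lambda>x. \<rho> x i) \<in> polys coords3) \<and> \<rho> ` A3 \<subseteq> Z \<and> Z \<subseteq> A3 \<and>
    (\<forall>x\<in>Z. \<rho> x = x)"

lemma retraction3D:
  assumes "retraction3 \<rho> Z"
  shows "\<And>i. i < 3 \<Longrightarrow> (\<lambda>x. \<rho> x i) \<in> polys coords3" "\<rho> ` A3 \<subseteq> Z" "Z \<subseteq> A3"
    "\<And>x. x \<in> Z \<Longrightarrow> \<rho> x = x"
  using assms unfolding retraction3_def by simp_all

definition retract3 :: "(nat \<Rightarrow> complex) set \<Rightarrow> bool"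
  where "retract3 Z \<longleftrightarrow> (\<exists>\<rho>. retraction3 \<rho> Z)"

lemma retract3_domain:
  assumes "retract3 Z" "f \<in> polys coords3" "g \<in> polys coords3" "\<And>x. x \<in> Z \<Longrightarrow> f x * g x = 0"
  shows "(\<forall>x\<in>Z. f x = 0) \<or> (\<forall>x\<in>Z. g x = 0)"
proof -
  obtain \<rho> where "retraction3 \<rho> Z" using assms(1) unfolding retract3_def ..
  note \<rho> = retraction3D[OF this]
  have c: "(\<lambda>x. f (\<rho> x)) \<in> polys coords3" if "f \<in> polys coords3" for f
    by (rule polys_comp[OF that]) (use \<rho>(1) in auto)
  have "(\<forall>x\<in>A3. f (\<rho> x) = 0) \<or> (\<forall>x\<in>A3. g (\<rho> x) = 0)"
    by (rule polys_A3_domain[OF c[OF assms(2)] c[OF assms(3)]]) (use \<rho>(2) assms(4) in blast)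
  then show ?thesis
  proof
    assume *: "\<forall>x\<in>A3. f (\<rho> x) = 0"
    have "f z = 0" if "z \<in> Z" for z
      using *[rule_format, OF subsetD[OF \<rho>(3) that]] \<rho>(4)[OF that] by simp
    then show ?thesis by blast
  next
    assume *: "\<forall>x\<in>A3. g (\<rho> x) = 0"
    have "g z = 0" if "z \<in> Z" for z
      using *[rule_format, OF subsetD[OF \<rho>(3) that]] \<rho>(4)[OF that] by simp
    then show ?thesis by blast
  qed
qed

text \<open>Density of the locus \<open>f \<noteq> 0\<close> in \<open>Z\<close>, in the form in
  which denominators are removed below.\<close>

lemma retract3_nonzero_mult:
  assumes "retract3 Z" "f \<in> polys coords3" "g \<in> polys coords3" "y \<in> Z" "f y \<noteq> 0"
    "\<And>x. x \<in> Z \<Longrightarrow> f x \<noteq> 0 \<Longrightarrow> g x = 0" "z \<in> Z"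
  shows "g z = 0"
proof -
  have "f x * g x = 0" if "x \<in> Z" for x
    using assms(6)[OF that] by (cases "f x = 0") simp_all
  then have "(\<forall>x\<in>Z. f x = 0) \<or> (\<forall>x\<in>Z. g x = 0)" by (rule retract3_domain[OF assms(1-3)])
  then show ?thesis using assms(4,5,7) by blast
qed

lemma closedin_retract3: "retract3 Z \<Longrightarrow> closedin (zariski (affine_space 3)) Z"
proof -
  assume "retract3 Z"
  then obtain \<rho> where "retraction3 \<rho> Z" unfolding retract3_def ..
  note \<rho> = retraction3D[OF this]
  \<comment> \<open>The fixed-point equations of \<open>\<rho>\<close> cut out
    \<open>Z\<close>.\<close>
  let ?F = "(\<lambda>i x. \<rho> x i - x i) ` {..<3}"
  have "x \<in> Z" if x: "x \<in> A3" "\<forall>f\<in>?F. f x = 0" for x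
  proof -
    have "\<rho> x \<in> Z" using \<rho>(2) x(1) by blast
    moreover have "\<rho> x = x"
      by (rule PiE_ext[of _ "{..<3}" "\<lambda>_. UNIV"]) (use calculation \<rho>(3) x in \<open>auto simp del: PiE_iff\<close>)
    ultimately show ?thesis by simp
  qed
  then have "Z = {x \<in> A3. \<forall>f\<in>?F. f x = 0}"
    using \<rho>(3,4) by (auto simp del: PiE_iff)
  moreover have "?F \<subseteq> polys coords3"
    using \<rho>(1) by (auto intro!: polys_diff coord3_polys)
  ultimately show ?thesis
    using closedin_zariski_zeros[of ?F coords3 A3] unfolding affine_space_3 coordinate_space_simps
    by (simp only:)
qed

text \<open>The monic equation for \<open>f\<close> becomes a polynomial equation for a numerator
  and a denominator, valid on all of \<open>Z\<close>. Pulled back to \<open>A3\<close>, it is an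
  identity in a factorial ring, and the rational root theorem yields a fraction for \<open>f\<close>
  that is defined at \<open>x\<close>.\<close>

lemma normal_retract3:
  assumes Z: "retract3 Z"
  shows "normal_points (induced Z (affine_space 3))"
  unfolding normal_points_def
proof (intro ballI allI impI, elim conjE)
  let ?A = "induced Z (affine_space 3)"
  fix x U V f and n :: nat and a
  assume x: "x \<in> points ?A" and U: "U \<noteq> {}" "regular ?A U f"
    and V: "openin (zariski ?A) V" "x \<in> V" "\<forall>i<n. regular ?A V (a i)"
    and eq: "\<forall>y \<in> U \<inter> V. f y ^ n + (\<Sum>i<n. a i y * f y ^ i) = 0"
  obtain \<rho> where "retraction3 \<rho> Z" using Z unfolding retract3_def ..
  note \<rho> = retraction3D[OF this]
  have top: "points ?A = Z" using \<rho>(3) by (auto simp: affine_space_3)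
  note rE = regular_induced_coordinateE[where Y = Z and S = A3 and C = coords3, OF _ _ \<rho>(3), folded affine_space_3]
  have pull: "\<exists>P. \<forall>x. peval P x = f (\<rho> x)" if "f \<in> polys coords3" for f
  proof -
    have "(\<lambda>x. f (\<rho> x)) \<in> polys coords3"
      by (rule polys_comp[OF that]) (use \<rho>(1) in auto)
    then obtain P where "(\<lambda>x. f (\<rho> x)) = peval P" using polys_imp_peval by blast
    then have "\<forall>x. peval P x = f (\<rho> x)" by (simp add: fun_eq_iff)
    then show ?thesis by blast
  qed
  have "\<forall>i. \<exists>b c. i < n \<longrightarrow> b \<in> polys coords3 \<and> c \<in> polys coords3 \<and> c x \<noteq> 0 \<and>
    (\<forall>y\<in>Z. c y \<noteq> 0 \<longrightarrow> y \<in> V \<and> a i y = b y / c y)"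
  proof
    fix i show "\<exists>b c. i < n \<longrightarrow> b \<in> polys coords3 \<and> c \<in> polys coords3 \<and> c x \<noteq> 0 \<and>
      (\<forall>y\<in>Z. c y \<noteq> 0 \<longrightarrow> y \<in> V \<and> a i y = b y / c y)"
    proof (cases "i < n")
      case True
      obtain b c where "b \<in> polys coords3" "c \<in> polys coords3" "c x \<noteq> 0"
        "\<And>y. y \<in> Z \<Longrightarrow> c y \<noteq> 0 \<Longrightarrow> y \<in> V \<and> a i y = b y / c y"
        using rE[OF V(3)[rule_format, OF True] V(2)] by blast
      then show ?thesis by blast
    qed auto
  qed
  from choice[OF this] obtain b where "\<forall>i. \<exists>c. i < n \<longrightarrow> b i \<in> polys coords3 \<and> c \<in> polys coords3 \<and> c x \<noteq> 0 \<and>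
    (\<forall>y\<in>Z. c y \<noteq> 0 \<longrightarrow> y \<in> V \<and> a i y = b i y / c y)" by (elim exE)
  from choice[OF this] obtain c where *: "\<forall>i. i < n \<longrightarrow> b i \<in> polys coords3 \<and> c i \<in> polys coords3 \<and> c i x \<noteq> 0 \<and>
    (\<forall>y\<in>Z. c i y \<noteq> 0 \<longrightarrow> y \<in> V \<and> a i y = b i y / c i y)" by (elim exE)
  have bc: "\<And>i. i < n \<Longrightarrow> b i \<in> polys coords3" "\<And>i. i < n \<Longrightarrow> c i \<in> polys coords3"
    "\<And>i. i < n \<Longrightarrow> c i x \<noteq> 0" "\<And>i y. i < n \<Longrightarrow> y \<in> Z \<Longrightarrow> c i y \<noteq> 0 \<Longrightarrow> y \<in> V \<and> a i y = b i y / c i y"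
    using * by simp_all
  obtain h where h: "h \<in> polys coords3" "h x \<noteq> 0" "\<And>y. y \<in> Z \<Longrightarrow> h y \<noteq> 0 \<Longrightarrow> y \<in> V"
    by (rule openin_induced_coordinateE[OF _ V(2) \<rho>(3)]) (use V(1) in \<open>auto simp: affine_space_3\<close>)
  obtain y0 where y0: "y0 \<in> U" using U(1) by blast
  have UZ: "U \<subseteq> Z" using openin_subset[OF regular_induced_openin[OF U(2)]] by auto
  have y0Z: "y0 \<in> Z" using UZ y0 by blast
  obtain p q where pq: "p \<in> polys coords3" "q \<in> polys coords3" "q y0 \<noteq> 0"
    "\<And>y. y \<in> Z \<Longrightarrow> q y \<noteq> 0 \<Longrightarrow> y \<in> U \<and> f y = p y / q y"
    using rE[OF U(2) y0] by blast
  \<comment> \<open>\<open>cc\<close> is a common denominator of the coefficients,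
    \<open>bb i / cc\<close> is the coefficient with index \<open>i\<close>, and \<open>E\<close> is
    the monic equation for \<open>p / q\<close> multiplied by \<open>cc * q ^ n\<close>.\<close>
  define cc where "cc = (\<lambda>y. \<Prod>i<n. c i y)"
  define bb where "bb = (\<lambda>i y. b i y * (\<Prod>j\<in>{..<n} - {i}. c j y))"
  define E where "E = (\<lambda>y. p y ^ n * cc y + (\<Sum>i<n. bb i y * p y ^ i * q y ^ (n - i)))"
  have cc: "cc \<in> polys coords3" "cc x \<noteq> 0"
    using bc(2,3) by (auto simp: cc_def intro!: polys_prod)
  have bb: "bb i \<in> polys coords3" if "i < n" for i
    using bc(1,2) that by (auto simp: bb_def intro!: polys_prod polys.mult)
  have E: "E \<in> polys coords3"
    unfolding E_def using cc bb pq by (auto intro!: polys_intros)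
  have Ezero: "E y = 0" if y: "y \<in> Z" "q y \<noteq> 0" "h y \<noteq> 0" "cc y \<noteq> 0" for y
  proof -
    have yU: "y \<in> U" "f y = p y / q y" "y \<in> V" using pq(4) h(3) y by auto
    have c0: "c i y \<noteq> 0" if "i < n" for i using y(4) that by (auto simp: cc_def)
    have "0 = cc y * q y ^ n * (f y ^ n + (\<Sum>i<n. a i y * f y ^ i))"
      using eq[rule_format, of y] yU(1,3) by simp
    also have "\<dots> = cc y * (q y ^ n * f y ^ n) + (\<Sum>i<n. (cc y * a i y) * (q y ^ n * f y ^ i))"
      by (simp add: algebra_simps sum_distrib_left)
    also have "q y ^ n * f y ^ n = p y ^ n" using yU(2) y(2) by (simp add: power_divide)
    also have "(\<Sum>i<n. (cc y * a i y) * (q y ^ n * f y ^ i)) = (\<Sum>i<n. bb i y * p y ^ i * q y ^ (n - i))"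
    proof (intro sum.cong refl)
      fix i assume i: "i \<in> {..<n}"
      have "cc y = c i y * (\<Prod>j\<in>{..<n} - {i}. c j y)"
        unfolding cc_def using i by (simp add: prod.remove)
      then have "cc y * a i y = bb i y"
        using bc(4)[of i y] c0[of i] i y(1) by (simp add: bb_def)
      moreover have "q y ^ n * f y ^ i = p y ^ i * q y ^ (n - i)"
        using yU(2) y(2) i by (simp add: power_divide power_diff)
      ultimately show "cc y * a i y * (q y ^ n * f y ^ i) = bb i y * p y ^ i * q y ^ (n - i)"
        by simp
    qed
    finally show ?thesis unfolding E_def by (metis mult.commute)
  qed
  have xZ: "x \<in> Z" using x top by simp
  \<comment> \<open>So far \<open>E\<close> is known to vanish only where \<open>q\<close>,
    \<open>h\<close> and \<open>cc\<close> are nonzero. Irreducibility of \<open>Z\<close> removes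
    these three restrictions one after another.\<close>
  have 1: "h z * (cc z * E z) = 0" if z: "z \<in> Z" for z
  proof (rule retract3_nonzero_mult[OF Z pq(2) _ y0Z pq(3) _ z])
    show "(\<lambda>z. h z * (cc z * E z)) \<in> polys coords3" by (intro polys.mult h(1) cc(1) E)
    show "h x * (cc x * E x) = 0" if "x \<in> Z" "q x \<noteq> 0" for x
      using Ezero[OF that] by auto
  qed
  have 2: "cc z * E z = 0" if z: "z \<in> Z" for z
  proof (rule retract3_nonzero_mult[OF Z h(1) _ xZ h(2) _ z])
    show "(\<lambda>z. cc z * E z) \<in> polys coords3" by (intro polys.mult cc(1) E)
    show "cc x * E x = 0" if "x \<in> Z" "h x \<noteq> 0" for x
      using 1[OF that(1)] that(2) by simp
  qed
  have EZ: "E z = 0" if z: "z \<in> Z" for z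
    by (rule retract3_nonzero_mult[OF Z cc(1) E xZ cc(2) _ z]) (use 2 mult_eq_0_iff in blast)
  obtain P where P: "\<And>x. peval P x = p (\<rho> x)" using pull[OF pq(1)] by blast
  obtain Q where Q: "\<And>x. peval Q x = q (\<rho> x)" using pull[OF pq(2)] by blast
  obtain C where C: "\<And>x. peval C x = cc (\<rho> x)" using pull[OF cc(1)] by blast
  note PQ = P Q C
  have "\<forall>i. \<exists>B. i < n \<longrightarrow> (\<forall>x. peval B x = bb i (\<rho> x))" using pull[OF bb] by blast
  from choice[OF this] obtain B where B: "\<And>i x. i < n \<Longrightarrow> peval (B i) x = bb i (\<rho> x)" by blast
  \<comment> \<open>As \<open>\<rho>\<close> maps \<open>A3\<close> into \<open>Z\<close>, vanishing
    of \<open>E\<close> on \<open>Z\<close> turns into an identity between polynomials.\<close>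
  have id: "P ^ n * C + (\<Sum>i<n. B i * P ^ i * Q ^ (n - i)) = 0"
  proof (rule peval_eq_0_imp)
    fix x :: "nat \<Rightarrow> complex" assume "\<And>i. i \<ge> 3 \<Longrightarrow> x i = undefined"
    then have "x \<in> A3" by (auto simp: PiE_def extensional_def)
    then have "E (\<rho> x) = 0" using EZ \<rho>(2) by blast
    then show "peval (P ^ n * C + (\<Sum>i<n. B i * P ^ i * Q ^ (n - i))) x = 0"
      by (simp add: E_def PQ B)
  qed
  have "Q \<noteq> 0" using PQ(2)[of y0] pq(3) \<rho>(4)[OF y0Z] by auto
  then obtain D P' Q' where D: "P = D * P'" "Q = D * Q'"
    and "\<And>n b. P ^ n * C + (\<Sum>i<n. b i * P ^ i * Q ^ (n - i)) = 0 \<Longrightarrow> Q' dvd C"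
    by (rule reduced_fraction[of Q P C]) blast
  from this(3)[OF id] have Q'C: "Q' dvd C" .
  \<comment> \<open>The value of \<open>C\<close> at \<open>x\<close> is \<open>cc x\<close>, which
    is nonzero, so the divisor \<open>Q'\<close> of \<open>C\<close> is nonzero there as
    well.\<close>
  have Q'x: "peval Q' x \<noteq> 0"
    using Q'C PQ(3)[of x] cc(2) \<rho>(4)[OF xZ] by (auto elim!: dvdE)
  interpret A: ringed "affine_space 3" unfolding affine_space_3 by (rule ringed_coordinate_space)
  interpret ringed ?A by (rule A.ringed_induced)
  have r: "regular ?A Z p" if "p \<in> polys coords3" for p
  proof (rule A.regular_induced[OF _ \<rho>(3)])
    show "regular (affine_space 3) A3 p"
      unfolding affine_space_3 using openin_topspace[of "zariski_topology A3 coords3"] that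
      by (intro regular_coordinate_polys) (simp_all only: topspace_zariski)
    show "openin (subtopology (zariski (affine_space 3)) Z) Z"
      using openin_topspace[of "zariski ?A"] unfolding top by (simp only: induced_simps)
  qed
  let ?V' = "{z \<in> Z. peval Q' z \<noteq> 0}"
  have o: "openin (zariski ?A) ?V'"
    by (rule regular_nonzero_open[OF r[OF peval_polys]])
  show "\<exists>V' g. openin (zariski ?A) V' \<and> x \<in> V' \<and> regular ?A V' g \<and> (\<forall>y \<in> U \<inter> V'. g y = f y)"
  proof (intro exI conjI ballI)
    show "openin (zariski ?A) ?V'" by (rule o)
    show "x \<in> ?V'" using xZ Q'x by simp
    show "regular ?A ?V' (\<lambda>z. peval P' z / peval Q' z)"
      by (rule regular_divide) (use o in \<open>auto intro: regular_restrict[OF r[OF peval_polys]]\<close>)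
    fix y assume y: "y \<in> U \<inter> ?V'"
    then have yU: "y \<in> U" by blast
    \<comment> \<open>The fraction \<open>p / q\<close> was chosen near \<open>y0\<close> and may be
      undefined at \<open>y\<close>. A second fraction, valid near \<open>y\<close>, is compared
      with it on the dense set where both denominators are nonzero.\<close>
    obtain p1 q1 where 1: "p1 \<in> polys coords3" "q1 \<in> polys coords3" "q1 y \<noteq> 0"
      "\<And>y. y \<in> Z \<Longrightarrow> q1 y \<noteq> 0 \<Longrightarrow> y \<in> U \<and> f y = p1 y / q1 y"
      using rE[OF U(2) yU] by blast
    define h1 where "h1 = (\<lambda>z. p1 z * peval Q' z - peval P' z * q1 z)"
    have h1: "h1 \<in> polys coords3" unfolding h1_def using 1 by (auto intro!: polys_intros peval_polys)
    have "h1 z = 0" if z: "z \<in> Z" "q z \<noteq> 0" "q1 z \<noteq> 0" for z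
    proof -
      have "p z / q z = p1 z / q1 z" using pq(4)[OF z(1,2)] 1(4)[OF z(1,3)] by simp
      moreover have "p z = peval D z * peval P' z" "q z = peval D z * peval Q' z"
        using PQ(1,2)[of z] \<rho>(4)[OF z(1)] D(1,2) by auto
      ultimately show ?thesis using z by (auto simp: h1_def field_simps)
    qed
    note h1z = this
    have "q1 z * h1 z = 0" if z: "z \<in> Z" for z
    proof (rule retract3_nonzero_mult[OF Z pq(2) _ y0Z pq(3) _ z])
      show "(\<lambda>z. q1 z * h1 z) \<in> polys coords3" by (intro polys.mult 1(2) h1)
      show "q1 x * h1 x = 0" if "x \<in> Z" "q x \<noteq> 0" for x
        using h1z[OF that] by auto
    qed
    then have "h1 y = 0" using y 1(3) by auto
    moreover have "f y = p1 y / q1 y" using 1(4)[of y] y 1(3) by simp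
    ultimately have "f y = peval P' y / peval Q' y"
      using y 1(3) by (simp add: h1_def frac_eq_eq)
    then show "peval P' y / peval Q' y = f y" by (rule sym)
  qed
qed

lemma (in ringed) regular_induced_open:
  assumes "openin (zariski X) W"
  shows "regular (induced W X) U f \<longleftrightarrow> U \<subseteq> W \<and> regular X U f"
proof
  assume r: "regular (induced W X) U f"
  have UW: "openin (zariski X) U" "U \<subseteq> W"
    using regular_induced_openin[OF r] assms openin_open_subtopology by blast+
  have "regular X U f"
  proof (rule regular_local[OF UW(1)])
    fix x assume x: "x \<in> U"
    obtain V g where V: "openin (zariski X) V" "x \<in> V" "W \<inter> V \<subseteq> U" "regular X V g"
      "\<And>y. y \<in> V \<inter> W \<Longrightarrow> f y = g y" using regular_inducedE[OF r x] by blast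
    show "\<exists>V g. x \<in> V \<and> V \<subseteq> U \<and> regular X V g \<and> (\<forall>y\<in>V. g y = f y)"
      by (rule exI[of _ "V \<inter> W"], rule exI[of _ g]) (use V x UW assms in \<open>auto intro: regular_restrict\<close>)
  qed
  then show "U \<subseteq> W \<and> regular X U f" using UW by simp
next
  assume r: "U \<subseteq> W \<and> regular X U f"
  then have "openin (subtopology (zariski X) W) U"
    using regular_open assms openin_open_subtopology by blast
  then show "regular (induced W X) U f" using r by (intro regular_induced) auto
qed

lemma irreducible_topologyD:
  assumes "irreducible_topology T" "openin T U" "openin T V" "U \<noteq> {}" "V \<noteq> {}"
  shows "U \<inter> V \<noteq> {}"
proof
  assume "U \<inter> V = {}"
  then have "(topspace T - U) \<union> (topspace T - V) = topspace T" by blast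
  moreover have "closedin T (topspace T - U)" "closedin T (topspace T - V)"
    using assms(2,3) by auto
  ultimately have "topspace T - U = topspace T \<or> topspace T - V = topspace T"
    using assms(1) unfolding irreducible_topology_def by meson
  then show False using assms(2-5) openin_subset by blast
qed

text \<open>The equation and the function are transported to a chart around \<open>x\<close>, the
  solution is found there and transported back.\<close>

lemma (in ringed) normal_points_local:
  assumes "irreducible_topology (zariski X)"
    and charts: "\<And>x. x \<in> points X \<Longrightarrow> \<exists>W (Y :: 'b fspace) \<phi> \<psi>. openin (zariski X) W \<and> x \<in> W \<and> ringed Y \<and>
      normal_points Y \<and> morphism (induced W X) Y \<phi> \<and> morphism Y (induced W X) \<psi> \<and>
      (\<forall>x\<in>W. \<psi> (\<phi> x) = x) \<and> (\<forall>y\<in>points Y. \<phi> (\<psi> y) = y)"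
  shows "normal_points X"
  unfolding normal_points_def
proof (intro ballI allI impI, elim conjE)
  fix x U V f and n :: nat and a
  assume x: "x \<in> points X" and U: "openin (zariski X) U" "U \<noteq> {}" "regular X U f"
    and V: "openin (zariski X) V" "x \<in> V" "\<forall>i<n. regular X V (a i)"
    and eq: "\<forall>y \<in> U \<inter> V. f y ^ n + (\<Sum>i<n. a i y * f y ^ i) = 0"
  obtain W and Y :: "'b fspace" and \<phi> \<psi> where W: "openin (zariski X) W" "x \<in> W" "ringed Y" "normal_points Y"
    "morphism (induced W X) Y \<phi>" "morphism Y (induced W X) \<psi>"
    "\<forall>x\<in>W. \<psi> (\<phi> x) = x" "\<forall>y\<in>points Y. \<phi> (\<psi> y) = y"
    using charts[OF x] by (elim exE conjE) rule
  interpret Y: ringed Y by fact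
  have pW: "points (induced W X) = W" using openin_subset[OF W(1)] by auto
  let ?\<psi> = "\<lambda>U. {y \<in> points Y. \<psi> y \<in> U \<inter> W}"
  have pull: "regular Y (?\<psi> U) (f \<circ> \<psi>)" if r: "regular X U f" for U f
  proof -
    have o: "openin (zariski X) (U \<inter> W)" using regular_open[OF r] W(1) by auto
    then have "regular (induced W X) (U \<inter> W) f"
      using regular_induced_open[OF W(1)] regular_restrict[OF r o] by auto
    then show ?thesis
      by (rule morphism_regular[OF W(6) regular_induced_openin[folded induced_simps(1)]]) fact
  qed
  \<comment> \<open>\<open>U\<close> need not contain \<open>x\<close>; irreducibility ensures that
    the function does not disappear on restriction to the chart.\<close>
  have Wn: "W \<inter> U \<noteq> {}" using irreducible_topologyD[OF assms(1) W(1) U(1) _ U(2)] W(2) by blast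
  have px: "\<phi> x \<in> points Y" by (rule morphism_points[OF W(5)]) (use pW W(2) in simp)
  have Un: "?\<psi> U \<noteq> {}"
  proof -
    obtain u where u: "u \<in> W" "u \<in> U" using Wn by blast
    then have "\<phi> u \<in> ?\<psi> U" using W(7) morphism_points[OF W(5)] pW by auto
    then show ?thesis by blast
  qed
  obtain V' g where V': "openin (zariski Y) V'" "\<phi> x \<in> V'" "regular Y V' g"
    "\<And>y. y \<in> ?\<psi> U \<Longrightarrow> y \<in> V' \<Longrightarrow> g y = (f \<circ> \<psi>) y"
  proof (rule normal_pointsD[OF W(4) px Y.regular_open[OF pull[OF U(3)]] Un pull[OF U(3)]])
    show "openin (zariski Y) (?\<psi> V)"
      using Y.regular_open[OF pull[OF regular_const[OF V(1)]]] .
    show "\<phi> x \<in> ?\<psi> V" using px W(2,7) V(2) by simp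
    show "regular Y (?\<psi> V) (a i \<circ> \<psi>)" if "i < n" for i using pull V(3) that by blast
    show "(f \<circ> \<psi>) y ^ n + (\<Sum>i<n. (a i \<circ> \<psi>) y * (f \<circ> \<psi>) y ^ i) = 0"
      if "y \<in> ?\<psi> U" "y \<in> ?\<psi> V" for y
      using eq that by simp
  qed blast
  have "regular (induced W X) {y \<in> points (induced W X). \<phi> y \<in> V'} (g \<circ> \<phi>)"
    by (rule morphism_regular[OF W(5) V'(1,3)])
  then have r: "regular X {y \<in> W. \<phi> y \<in> V'} (g \<circ> \<phi>)"
    unfolding regular_induced_open[OF W(1)] pW by (rule conjunct2)
  show "\<exists>V' g. openin (zariski X) V' \<and> x \<in> V' \<and> regular X V' g \<and> (\<forall>y \<in> U \<inter> V'. g y = f y)"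
  proof (intro exI conjI ballI)
    show "regular X {y \<in> W. \<phi> y \<in> V'} (g \<circ> \<phi>)" by (rule r)
    show "openin (zariski X) {y \<in> W. \<phi> y \<in> V'}" by (rule regular_open[OF r])
    show "x \<in> {y \<in> W. \<phi> y \<in> V'}" using W(2) V'(2) by simp
    fix y assume "y \<in> U \<inter> {y \<in> W. \<phi> y \<in> V'}"
    then show "(g \<circ> \<phi>) y = f y"
      using V'(4)[of "\<phi> y"] morphism_points[OF W(5), of y] unfolding pW using W(7) by simp
  qed
qed

subsection \<open>Products\<close>

text \<open>General finite index sets are convenient because sums of tensors are indexed by disjoint
  unions and products of tensors by pairs.\<close>

lemma tensorsI:
  assumes "finite I" "\<And>i. i \<in> I \<Longrightarrow> regular X U (g i)" "\<And>i. i \<in> I \<Longrightarrow> regular Y V (h i)"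
    "\<And>z. f z = (\<Sum>i\<in>I. g i (fst z) * h i (snd z))"
  shows "f \<in> tensors X Y U V"
proof -
  obtain e where e: "bij_betw e {0..<card I} I" using ex_bij_betw_nat_finite[OF assms(1)] by blast
  have "f = (\<lambda>z. \<Sum>i<card I. g (e i) (fst z) * h (e i) (snd z))"
  proof
    fix z
    show "f z = (\<Sum>i<card I. g (e i) (fst z) * h (e i) (snd z))"
      unfolding assms(4) using sum.reindex_bij_betw[OF e, of "\<lambda>i. g i (fst z) * h i (snd z)"]
      by (simp add: atLeast0LessThan)
  qed
  moreover have "\<forall>i<card I. regular X U (g (e i)) \<and> regular Y V (h (e i))"
    using assms(2,3) bij_betwE[OF e] by auto
  ultimately show ?thesis unfolding tensors_def by (intro CollectI exI conjI)
qed

lemma tensorsE: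
  assumes "f \<in> tensors X Y U V"
  shows "\<exists>(n::nat) g h. (\<forall>i<n. regular X U (g i) \<and> regular Y V (h i)) \<and>
    (\<forall>z. f z = (\<Sum>i<n. g i (fst z) * h i (snd z)))"
proof -
  obtain n :: nat and g h where "f = (\<lambda>z. \<Sum>i<n. g i (fst z) * h i (snd z))"
    "\<forall>i<n. regular X U (g i) \<and> regular Y V (h i)"
    using assms unfolding tensors_def by (elim CollectE exE conjE)
  then show ?thesis by (intro exI[of _ n] exI[of _ g] exI[of _ h]) simp
qed

lemma tensors_polys:
  assumes X: "ringed X" and Y: "ringed Y" and f: "f \<in> polys C"
    and "openin (zariski X) U" "openin (zariski Y) V"
    and "\<And>c. c \<in> C \<Longrightarrow> (\<lambda>z. c (\<phi> z)) \<in> tensors X Y U V"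
  shows "(\<lambda>z. f (\<phi> z)) \<in> tensors X Y U V"
  using f
proof induction
  case (const c)
  show ?case
    by (rule tensorsI[of "{()}" _ _ "\<lambda>_ _. c" _ _ "\<lambda>_ _. 1"])
      (use ringed.regular_const[OF X] ringed.regular_const[OF Y] assms in auto)
next
  case (coord f)
  then show ?case using assms by blast
next
  case (add f g)
  from tensorsE[OF add.IH(1)] obtain n :: nat and a b where
    *: "(\<forall>i<n. regular X U (a i) \<and> regular Y V (b i)) \<and> (\<forall>z. f (\<phi> z) = (\<Sum>i<n. a i (fst z) * b i (snd z)))"
    by (elim exE)
  have 1: "\<And>i. i < n \<Longrightarrow> regular X U (a i)" "\<And>i. i < n \<Longrightarrow> regular Y V (b i)"
    "\<And>z. f (\<phi> z) = (\<Sum>i<n. a i (fst z) * b i (snd z))" using * by blast+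
  from tensorsE[OF add.IH(2)] obtain m :: nat and a' b' where
    *: "(\<forall>i<m. regular X U (a' i) \<and> regular Y V (b' i)) \<and> (\<forall>z. g (\<phi> z) = (\<Sum>i<m. a' i (fst z) * b' i (snd z)))"
    by (elim exE)
  have 2: "\<And>i. i < m \<Longrightarrow> regular X U (a' i)" "\<And>i. i < m \<Longrightarrow> regular Y V (b' i)"
    "\<And>z. g (\<phi> z) = (\<Sum>i<m. a' i (fst z) * b' i (snd z))" using * by blast+
  show ?case
    by (rule tensorsI[of "{..<n} <+> {..<m}" _ _ "case_sum a a'" _ _ "case_sum b b'"])
      (use 1 2 in \<open>auto simp: sum.Plus\<close>)
next
  case (mult f g)
  from tensorsE[OF mult.IH(1)] obtain n :: nat and a b where
    *: "(\<forall>i<n. regular X U (a i) \<and> regular Y V (b i)) \<and> (\<forall>z. f (\<phi> z) = (\<Sum>i<n. a i (fst z) * b i (snd z)))"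
    by (elim exE)
  have 1: "\<And>i. i < n \<Longrightarrow> regular X U (a i)" "\<And>i. i < n \<Longrightarrow> regular Y V (b i)"
    "\<And>z. f (\<phi> z) = (\<Sum>i<n. a i (fst z) * b i (snd z))" using * by blast+
  from tensorsE[OF mult.IH(2)] obtain m :: nat and a' b' where
    *: "(\<forall>i<m. regular X U (a' i) \<and> regular Y V (b' i)) \<and> (\<forall>z. g (\<phi> z) = (\<Sum>i<m. a' i (fst z) * b' i (snd z)))"
    by (elim exE)
  have 2: "\<And>i. i < m \<Longrightarrow> regular X U (a' i)" "\<And>i. i < m \<Longrightarrow> regular Y V (b' i)"
    "\<And>z. g (\<phi> z) = (\<Sum>i<m. a' i (fst z) * b' i (snd z))" using * by blast+
  show ?case
  proof (rule tensorsI[of "{..<n} \<times> {..<m}" _ _ "\<lambda>(i,j) x. a i x * a' j x" _ _ "\<lambda>(i,j) y. b i y * b' j y"])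
    fix z show "f (\<phi> z) * g (\<phi> z) = (\<Sum>i\<in>{..<n} \<times> {..<m}. (case i of (i, j) \<Rightarrow> \<lambda>x. a i x * a' j x) (fst z) *
       (case i of (i, j) \<Rightarrow> \<lambda>y. b i y * b' j y) (snd z))"
      unfolding 1(3) 2(3) sum_product sum.cartesian_product
      by (intro sum.cong) (auto simp: mult_ac)
  qed (use 1 2 in \<open>auto intro: ringed.regular_mult[OF X] ringed.regular_mult[OF Y]\<close>)
qed

lemma openin_product_zariski:
  assumes "openin (zariski X) U" "openin (zariski Y) V" "p \<in> tensors X Y U V"
  shows "openin (product_zariski X Y) {z \<in> U \<times> V. p z \<noteq> 0}"
  unfolding product_zariski_def by (rule topology_generated_by_Basis) (use assms in blast)

lemma topspace_product_zariski:
  assumes "ringed X" "ringed Y"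
  shows "topspace (product_zariski X Y) = points X \<times> points Y"
proof
  show "topspace (product_zariski X Y) \<subseteq> points X \<times> points Y"
    unfolding product_zariski_def topology_generated_by_topspace
  proof (intro Union_least, elim CollectE exE conjE)
    fix S U V p assume S: "S = {z \<in> U \<times> V. p z \<noteq> 0}" and "openin (zariski X) U" "openin (zariski Y) V"
    then have "U \<subseteq> points X" "V \<subseteq> points Y" by (auto dest: openin_subset)
    then show "S \<subseteq> points X \<times> points Y" unfolding S by blast
  qed
  have "(\<lambda>_. 1) \<in> tensors X Y (points X) (points Y)"
    by (rule tensors_polys[OF assms polys.const[of 1 "{}"]]) auto
  from openin_subset[OF openin_product_zariski[OF _ _ this]]
  show "points X \<times> points Y \<subseteq> topspace (product_zariski X Y)" by simp
qed

lemma product_space_simps: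
  "zariski (product_space X Y) = product_zariski X Y"
  "regular (product_space X Y) W f \<longleftrightarrow> openin (product_zariski X Y) W \<and>
       (\<forall>z\<in>W. \<exists>U V p q. openin (zariski X) U \<and> openin (zariski Y) V \<and>
          p \<in> tensors X Y U V \<and> q \<in> tensors X Y U V \<and> z \<in> U \<times> V \<and> q z \<noteq> 0 \<and>
          (\<forall>y \<in> W \<inter> U \<times> V. q y \<noteq> 0 \<longrightarrow> f y = p y / q y))"
  by (simp_all add: product_space_def)

text \<open>A tensor that vanishes at all \<open>(z, z)\<close> but not at \<open>(x, y)\<close>
  defines one of the generating open sets of the product, and this set avoids the diagonal.\<close>

lemma closedin_diagonal:
  assumes "ringed X" and sep: "\<And>x y. x \<in> points X \<Longrightarrow> y \<in> points X \<Longrightarrow> x \<noteq> y \<Longrightarrow>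
    \<exists>U V p. openin (zariski X) U \<and> openin (zariski X) V \<and> p \<in> tensors X X U V \<and> x \<in> U \<and> y \<in> V \<and>
      p (x, y) \<noteq> 0 \<and> (\<forall>z \<in> U \<inter> V. p (z, z) = 0)"
  shows "closedin (zariski (product_space X X)) {(x, x) | x. x \<in> points X}"
  unfolding closedin_def product_space_simps topspace_product_zariski[OF assms(1,1)]
proof
  show "{(x, x) |x. x \<in> points X} \<subseteq> points X \<times> points X" by auto
  show "openin (product_zariski X X) (points X \<times> points X - {(x, x) |x. x \<in> points X})"
  proof (subst openin_subopen, intro ballI)
    fix z assume "z \<in> points X \<times> points X - {(x, x) |x. x \<in> points X}"
    then obtain x y where z: "z = (x, y)" "x \<in> points X" "y \<in> points X" "x \<noteq> y" by auto
    obtain U V p where 1: "openin (zariski X) U" "openin (zariski X) V" "p \<in> tensors X X U V"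
      "x \<in> U" "y \<in> V" "p (x, y) \<noteq> 0" "\<forall>z \<in> U \<inter> V. p (z, z) = 0"
      using sep[OF z(2-4)] by (elim exE conjE)
    show "\<exists>T. openin (product_zariski X X) T \<and> z \<in> T \<and> T \<subseteq> points X \<times> points X - {(x, x) |x. x \<in> points X}"
      by (rule exI[of _ "{z \<in> U \<times> V. p z \<noteq> 0}"], intro conjI openin_product_zariski)
        (use 1 z openin_subset[OF 1(1)] openin_subset[OF 1(2)] in auto)
  qed
qed

subsection \<open>Matrices of order three\<close>

type_synonym M3 = "complex^3^3"

lemma SL_simps [simp]:
  "carrier SL = {A. det A = 1}" "A \<otimes>\<^bsub>SL\<^esub> B = A ** B" "\<one>\<^bsub>SL\<^esub> = mat 1"
  by (simp_all add: SL_def)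

lemma group_SL: "group (SL :: (complex^'n^'n) monoid)"
proof (rule groupI)
  fix x :: "complex^'n^'n" assume "x \<in> carrier SL"
  then have x: "det x = 1" by simp
  then obtain y where y: "y ** x = mat 1"
    using invertible_det_nz[of x] by (auto simp: invertible_def)
  then have "det y = 1" using det_mul[of y x] x by simp
  then show "\<exists>y\<in>carrier SL. y \<otimes>\<^bsub>SL\<^esub> x = \<one>\<^bsub>SL\<^esub>" using y by auto
qed (auto simp: det_mul matrix_mul_assoc)

interpretation SL3: group SL3
  by (rule group_SL)

lemma mult_entry: "((A :: M3) ** (B :: M3)) $ i $ j = A$i$1 * B$1$j + A$i$2 * B$2$j + A$i$3 * B$3$j"
  by (simp add: matrix_matrix_mult_def sum_3)

lemma mult_diff_distrib:
  fixes A B C :: M3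
  shows "A ** (B - C) = A ** B - A ** C" "(B - C) ** A = B ** A - C ** A"
  by (simp_all add: vec_eq_iff mult_entry algebra_simps)

lemma mat_entry: "(mat c :: M3) $ i $ j = (if i = j then c else 0)"
  by (simp add: mat_def)

lemma M3_eq_iff: "(A :: M3) = B \<longleftrightarrow>
    A$1$1 = B$1$1 \<and> A$1$2 = B$1$2 \<and> A$1$3 = B$1$3 \<and>
    A$2$1 = B$2$1 \<and> A$2$2 = B$2$2 \<and> A$2$3 = B$2$3 \<and>
    A$3$1 = B$3$1 \<and> A$3$2 = B$3$2 \<and> A$3$3 = B$3$3"
  by (simp add: vec_eq_iff forall_3 conj_assoc)

definition tr3 :: "M3 \<Rightarrow> complex" where "tr3 A = A$1$1 + A$2$2 + A$3$3"

text \<open>The sum of the principal minors of order two, that is, the second elementary symmetric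
  function of the eigenvalues.\<close>

definition min3 :: "M3 \<Rightarrow> complex" where
  "min3 A = A$1$1 * A$2$2 - A$1$2 * A$2$1 + A$1$1 * A$3$3 - A$1$3 * A$3$1 + A$2$2 * A$3$3 - A$2$3 * A$3$2"

text \<open>The adjugate, written as in the Cayley-Hamilton theorem, so that it visibly lies in every
  matrix algebra containing \<open>A\<close>.\<close>

definition adj3 :: "M3 \<Rightarrow> M3" where
  "adj3 A = (\<chi> i j. (A ** A)$i$j - tr3 A * A$i$j + (if i = j then min3 A else 0))"

lemma adj3_entries:
  "adj3 A $1$1 = A$2$2 * A$3$3 - A$2$3 * A$3$2"
  "adj3 A $1$2 = A$1$3 * A$3$2 - A$1$2 * A$3$3"
  "adj3 A $1$3 = A$1$2 * A$2$3 - A$1$3 * A$2$2"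
  "adj3 A $2$1 = A$2$3 * A$3$1 - A$2$1 * A$3$3"
  "adj3 A $2$2 = A$1$1 * A$3$3 - A$1$3 * A$3$1"
  "adj3 A $2$3 = A$1$3 * A$2$1 - A$1$1 * A$2$3"
  "adj3 A $3$1 = A$2$1 * A$3$2 - A$2$2 * A$3$1"
  "adj3 A $3$2 = A$1$2 * A$3$1 - A$1$1 * A$3$2"
  "adj3 A $3$3 = A$1$1 * A$2$2 - A$1$2 * A$2$1"
  by (simp_all add: adj3_def mult_entry tr3_def min3_def algebra_simps)

lemma adj3_mult: "adj3 A ** A = mat (det A)" "A ** adj3 A = mat (det A)"
  by (simp_all add: M3_eq_iff mult_entry adj3_entries mat_entry det_3 algebra_simps)

lemma det_adj3: "det A = 1 \<Longrightarrow> det (adj3 A) = 1"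
  using adj3_mult(1)[of A] det_mul[of "adj3 A" A] by simp

lemma inv_SL3: "det A = 1 \<Longrightarrow> inv\<^bsub>SL3\<^esub> A = adj3 A"
  by (rule SL3.inv_equality) (simp_all add: adj3_mult det_adj3)

lemma adj3_adj3: "det A = 1 \<Longrightarrow> adj3 (adj3 A) = A"
  using inv_SL3[of A] inv_SL3[of "adj3 A"] det_adj3[of A] SL3.inv_inv[of A] by simp

lemma adj3_product: "det A = 1 \<Longrightarrow> det B = 1 \<Longrightarrow> adj3 (A ** B) = adj3 B ** adj3 A"
  using SL3.inv_mult_group[of A B] inv_SL3[of A] inv_SL3[of B] inv_SL3[of "A ** B"]
  by (simp add: det_mul)

subsection \<open>Patterns\<close>

definition supported_on :: "(3 \<times> 3) set \<Rightarrow> M3 set"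
  where "supported_on R = {A. \<forall>i j. (i, j) \<notin> R \<longrightarrow> A$i$j = 0}"

text \<open>A group if \<open>R\<close> is a preorder. The definition is also applied to
  \<open>UNIV - {(3,1)}\<close>, which is not transitive and gives only a closed irreducible
  set.\<close>

definition pattern_group :: "(3 \<times> 3) set \<Rightarrow> M3 set"
  where "pattern_group R = {A \<in> supported_on R. det A = 1}"

definition unipotent_pattern :: "(3 \<times> 3) set \<Rightarrow> M3 set"
  where "unipotent_pattern S = {A. A - mat 1 \<in> supported_on S}"

lemma supported_on_mult: "A \<in> supported_on R \<Longrightarrow> B \<in> supported_on S \<Longrightarrow> A ** B \<in> supported_on (R O S)"
  unfolding supported_on_def mem_Collect_eq matrix_matrix_mult_def
  by (auto intro!: sum.neutral) blast

lemma supported_on_mono: "R \<subseteq> S \<Longrightarrow> A \<in> supported_on R \<Longrightarrow> A \<in> supported_on S"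
  unfolding supported_on_def by blast

lemma supported_on_trans_mult: "trans R \<Longrightarrow> A \<in> supported_on R \<Longrightarrow> B \<in> supported_on R \<Longrightarrow> A ** B \<in> supported_on R"
  using supported_on_mono[OF trans_O_subset supported_on_mult] by blast

lemma supported_on_add: "A \<in> supported_on R \<Longrightarrow> B \<in> supported_on R \<Longrightarrow> A + B \<in> supported_on R"
  unfolding supported_on_def by auto

lemma supported_on_adj3:
  assumes "refl R" "trans R" "A \<in> supported_on R" shows "adj3 A \<in> supported_on R"
proof -
  have "A ** A \<in> supported_on R" using assms supported_on_trans_mult by blast
  then show ?thesis using assms by (auto simp: supported_on_def adj3_def refl_on_def)
qed

lemma supported_on_mat: "refl R \<Longrightarrow> mat c \<in> supported_on R"
  by (auto simp: supported_on_def mat_entry refl_on_def)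

lemma pattern_group_det: "A \<in> pattern_group R \<Longrightarrow> det A = 1" by (simp add: pattern_group_def)

lemma pattern_group_subgroup:
  assumes "refl R" "trans R" shows "subgroup (pattern_group R) SL3"
proof
  show "pattern_group R \<subseteq> carrier SL3" by (auto simp: pattern_group_def)
  show "\<one>\<^bsub>SL3\<^esub> \<in> pattern_group R" using supported_on_mat[OF assms(1), of 1] by (simp add: pattern_group_def)
  fix x assume x: "x \<in> pattern_group R"
  show "inv\<^bsub>SL3\<^esub> x \<in> pattern_group R"
    using x supported_on_adj3[OF assms] det_adj3[of x] by (simp add: pattern_group_def inv_SL3)
  fix y assume "y \<in> pattern_group R"
  then show "x \<otimes>\<^bsub>SL3\<^esub> y \<in> pattern_group R"
    using x supported_on_trans_mult[OF assms(2)] by (simp add: pattern_group_def det_mul)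
qed

lemma pattern_group_mono: "R \<subseteq> S \<Longrightarrow> pattern_group R \<subseteq> pattern_group S"
  unfolding pattern_group_def using supported_on_mono by blast

abbreviation mcoords :: "(M3 \<Rightarrow> complex) set"
  where "mcoords \<equiv> {\<lambda>A. A $ i $ j | i j. True}"

lemma matrix_space_3: "(matrix_space :: M3 fspace) = coordinate_space UNIV mcoords"
  by (simp add: matrix_space_def)

lemma entry_polys [intro]: "(\<lambda>A. A $ i $ j) \<in> polys mcoords"
  by (rule polys.coord) auto

lemma det_polys: "(det :: M3 \<Rightarrow> complex) \<in> polys mcoords"
  unfolding det_3[abs_def] by (intro polys_intros entry_polys)

lemma closedin_polys_zeros:
  "F \<subseteq> polys mcoords \<Longrightarrow> closedin (zariski (matrix_space :: M3 fspace)) {x. \<forall>f\<in>F. f x = 0}"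
  using closedin_zariski_zeros[of F mcoords UNIV] by (simp add: matrix_space_3)

lemma closedin_pattern_group: "closedin (zariski matrix_space) (pattern_group R)"
proof -
  let ?F = "insert (\<lambda>A. det A - 1) {\<lambda>A. A $ i $ j | i j. (i, j) \<notin> R}"
  have "?F \<subseteq> polys mcoords"
    using polys_diff[OF det_polys polys.const] entry_polys by auto
  moreover have "pattern_group R = {x. \<forall>f\<in>?F. f x = 0}"
    by (auto simp: pattern_group_def supported_on_def)
  ultimately show ?thesis using closedin_polys_zeros by (simp only:)
qed

subsection \<open>Irreducible sets of matrices\<close>

text \<open>Irreducibility is phrased with polynomials, so that it can be tested on rational curves
  and passes to images under polynomial maps.\<close>

definition irred :: "M3 set \<Rightarrow> bool"
  where "irred S \<longleftrightarrow> (\<forall>f\<in>polys mcoords. \<forall>g\<in>polys mcoords.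
    (\<exists>x\<in>S. f x \<noteq> 0) \<longrightarrow> (\<exists>x\<in>S. g x \<noteq> 0) \<longrightarrow> (\<exists>x\<in>S. f x \<noteq> 0 \<and> g x \<noteq> 0))"

lemma irredD:
  "irred S \<Longrightarrow> f \<in> polys mcoords \<Longrightarrow> g \<in> polys mcoords \<Longrightarrow> x \<in> S \<Longrightarrow> f x \<noteq> 0 \<Longrightarrow> y \<in> S \<Longrightarrow> g y \<noteq> 0 \<Longrightarrow>
    \<exists>z\<in>S. f z \<noteq> 0 \<and> g z \<noteq> 0"
  unfolding irred_def by blast

lemma irred_open_Int:
  assumes S: "irred S" and U: "openin (zariski matrix_space) U" "x \<in> S" "x \<in> U"
    and V: "openin (zariski matrix_space) V" "y \<in> S" "y \<in> V"
  shows "S \<inter> U \<inter> V \<noteq> {}"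
proof -
  obtain f where f: "f \<in> polys mcoords" "f x \<noteq> 0" "\<forall>y\<in>UNIV. f y \<noteq> 0 \<longrightarrow> y \<in> U"
    using U unfolding matrix_space_3 coordinate_space_simps openin_zariski_iff by meson
  obtain g where g: "g \<in> polys mcoords" "g y \<noteq> 0" "\<forall>y\<in>UNIV. g y \<noteq> 0 \<longrightarrow> y \<in> V"
    using V unfolding matrix_space_3 coordinate_space_simps openin_zariski_iff by meson
  obtain z where "z \<in> S" "f z \<noteq> 0" "g z \<noteq> 0"
    using irredD[OF S f(1) g(1) U(2) f(2) V(2) g(2)] by blast
  then show ?thesis using f(3) g(3) by auto
qed

lemma irred_connectedin: "irred S \<Longrightarrow> connectedin (zariski matrix_space) S"
  unfolding connectedin
proof (intro conjI notI)
  show "S \<subseteq> points matrix_space" by (simp add: matrix_space_3)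
  assume S: "irred S" and "\<exists>E1 E2. openin (zariski matrix_space) E1 \<and> openin (zariski matrix_space) E2 \<and>
    S \<subseteq> E1 \<union> E2 \<and> E1 \<inter> E2 \<inter> S = {} \<and> E1 \<inter> S \<noteq> {} \<and> E2 \<inter> S \<noteq> {}"
  then obtain E1 E2 where E: "openin (zariski matrix_space) E1" "openin (zariski matrix_space) E2"
    "E1 \<inter> E2 \<inter> S = {}" "E1 \<inter> S \<noteq> {}" "E2 \<inter> S \<noteq> {}" by (elim exE conjE)
  obtain x y where "x \<in> S" "x \<in> E1" "y \<in> S" "y \<in> E2" using E(4,5) by blast
  from irred_open_Int[OF S E(1) this(1,2) E(2) this(3,4)] show False using E(3) by blast
qed

lemma irred_image:
  assumes "irred S" "\<And>i j. (\<lambda>x. \<phi> x $ i $ j) \<in> polys mcoords"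
  shows "irred (\<phi> ` S)"
  unfolding irred_def
proof (intro ballI impI)
  fix f g assume f: "f \<in> polys mcoords" "\<exists>x\<in>\<phi> ` S. f x \<noteq> 0" and g: "g \<in> polys mcoords" "\<exists>x\<in>\<phi> ` S. g x \<noteq> 0"
  have c: "(\<lambda>x. f (\<phi> x)) \<in> polys mcoords" if "f \<in> polys mcoords" for f
    by (rule polys_comp[OF that]) (use assms(2) in auto)
  obtain x y where "x \<in> S" "f (\<phi> x) \<noteq> 0" "y \<in> S" "g (\<phi> y) \<noteq> 0" using f(2) g(2) by blast
  from irredD[OF assms(1) c[OF f(1)] c[OF g(1)] this]
  show "\<exists>x\<in>\<phi> ` S. f x \<noteq> 0 \<and> g x \<noteq> 0" by blast
qed

definition scale_row :: "complex \<Rightarrow> M3 \<Rightarrow> M3"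
  where "scale_row c A = (\<chi> i j. if i = 1 then c * A$i$j else A$i$j)"

lemma scale_row_entry [simp]: "scale_row c A $ i $ j = (if i = 1 then c * A$i$j else A$i$j)"
  by (simp add: scale_row_def)

lemma det_scale_row: "det (scale_row c A) = c * det A"
  by (simp add: det_3 algebra_simps)

text \<open>Two points of \<open>E\<close> with determinant one lie on the rational curve obtained from the line
  through them by rescaling the first row.\<close>

lemma irred_curve:
  assumes line: "\<And>A B z. A \<in> E \<Longrightarrow> B \<in> E \<Longrightarrow> (\<chi> i j. (1 - z) * A$i$j + z * B$i$j) \<in> E"
    and scale: "\<And>A. A \<in> E \<Longrightarrow> det A \<noteq> 0 \<Longrightarrow> scale_row (1 / det A) A \<in> E"
  shows "irred {A \<in> E. det A = 1}"
  unfolding irred_def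
proof (intro ballI impI, elim bexE)
  fix f g A B assume f: "f \<in> polys mcoords" "f A \<noteq> 0" and g: "g \<in> polys mcoords" "g B \<noteq> 0"
    and AB: "A \<in> {A \<in> E. det A = 1}" "B \<in> {A \<in> E. det A = 1}"
  define M where "M z = (\<chi> i j. (1 - z) * A$i$j + z * B$i$j)" for z
  have M: "M z $ i $ j = poly [:A$i$j, B$i$j - A$i$j:] z" for z i j
    by (simp add: M_def algebra_simps)
  \<comment> \<open>Along the line through \<open>A\<close> and \<open>B\<close> the entries, and
    with them the determinant, are polynomials in the parameter.\<close>
  have "\<exists>d. \<forall>z. poly d z = det (M z)"
    unfolding det_3 M
    by (rule exI[of _ "[:A$1$1, B$1$1 - A$1$1:] * [:A$2$2, B$2$2 - A$2$2:] * [:A$3$3, B$3$3 - A$3$3:] +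
      [:A$1$2, B$1$2 - A$1$2:] * [:A$2$3, B$2$3 - A$2$3:] * [:A$3$1, B$3$1 - A$3$1:] +
      [:A$1$3, B$1$3 - A$1$3:] * [:A$2$1, B$2$1 - A$2$1:] * [:A$3$2, B$3$2 - A$3$2:] -
      [:A$1$1, B$1$1 - A$1$1:] * [:A$2$3, B$2$3 - A$2$3:] * [:A$3$2, B$3$2 - A$3$2:] -
      [:A$1$2, B$1$2 - A$1$2:] * [:A$2$1, B$2$1 - A$2$1:] * [:A$3$3, B$3$3 - A$3$3:] -
      [:A$1$3, B$1$3 - A$1$3:] * [:A$2$2, B$2$2 - A$2$2:] * [:A$3$1, B$3$1 - A$3$1:]"])
      (simp only: poly_add poly_mult poly_diff simp_thms)
  then obtain d where d: "\<And>z. poly d z = det (M z)" by blast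
  have M01: "M 0 = A" "M 1 = B" by (simp_all add: M_def vec_eq_iff)
  define C where "C z = scale_row (1 / det (M z)) (M z)" for z
  have C01: "C 0 = A" "C 1 = B" using AB by (simp_all add: C_def M01 vec_eq_iff)
  have C: "C z \<in> {A \<in> E. det A = 1}" if "poly d z \<noteq> 0" for z
    using that line[of A B z] AB scale[of "M z"] by (simp add: C_def d det_scale_row M_def)
  \<comment> \<open>On the curve a polynomial function is a fraction whose denominator is a power of
    \<open>d\<close>; away from the zeros of \<open>d\<close> the numerator alone decides whether it
    vanishes.\<close>
  have rat: "\<exists>k p. \<forall>z. poly d z \<noteq> 0 \<longrightarrow> h (C z) = poly p z / poly d z ^ k"
    if "h \<in> polys mcoords" for h
    using that
  proof induction
    case (const c)
    show ?case by (rule exI[of _ 0], rule exI[of _ "[:c:]"]) simp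
  next
    case (coord h)
    then obtain i j where h: "h = (\<lambda>A. A$i$j)" by auto
    show ?case
    proof (cases "i = 1")
      case True
      then show ?thesis
        by (intro exI[of _ "1::nat"] exI[of _ "[:A$i$j, B$i$j - A$i$j:]"]) (simp add: h C_def M d)
    next
      case False
      then show ?thesis
        by (intro exI[of _ "0::nat"] exI[of _ "[:A$i$j, B$i$j - A$i$j:]"]) (simp add: h C_def M)
    qed
  next
    case (add f g)
    then obtain k p k' p' where "\<forall>z. poly d z \<noteq> 0 \<longrightarrow> f (C z) = poly p z / poly d z ^ k"
      "\<forall>z. poly d z \<noteq> 0 \<longrightarrow> g (C z) = poly p' z / poly d z ^ k'" by blast
    then show ?case
      by (intro exI[of _ "k + k'"] exI[of _ "p * d ^ k' + p' * d ^ k"])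
        (simp add: power_add add_frac_eq)
  next
    case (mult f g)
    then obtain k p k' p' where "\<forall>z. poly d z \<noteq> 0 \<longrightarrow> f (C z) = poly p z / poly d z ^ k"
      "\<forall>z. poly d z \<noteq> 0 \<longrightarrow> g (C z) = poly p' z / poly d z ^ k'" by blast
    then show ?case
      by (intro exI[of _ "k + k'"] exI[of _ "p * p'"]) (simp add: power_add)
  qed
  obtain k p where p: "\<And>z. poly d z \<noteq> 0 \<Longrightarrow> f (C z) = poly p z / poly d z ^ k"
    using rat[OF f(1)] by blast
  obtain l q where q: "\<And>z. poly d z \<noteq> 0 \<Longrightarrow> g (C z) = poly q z / poly d z ^ l"
    using rat[OF g(1)] by blast
  have d01: "poly d 0 = 1" "poly d 1 = 1" using AB by (simp_all add: d M01)
  \<comment> \<open>\<open>A\<close> and \<open>B\<close> are the points of the curve with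
    parameters 0 and 1, so neither numerator is the zero polynomial, and a parameter avoiding
    finitely many roots serves for both functions.\<close>
  have "poly p 0 \<noteq> 0" using p[of 0] f(2) d01(1) C01(1) by auto
  moreover have "poly q 1 \<noteq> 0" using q[of 1] g(2) d01(2) C01(2) by auto
  ultimately have "p * q * d \<noteq> 0" using d01 by auto
  then have "finite {z. poly (p * q * d) z = 0}" by (rule poly_roots_finite)
  then obtain z where "poly (p * q * d) z \<noteq> 0"
    using infinite_UNIV_char_0[where 'a = complex] by (metis (mono_tags, lifting) UNIV_eq_I mem_Collect_eq)
  then have z: "poly p z \<noteq> 0" "poly q z \<noteq> 0" "poly d z \<noteq> 0" by auto
  show "\<exists>x\<in>{A \<in> E. det A = 1}. f x \<noteq> 0 \<and> g x \<noteq> 0"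
    by (rule bexI[OF _ C[OF z(3)]]) (use z p[OF z(3)] q[OF z(3)] in simp)
qed

lemma irred_pattern_group: "irred (pattern_group R)"
  unfolding pattern_group_def by (rule irred_curve) (auto simp: supported_on_def)

lemma pattern_group_connected_group:
  assumes "refl R" "trans R" shows "connected_group (pattern_group R)"
  unfolding connected_group_def algebraic_group_def
  using pattern_group_subgroup[OF assms] closedin_pattern_group irred_connectedin[OF irred_pattern_group] by blast

subsection \<open>Unipotent groups\<close>

text \<open>Every term of the Leibniz expansion other than the diagonal one contains a cycle of
  length two or three.\<close>

lemma det_acyclic:
  fixes A :: M3
  assumes "A$1$2 * A$2$1 = 0" "A$1$3 * A$3$1 = 0" "A$2$3 * A$3$2 = 0"
    "A$1$2 * A$2$3 * A$3$1 = 0" "A$1$3 * A$3$2 * A$2$1 = 0"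
  shows "det A = A$1$1 * A$2$2 * A$3$3"
proof -
  have "det A = A$1$1 * A$2$2 * A$3$3 + A$1$2 * A$2$3 * A$3$1 + A$1$3 * A$3$2 * A$2$1 -
    A$1$1 * (A$2$3 * A$3$2) - (A$1$2 * A$2$1) * A$3$3 - (A$1$3 * A$3$1) * A$2$2"
    by (simp add: det_3 algebra_simps)
  then show ?thesis unfolding assms by simp
qed

text \<open>A cycle in \<open>S\<close> would give a pair \<open>(i, i)\<close> by
  transitivity.\<close>

lemma strict_acyclic:
  fixes A :: M3
  assumes "trans S" "irrefl S" and A: "\<And>i j. i \<noteq> j \<Longrightarrow> (i, j) \<notin> S \<Longrightarrow> A$i$j = 0"
  shows "A$1$2 * A$2$1 = 0" "A$1$3 * A$3$1 = 0" "A$2$3 * A$3$2 = 0"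
    "A$1$2 * A$2$3 * A$3$1 = 0" "A$1$3 * A$3$2 * A$2$1 = 0"
proof -
  have 2: "A$i$j * A$j$i = 0" if "i \<noteq> j" for i j
    using A[OF that] A[of j i] that assms(1,2) by (metis irreflD mult_eq_0_iff transD)
  have 3: "A$i$j * A$j$k * A$k$i = 0" if "i \<noteq> j" "j \<noteq> k" "k \<noteq> i" for i j k
    using A[OF that(1)] A[OF that(2)] A[OF that(3)] assms(1,2) by (metis irreflD mult_eq_0_iff transD)
  show "A$1$2 * A$2$1 = 0" "A$1$3 * A$3$1 = 0" "A$2$3 * A$3$2 = 0"
    "A$1$2 * A$2$3 * A$3$1 = 0" "A$1$3 * A$3$2 * A$2$1 = 0"
    using 2 3 by simp_all
qed

lemma trans_strict_part: "trans R \<Longrightarrow> trans (R - R\<inverse>)"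
  unfolding trans_def by blast

lemma irrefl_strict_part: "irrefl (R - R\<inverse>)"
  by (auto simp: irrefl_def)

lemma unipotent_pattern_entries: "A \<in> unipotent_pattern S \<longleftrightarrow> (\<forall>i j. (i, j) \<notin> S \<longrightarrow> A$i$j = (if i = j then 1 else 0))"
  unfolding unipotent_pattern_def supported_on_def by (auto simp: mat_entry split: if_splits)

lemma unipotent_pattern_det:
  assumes "trans S" "irrefl S" "A \<in> unipotent_pattern S" shows "det A = 1"
proof -
  have "A$i$j = 0" if "i \<noteq> j" "(i, j) \<notin> S" for i j using assms(3) that by (simp add: unipotent_pattern_entries)
  from det_acyclic[OF strict_acyclic[OF assms(1,2) this]]
  show ?thesis using assms(2,3) by (simp add: unipotent_pattern_entries irrefl_def)
qed

lemma unipotent_pattern_mult: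
  assumes "trans S" "A \<in> unipotent_pattern S" "B \<in> unipotent_pattern S" shows "A ** B \<in> unipotent_pattern S"
proof -
  have "A ** B - mat 1 = (A - mat 1) ** (B - mat 1) + (A - mat 1) + (B - mat 1)"
    by (simp add: M3_eq_iff mult_entry mat_entry algebra_simps)
  then show ?thesis
    using assms unfolding unipotent_pattern_def by (simp only: mem_Collect_eq supported_on_add supported_on_trans_mult)
qed

text \<open>The four members of such a chain would be distinct, but there are only three indices.
  This bounds the nilpotency degree by three.\<close>

lemma strict_chain4:
  fixes S :: "(3 \<times> 3) set"
  assumes "trans S" "irrefl S" "(a, b) \<in> S" "(b, c) \<in> S" "(c, d) \<in> S"
  shows False
proof -
  have "a \<noteq> b" "b \<noteq> c" "c \<noteq> d" "a \<noteq> c" "b \<noteq> d" "a \<noteq> d"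
    using assms by (metis irreflD transD)+
  then show False using exhaust_3[of a] exhaust_3[of b] exhaust_3[of c] exhaust_3[of d] by auto
qed

lemma supported_on_empty: "supported_on {} = {0}"
  by (auto simp: supported_on_def vec_eq_iff)

lemma supported_on_strict_cube:
  assumes "trans S" "irrefl S" "N \<in> supported_on S" shows "N ** (N ** N) = 0"
proof -
  have "S O S O S = {}" using strict_chain4[OF assms(1,2)] by blast
  then show ?thesis using supported_on_mult[OF assms(3) supported_on_mult[OF assms(3,3)]] by (simp add: supported_on_empty)
qed

lemma unipotent_pattern_unipotent: "trans S \<Longrightarrow> irrefl S \<Longrightarrow> A \<in> unipotent_pattern S \<Longrightarrow> unipotent A"
  unfolding unipotent_def using supported_on_strict_cube[of S "A - mat 1"]
  by (intro exI[of _ 3]) (simp add: unipotent_pattern_def eval_nat_numeral)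

lemma unipotent_pattern_subset_pattern_group: "trans S \<Longrightarrow> irrefl S \<Longrightarrow> S \<subseteq> R \<Longrightarrow> refl R \<Longrightarrow> unipotent_pattern S \<subseteq> pattern_group R"
proof
  fix A assume S: "trans S" "irrefl S" "S \<subseteq> R" "refl R" and A: "A \<in> unipotent_pattern S"
  have "A = (A - mat 1) + mat 1" by simp
  also have "\<dots> \<in> supported_on R" by (intro supported_on_add supported_on_mat S) (use A S(3) supported_on_mono in \<open>auto simp: unipotent_pattern_def\<close>)
  finally show "A \<in> pattern_group R" using unipotent_pattern_det[OF S(1,2) A] by (simp add: pattern_group_def)
qed

text \<open>With diagonal entries 1 and no cycles, \<open>tr3 A\<close> and \<open>min3 A\<close>
  are both 3, so the adjugate is A^2 - 3 A + 3. Outside \<open>S\<close> its entries are 1 - 3 + 3 =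
  1 on the diagonal and 0 elsewhere.\<close>

lemma unipotent_pattern_adj3:
  assumes "trans S" "irrefl S" "A \<in> unipotent_pattern S" shows "adj3 A \<in> unipotent_pattern S"
proof -
  have A1: "A$i$i = 1" for i using assms(2,3) by (simp add: unipotent_pattern_entries irrefl_def)
  have A0: "A$i$j = 0" if "i \<noteq> j" "(i, j) \<notin> S" for i j using assms(3) that by (simp add: unipotent_pattern_entries)
  have ac: "A$1$2 * A$2$1 = 0" "A$1$3 * A$3$1 = 0" "A$2$3 * A$3$2 = 0"
    by (rule strict_acyclic[OF assms(1,2)]; fact A0)+
  have AA: "A ** A \<in> unipotent_pattern S" by (rule unipotent_pattern_mult[OF assms(1,3,3)])
  have t: "tr3 A = 3" "min3 A = 3"
    unfolding tr3_def min3_def A1 ac(1-3) by simp_all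
  show ?thesis
    using AA assms(3) t by (simp add: unipotent_pattern_entries adj3_def)
qed

lemma unipotent_pattern_subgroup:
  assumes "trans S" "irrefl S" shows "subgroup (unipotent_pattern S) SL3"
proof
  show "unipotent_pattern S \<subseteq> carrier SL3" using unipotent_pattern_det[OF assms] by auto
  show "\<one>\<^bsub>SL3\<^esub> \<in> unipotent_pattern S" by (simp add: unipotent_pattern_def supported_on_def)
  fix x assume x: "x \<in> unipotent_pattern S"
  show "inv\<^bsub>SL3\<^esub> x \<in> unipotent_pattern S" using unipotent_pattern_adj3[OF assms x] unipotent_pattern_det[OF assms x] by (simp add: inv_SL3)
  fix y assume "y \<in> unipotent_pattern S"
  then show "x \<otimes>\<^bsub>SL3\<^esub> y \<in> unipotent_pattern S" using unipotent_pattern_mult[OF assms(1) x] by simp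
qed

lemma closedin_unipotent_pattern: "closedin (zariski matrix_space) (unipotent_pattern S)"
proof -
  let ?F = "{\<lambda>A::M3. A $ i $ j - (if i = j then 1 else 0) | i j. (i, j) \<notin> S}"
  have "?F \<subseteq> polys mcoords"
    using polys_diff[OF entry_polys polys.const] by blast
  moreover have "unipotent_pattern S = {x. \<forall>f\<in>?F. f x = 0}"
  proof (intro equalityI subsetI)
    fix x assume "x \<in> unipotent_pattern S"
    then show "x \<in> {x. \<forall>f\<in>?F. f x = 0}" by (auto simp: unipotent_pattern_entries)
  next
    fix x assume x: "x \<in> {x. \<forall>f\<in>?F. f x = 0}"
    have "x $ i $ j - (if i = j then 1 else 0) = 0" if "(i, j) \<notin> S" for i j
    proof -
      have "(\<lambda>A::M3. A $ i $ j - (if i = j then 1 else 0)) \<in> ?F" using that by blast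
      from x[THEN CollectD, THEN bspec, OF this] show ?thesis by simp
    qed
    then show "x \<in> unipotent_pattern S" by (simp add: unipotent_pattern_entries)
  qed
  ultimately show ?thesis using closedin_polys_zeros by (simp only:)
qed

lemma unipotent_pattern_connected_group:
  assumes "trans S" "irrefl S" shows "connected_group (unipotent_pattern S)"
proof -
  have "irred {A \<in> unipotent_pattern S. det A = 1}"
  proof (rule irred_curve)
    \<comment> \<open>The determinant is 1 already, so the rescaling in \<open>irred_curve\<close>
      is by the factor 1.\<close>
    fix A assume "A \<in> unipotent_pattern S" "det A \<noteq> 0"
    moreover have "scale_row 1 A = A" by (simp add: vec_eq_iff)
    ultimately show "scale_row (1 / det A) A \<in> unipotent_pattern S" using unipotent_pattern_det[OF assms] by simp
  qed (auto simp: unipotent_pattern_entries)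
  moreover have "{A \<in> unipotent_pattern S. det A = 1} = unipotent_pattern S" using unipotent_pattern_det[OF assms] by auto
  ultimately show ?thesis
    unfolding connected_group_def algebraic_group_def
    using unipotent_pattern_subgroup[OF assms] closedin_unipotent_pattern irred_connectedin by metis
qed

lemma unipotent_power_eigen:
  fixes N :: M3
  assumes "N *v v = y *s v" shows "(((**) N) ^^ k) (mat 1) *v v = (y ^ k) *s v"
proof (induction k)
  case (Suc k)
  have "(((**) N) ^^ Suc k) (mat 1) *v v = N *v ((((**) N) ^^ k) (mat 1) *v v)"
    by (simp add: matrix_vector_mul_assoc)
  also have "\<dots> = y ^ k *s (N *v v)" by (simp add: Suc vector_scalar_commute)
  finally show ?case by (simp add: assms vec_eq_iff)
qed simp

text \<open>An eigenvector of \<open>A\<close> for \<open>x\<close> is one of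
  \<open>A - mat 1\<close> for \<open>x - 1\<close>, and some power of \<open>A - mat 1\<close> is
  zero.\<close>

lemma unipotent_eigen:
  fixes A :: M3
  assumes "unipotent A" "det (A - mat x) = 0" shows "x = 1"
proof -
  have "\<not> (\<exists>B. B ** (A - mat x) = mat 1)"
    using assms(2) by (metis det_I det_mul mult_zero_right zero_neq_one)
  then obtain v where v: "(A - mat x) *v v = 0" "v \<noteq> 0"
    using matrix_left_invertible_ker[of "A - mat x"] by blast
  have "(A - mat 1) *v v = (A - mat x) *v v + (x - 1) *s v"
    by (simp add: vec_eq_iff matrix_vector_mult_def mat_def sum_3 forall_3 algebra_simps)
  then have e: "(A - mat 1) *v v = (x - 1) *s v" using v(1) by simp
  obtain k where "(((**) (A - mat 1)) ^^ k) (mat 1) = 0" using assms(1) unfolding unipotent_def ..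
  then have "(x - 1) ^ k *s v = 0" using unipotent_power_eigen[OF e, of k] by simp
  then show ?thesis using v(2) by (auto simp: vec_eq_iff)
qed

text \<open>All roots of the characteristic polynomial of \<open>N = A - mat 1\<close> are 0; the
  roots are computed explicitly to conclude that the trace \<open>t\<close> of \<open>N\<close> is
  0.\<close>

lemma unipotent_trace:
  fixes A :: M3
  assumes "unipotent A" shows "tr3 A = 3"
proof -
  define N where "N = A - mat 1"
  define t c d where "t = tr3 N" and "c = min3 N" and "d = det N"
  have N: "A - mat (1 + y) = N - mat y" for y by (simp add: N_def M3_eq_iff mat_entry)
  have ch: "det (N - mat y) = - (y ^ 3) + t * y ^ 2 - c * y + d" for y
    by (simp add: det_3 mat_entry t_def c_def d_def tr3_def min3_def algebra_simps power2_eq_square power3_eq_cube)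
  have root: "y = 0" if "- (y ^ 3) + t * y ^ 2 - c * y + d = 0" for y
    using unipotent_eigen[OF assms, of "1 + y"] that ch[of y] by (simp add: N)
  \<comment> \<open>The cubic has some root; as this root must be 0, the constant term
    \<open>d\<close> vanishes.\<close>
  obtain y where "poly [:d, - c, t, -1:] y = 0"
    using fundamental_theorem_of_algebra_alt[of "[:d, - c, t, -1:]"] by auto
  then have y: "- (y ^ 3) + t * y ^ 2 - c * y + d = 0"
    by (simp add: algebra_simps power2_eq_square power3_eq_cube)
  from root[OF y] y have d0: "d = 0" by simp
  \<comment> \<open>The two roots of the remaining quadratic factor are written with a square root
    of its discriminant; their sum is \<open>t\<close>.\<close>
  define w where "w = csqrt (t\<^sup>2 - 4 * c)"
  have w: "w\<^sup>2 = t\<^sup>2 - 4 * c" by (simp add: w_def)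
  have q: "y = 0" if "y ^ 2 - t * y + c = 0" for y
  proof (rule root)
    have "- (y ^ 3) + t * y ^ 2 - c * y + d = - y * (y ^ 2 - t * y + c)"
      using d0 by (simp add: algebra_simps power2_eq_square power3_eq_cube)
    then show "- (y ^ 3) + t * y ^ 2 - c * y + d = 0" using that by simp
  qed
  have e: "((t + w) / 2)\<^sup>2 - t * ((t + w) / 2) + c = (w\<^sup>2 - (t\<^sup>2 - 4 * c)) / 4"
    "((t - w) / 2)\<^sup>2 - t * ((t - w) / 2) + c = (w\<^sup>2 - (t\<^sup>2 - 4 * c)) / 4"
    by (simp_all add: field_simps power2_eq_square)
  have "(t + w) / 2 = 0" by (rule q) (simp only: e w diff_self div_0)
  moreover have "(t - w) / 2 = 0" by (rule q) (simp only: e w diff_self div_0)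
  moreover have "t = (t + w) / 2 + (t - w) / 2" by (simp add: field_simps)
  ultimately have "t = 0" by simp
  then show ?thesis by (simp add: t_def N_def tr3_def mat_entry add.assoc)
qed

section \<open>Elementary matrices and normal unipotent subgroups\<close>

definition elementary :: "3 \<Rightarrow> 3 \<Rightarrow> complex \<Rightarrow> M3"
  where "elementary i j c = (\<chi> k l. if k = i \<and> l = j then c else if k = l then 1 else 0)"

lemma elementary_entry: "elementary i j c $ k $ l = (if k = i \<and> l = j then c else if k = l then 1 else 0)"
  by (simp add: elementary_def)

lemma elementary_det: "i \<noteq> j \<Longrightarrow> det (elementary i j c) = 1"
  using exhaust_3[of i] exhaust_3[of j] by (elim disjE) (simp_all add: det_3 elementary_entry)

lemma elementary_adj3: "i \<noteq> j \<Longrightarrow> adj3 (elementary i j c) = elementary i j (- c)"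
  using exhaust_3[of i] exhaust_3[of j] by (elim disjE) (simp_all add: M3_eq_iff adj3_entries elementary_entry)

lemma elementary_pattern_group: "refl R \<Longrightarrow> (i, j) \<in> R \<Longrightarrow> i \<noteq> j \<Longrightarrow> elementary i j c \<in> pattern_group R"
  using elementary_det[of i j c] by (auto simp: pattern_group_def supported_on_def elementary_entry refl_on_def)

text \<open>If both products lie in a group of unipotent matrices, both traces are 3, and the entry
  \<open>A$j$i\<close> must vanish.\<close>

lemma trace_conj_elementary:
  "i \<noteq> j \<Longrightarrow> tr3 (A ** (elementary i j 1 ** A ** elementary i j (- 1))) = tr3 (A ** A) - (A$j$i)\<^sup>2"
  using exhaust_3[of i] exhaust_3[of j]
  by (elim disjE) (simp_all add: tr3_def mult_entry elementary_entry algebra_simps power2_eq_square)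

text \<open>For \<open>(i, j) \<in> R\<close> the group \<open>V\<close> is stable under conjugation
  by \<open>elementary i j 1\<close>, and the trace identity kills the entry \<open>(j, i)\<close>
  of its members. The off-diagonal entries that survive contain no cycle, so the diagonal entries
  are eigenvalues and equal 1.\<close>

lemma unipotent_normal_subset:
  assumes R: "refl R" "trans R" and V: "V \<lhd> SL3\<lparr>carrier := pattern_group R\<rparr>" "\<And>A. A \<in> V \<Longrightarrow> unipotent A"
  shows "V \<subseteq> unipotent_pattern (R - R\<inverse>)"
proof
  fix A assume A: "A \<in> V"
  interpret P: group "SL3\<lparr>carrier := pattern_group R\<rparr>" by (rule SL3.subgroup_imp_group[OF pattern_group_subgroup[OF R]])
  interpret V: normal V "SL3\<lparr>carrier := pattern_group R\<rparr>" by (rule V(1))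
  have AR: "A \<in> pattern_group R" using V.subset A by auto
  have off: "A$j$i = 0" if ij: "i \<noteq> j" "(i, j) \<in> R" for i j
  proof -
    have g: "elementary i j 1 \<in> pattern_group R" by (rule elementary_pattern_group[OF R(1) ij(2,1)])
    have "elementary i j 1 \<otimes>\<^bsub>SL3\<lparr>carrier := pattern_group R\<rparr>\<^esub> A \<otimes>\<^bsub>SL3\<lparr>carrier := pattern_group R\<rparr>\<^esub> inv\<^bsub>SL3\<lparr>carrier := pattern_group R\<rparr>\<^esub> (elementary i j 1) \<in> V"
      by (rule V.inv_op_closed2) (use g A in auto)
    then have "elementary i j 1 ** A ** elementary i j (- 1) \<in> V"
      using g by (simp add: SL3.m_inv_consistent[OF pattern_group_subgroup[OF R]] inv_SL3 elementary_det ij elementary_adj3)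
    then have "A ** (elementary i j 1 ** A ** elementary i j (- 1)) \<in> V" "A ** A \<in> V"
      using V.m_closed[OF A] A by auto
    then have "(A$j$i)\<^sup>2 = 0"
      using unipotent_trace[OF V(2)] trace_conj_elementary[OF ij(1), of A] by simp
    then show ?thesis by simp
  qed
  have off': "A$i$j = 0" if "i \<noteq> j" "(i, j) \<notin> R - R\<inverse>" for i j
    using that off[of j i] AR by (auto simp: pattern_group_def supported_on_def)
  note S = trans_strict_part[OF R(2)] irrefl_strict_part[of R]
  have diag: "A$i$i = 1" for i
  proof (rule unipotent_eigen[OF V(2)[OF A]])
    have "(A - mat (A$i$i))$k$l = 0" if "k \<noteq> l" "(k, l) \<notin> R - R\<inverse>" for k l
      using off'[OF that] that by (simp add: mat_entry)
    from det_acyclic[OF strict_acyclic[OF S this]]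
    show "det (A - mat (A$i$i)) = 0" using exhaust_3[of i] by (auto simp: mat_entry)
  qed
  show "A \<in> unipotent_pattern (R - R\<inverse>)" using off' diag by (auto simp: unipotent_pattern_entries)
qed

text \<open>Conjugation replaces \<open>h - mat 1\<close> by
  \<open>g ** ((h - mat 1) ** adj3 g)\<close>, and the strict part of a preorder is stable under
  composition with the preorder on both sides.\<close>

lemma unipotent_pattern_normal:
  assumes R: "refl R" "trans R"
  shows "unipotent_pattern (R - R\<inverse>) \<lhd> SL3\<lparr>carrier := pattern_group R\<rparr>"
proof -
  let ?S = "R - R\<inverse>"
  note S = trans_strict_part[OF R(2)] irrefl_strict_part[of R]
  have sub: "unipotent_pattern ?S \<subseteq> pattern_group R" by (rule unipotent_pattern_subset_pattern_group[OF S _ R(1)]) auto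
  interpret P: group "SL3\<lparr>carrier := pattern_group R\<rparr>" by (rule SL3.subgroup_imp_group[OF pattern_group_subgroup[OF R]])
  show ?thesis
    unfolding P.normal_inv_iff
  proof (intro conjI ballI)
    show "subgroup (unipotent_pattern ?S) (SL3\<lparr>carrier := pattern_group R\<rparr>)"
      by (rule SL3.subgroup_incl[OF unipotent_pattern_subgroup[OF S] pattern_group_subgroup[OF R] sub])
    fix g h assume "g \<in> carrier (SL3\<lparr>carrier := pattern_group R\<rparr>)" and h: "h \<in> unipotent_pattern ?S"
    then have g: "g \<in> pattern_group R" by simp
    have d: "det g = 1" by (rule pattern_group_det[OF g])
    have "R O ?S O R \<subseteq> ?S"
    proof (rule subrelI, elim relcompE Pair_inject, hypsubst)
      fix x a b z assume h: "(x, a) \<in> R" "(a, b) \<in> ?S" "(b, z) \<in> R"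
      then have "(x, z) \<in> R" using R(2) by (meson DiffD1 transD)
      moreover have "(z, x) \<notin> R"
      proof
        assume "(z, x) \<in> R"
        then have "(b, a) \<in> R" using h R(2) by (meson transD)
        then show False using h(2) by blast
      qed
      ultimately show "(x, z) \<in> ?S" by blast
    qed
    moreover have "g ** ((h - mat 1) ** adj3 g) \<in> supported_on (R O ?S O R)"
      using g h supported_on_adj3[OF R] by (intro supported_on_mult) (auto simp: pattern_group_def unipotent_pattern_def)
    moreover have "g ** ((h - mat 1) ** adj3 g) = g ** h ** adj3 g - mat 1"
      using adj3_mult(2)[of g] d
      by (simp add: matrix_mul_assoc mult_diff_distrib)
    ultimately have "g ** h ** adj3 g \<in> unipotent_pattern ?S" unfolding unipotent_pattern_def using supported_on_mono by auto
    then show "g \<otimes>\<^bsub>SL3\<lparr>carrier := pattern_group R\<rparr>\<^esub> h \<otimes>\<^bsub>SL3\<lparr>carrier := pattern_group R\<rparr>\<^esub> inv\<^bsub>SL3\<lparr>carrier := pattern_group R\<rparr>\<^esub> g \<in> unipotent_pattern ?S"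
      using g by (simp add: SL3.m_inv_consistent[OF pattern_group_subgroup[OF R]] inv_SL3 d)
  qed
qed

lemma unipotent_radical_pattern_group:
  assumes R: "refl R" "trans R"
  shows "unipotent_radical (pattern_group R) = unipotent_pattern (R - R\<inverse>)"
  unfolding unipotent_radical_def
proof (rule Greatest_equality)
  note S = trans_strict_part[OF R(2)] irrefl_strict_part[of R]
  show "connected_group (unipotent_pattern (R - R\<inverse>)) \<and> unipotent_pattern (R - R\<inverse>) \<lhd> SL3\<lparr>carrier := pattern_group R\<rparr> \<and>
    (\<forall>A\<in>unipotent_pattern (R - R\<inverse>). unipotent A)"
    using unipotent_pattern_connected_group[OF S] unipotent_pattern_normal[OF R] unipotent_pattern_unipotent[OF S] by blast
  show "\<And>V. connected_group V \<and> V \<lhd> SL3\<lparr>carrier := pattern_group R\<rparr> \<and> (\<forall>A\<in>V. unipotent A) \<Longrightarrow>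
    V \<le> unipotent_pattern (R - R\<inverse>)"
    using unipotent_normal_subset[OF R] by blast
qed

subsection \<open>Levi subgroups\<close>

lemma diagonal_torus_pattern_group: "diagonal_torus = pattern_group Id"
  by (auto simp: diagonal_torus_def pattern_group_def supported_on_def)

lemma strict_O_right:
  assumes "trans R" shows "(R - R\<inverse>) O R \<subseteq> R - R\<inverse>"
proof (rule subrelI, elim relcompE Pair_inject, hypsubst)
  fix x a z assume h: "(x, a) \<in> R - R\<inverse>" "(a, z) \<in> R"
  then have "(x, z) \<in> R" using assms by (meson DiffD1 transD)
  moreover have "(z, x) \<notin> R"
  proof
    assume "(z, x) \<in> R"
    then have "(a, x) \<in> R" using h assms by (meson transD)
    then show False using h(1) by blast
  qed
  ultimately show "(x, z) \<in> R - R\<inverse>" by blast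
qed

lemma strict_O_left:
  assumes "trans R" shows "R O (R - R\<inverse>) \<subseteq> R - R\<inverse>"
proof (rule subrelI, elim relcompE Pair_inject, hypsubst)
  fix x a z assume h: "(x, a) \<in> R" "(a, z) \<in> R - R\<inverse>"
  then have "(x, z) \<in> R" using assms by (meson DiffD1 transD)
  moreover have "(z, x) \<notin> R"
  proof
    assume "(z, x) \<in> R"
    then have "(z, a) \<in> R" using h assms by (meson transD)
    then show False using h(2) by blast
  qed
  ultimately show "(x, z) \<in> R - R\<inverse>" by blast
qed

lemma sym_part: "refl R \<Longrightarrow> refl (R \<inter> R\<inverse>)" "trans R \<Longrightarrow> trans (R \<inter> R\<inverse>)"
  by (auto simp: refl_on_def intro: trans_Int)

text \<open>By transitivity a cycle in \<open>R\<close> runs inside the symmetric part, so cutting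
  off the one-directional entries changes no term of the Leibniz expansion.\<close>

lemma det_sym_part:
  assumes R: "trans R" and A: "A \<in> supported_on R"
    and L: "\<And>i j. L$i$j = (if (j, i) \<in> R then A$i$j else 0)"
    and d: "\<And>i. (i, i) \<in> R"
  shows "det L = det (A :: M3)"
proof -
  have 0: "A$i$j = 0" if "(i, j) \<notin> R" for i j using A that by (simp add: supported_on_def)
  have 1: "L$i$i = A$i$i" for i using d by (simp add: L)
  have 2: "L$i$j * L$j$i = A$i$j * A$j$i" for i j
    using 0[of i j] 0[of j i] by (auto simp: L)
  have 3: "L$i$j * L$j$k * L$k$i = A$i$j * A$j$k * A$k$i" for i j k
  proof (cases "(i, j) \<in> R \<and> (j, k) \<in> R \<and> (k, i) \<in> R")
    case True
    then have "(j, i) \<in> R" "(k, j) \<in> R" "(i, k) \<in> R" using R by (meson transD)+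
    then show ?thesis by (simp add: L)
  next
    case False
    then show ?thesis using 0[of i j] 0[of j k] 0[of k i] by (auto simp: L)
  qed
  have e: "det M = M$1$1 * M$2$2 * M$3$3 + M$1$2 * M$2$3 * M$3$1 + M$1$3 * M$3$2 * M$2$1 -
    M$1$1 * (M$2$3 * M$3$2) - (M$1$2 * M$2$1) * M$3$3 - (M$1$3 * M$3$1) * M$2$2" for M :: M3
    by (simp add: det_3 algebra_simps)
  show ?thesis unfolding e 1 2 3 ..
qed

lemma pattern_group_levi_decomposition:
  assumes R: "refl R" "trans R"
  shows "pattern_group (R \<inter> R\<inverse>) <#>\<^bsub>SL3\<^esub> unipotent_pattern (R - R\<inverse>) = pattern_group R"
proof
  note S = trans_strict_part[OF R(2)] irrefl_strict_part[of R]
  interpret P: subgroup "pattern_group R" SL3 by (rule pattern_group_subgroup[OF R])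
  have "pattern_group (R \<inter> R\<inverse>) \<subseteq> pattern_group R" by (rule pattern_group_mono) auto
  moreover have "unipotent_pattern (R - R\<inverse>) \<subseteq> pattern_group R" by (rule unipotent_pattern_subset_pattern_group[OF S _ R(1)]) auto
  ultimately show "pattern_group (R \<inter> R\<inverse>) <#>\<^bsub>SL3\<^esub> unipotent_pattern (R - R\<inverse>) \<subseteq> pattern_group R"
    unfolding set_mult_def using P.m_closed by blast
  show "pattern_group R \<subseteq> pattern_group (R \<inter> R\<inverse>) <#>\<^bsub>SL3\<^esub> unipotent_pattern (R - R\<inverse>)"
  proof
    fix A assume A: "A \<in> pattern_group R"
    \<comment> \<open>The symmetric part of \<open>A\<close> is the Levi factor. The rest
      \<open>A - L\<close> is supported on the strict part and stays so after multiplication by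
      \<open>adj3 L\<close>.\<close>
    define L where "L = (\<chi> i j. if (j, i) \<in> R then A$i$j else 0)"
    have Le: "L$i$j = (if (j, i) \<in> R then A$i$j else 0)" for i j by (simp add: L_def)
    have AR: "A \<in> supported_on R" "det A = 1" using A by (auto simp: pattern_group_def)
    have "det L = det A" by (rule det_sym_part[OF R(2) AR(1) Le]) (use R(1) in \<open>auto simp: refl_on_def\<close>)
    then have dL: "det L = 1" using AR by simp
    have LP: "L \<in> supported_on (R \<inter> R\<inverse>)" using AR(1) by (auto simp: supported_on_def Le)
    have "A - L \<in> supported_on (R - R\<inverse>)" using AR(1) by (auto simp: supported_on_def Le)
    moreover have "adj3 L \<in> supported_on R" using supported_on_adj3[OF sym_part(1)[OF R(1)] sym_part(2)[OF R(2)] LP] supported_on_mono by blast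
    ultimately have "adj3 L ** (A - L) \<in> supported_on (R - R\<inverse>)"
      using supported_on_mono[OF strict_O_left[OF R(2)] supported_on_mult] by blast
    moreover have "adj3 L ** (A - L) = adj3 L ** A - mat 1"
      by (simp add: mult_diff_distrib adj3_mult dL)
    ultimately have u: "adj3 L ** A \<in> unipotent_pattern (R - R\<inverse>)" by (simp add: unipotent_pattern_def)
    have "A = L ** (adj3 L ** A)" by (simp add: matrix_mul_assoc adj3_mult dL)
    moreover have "L \<in> pattern_group (R \<inter> R\<inverse>)" using LP dL by (simp add: pattern_group_def)
    ultimately show "A \<in> pattern_group (R \<inter> R\<inverse>) <#>\<^bsub>SL3\<^esub> unipotent_pattern (R - R\<inverse>)"
      unfolding set_mult_def using u by auto
  qed
qed

lemma pattern_group_Int_unipotent_pattern: "refl R \<Longrightarrow> trans R \<Longrightarrow> pattern_group (R \<inter> R\<inverse>) \<inter> unipotent_pattern (R - R\<inverse>) = {mat 1}"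
proof
  assume R: "refl R" "trans R"
  show "pattern_group (R \<inter> R\<inverse>) \<inter> unipotent_pattern (R - R\<inverse>) \<subseteq> {mat 1}"
  proof
    fix A assume A: "A \<in> pattern_group (R \<inter> R\<inverse>) \<inter> unipotent_pattern (R - R\<inverse>)"
    have "A$i$j = (if i = j then 1 else 0)" for i j
      using A by (cases "(i, j) \<in> R - R\<inverse>") (auto simp: unipotent_pattern_entries pattern_group_def supported_on_def)
    then show "A \<in> {mat 1}" by (simp add: vec_eq_iff mat_entry)
  qed
  show "{mat 1} \<subseteq> pattern_group (R \<inter> R\<inverse>) \<inter> unipotent_pattern (R - R\<inverse>)"
    using supported_on_mat[OF sym_part(1)[OF R(1)]] by (auto simp: pattern_group_def unipotent_pattern_def supported_on_def)
qed

text \<open>A Levi subgroup containing the torus is fixed by conjugation with the central torus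
  element \<open>z\<close>, because commutators with \<open>z\<close> lie in the unipotent radical.\<close>

lemma levi_pattern_group:
  assumes R: "refl R" "trans R" and z: "z \<in> pattern_group Id"
    and zR: "\<And>i j. (i, j) \<in> R \<Longrightarrow> z$i$i = z$j$j \<longleftrightarrow> (j, i) \<in> R"
  shows "(THE M. levi_subgroup M (pattern_group R) \<and> diagonal_torus \<subseteq> M) = pattern_group (R \<inter> R\<inverse>)"
proof (rule the_equality)
  let ?L = "pattern_group (R \<inter> R\<inverse>)" and ?U = "unipotent_pattern (R - R\<inverse>)"
  note S = trans_strict_part[OF R(2)] irrefl_strict_part[of R]
  note L = sym_part(1)[OF R(1)] sym_part(2)[OF R(2)]
  show "levi_subgroup ?L (pattern_group R) \<and> diagonal_torus \<subseteq> ?L"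
    unfolding levi_subgroup_def algebraic_group_def diagonal_torus_pattern_group unipotent_radical_pattern_group[OF R]
    using pattern_group_subgroup[OF L] closedin_pattern_group pattern_group_Int_unipotent_pattern[OF R] pattern_group_levi_decomposition[OF R]
      pattern_group_mono[of Id "R \<inter> R\<inverse>"] R(1) by (auto simp: refl_on_def)
  fix M assume "levi_subgroup M (pattern_group R) \<and> diagonal_torus \<subseteq> M"
  then have M: "subgroup M SL3" "M \<inter> ?U = {mat 1}" "M <#>\<^bsub>SL3\<^esub> ?U = pattern_group R" "pattern_group Id \<subseteq> M"
    unfolding levi_subgroup_def algebraic_group_def diagonal_torus_pattern_group unipotent_radical_pattern_group[OF R] by auto
  interpret M: subgroup M SL3 by (rule M(1))
  have U1: "mat 1 \<in> ?U" using pattern_group_Int_unipotent_pattern[OF R] by blast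
  have MR: "M \<subseteq> pattern_group R"
  proof
    fix m assume "m \<in> M"
    then have "m ** mat 1 \<in> M <#>\<^bsub>SL3\<^esub> ?U"
      unfolding set_mult_def using U1 by (intro UN_I[of m] UN_I[of "mat 1"]) simp_all
    then show "m \<in> pattern_group R" by (simp add: M(3))
  qed
  have Msub: "M \<subseteq> ?L"
  proof
    fix m assume m: "m \<in> M"
    have mR: "m \<in> pattern_group R" "z \<in> pattern_group R" using MR m M(4) z by auto
    have d: "det m = 1" "det z = 1" using mR by (auto dest: pattern_group_det)
    have zd: "z$i$j = 0" if "i \<noteq> j" for i j using z that by (auto simp: pattern_group_def supported_on_def)
    have zm: "(z ** m)$i$j = z$i$i * m$i$j" "(m ** z)$i$j = m$i$j * z$j$j" for i j
      using exhaust_3[of i] exhaust_3[of j] by (auto simp: mult_entry zd)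
    \<comment> \<open>The commutator of \<open>z\<close> and \<open>m\<close>. It differs from the
      identity by \<open>(z ** m - m ** z) ** adj3 (m ** z)\<close>; the first factor has entries
      \<open>(z$i$i - z$j$j) * m$i$j\<close>, which vanish on the symmetric part of
      \<open>R\<close>.\<close>
    let ?w = "z ** m ** adj3 z ** adj3 m"
    have "z \<in> M" using z M(4) by blast
    then have wM: "?w \<in> M"
      using m M.m_closed M.m_inv_closed[of z] M.m_inv_closed[of m] by (simp add: inv_SL3 d)
    have "z ** m - m ** z \<in> supported_on (R - R\<inverse>)"
      using mR(1) zR by (auto simp: supported_on_def pattern_group_def zm)
    moreover have "adj3 (m ** z) \<in> supported_on R"
      using supported_on_adj3[OF R] supported_on_trans_mult[OF R(2)] mR by (auto simp: pattern_group_def)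
    ultimately have "(z ** m - m ** z) ** adj3 (m ** z) \<in> supported_on (R - R\<inverse>)"
      using supported_on_mono[OF strict_O_right[OF R(2)] supported_on_mult] by blast
    moreover have "(z ** m - m ** z) ** adj3 (m ** z) = ?w - mat 1"
      using adj3_mult(2)[of "m ** z"] by (simp add: mult_diff_distrib det_mul d adj3_product matrix_mul_assoc)
    ultimately have "?w \<in> ?U" by (simp add: unipotent_pattern_def)
    then have "?w = mat 1" using wM M(2) by blast
    then have "?w ** (m ** z) = m ** z" by simp
    moreover have "?w ** (m ** z) = z ** m"
    proof -
      have "?w ** (m ** z) = z ** m ** (adj3 z ** (adj3 m ** m) ** z)" by (simp only: matrix_mul_assoc)
      then show ?thesis by (simp add: adj3_mult d)
    qed
    ultimately have "z ** m = m ** z" by simp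
    then have c: "z$i$i * m$i$j = m$i$j * z$j$j" for i j using zm by metis
    have "m$i$j = 0" if "(i, j) \<notin> R \<inter> R\<inverse>" for i j
    proof (cases "(i, j) \<in> R")
      case True
      then have "z$i$i \<noteq> z$j$j" using zR[OF True] that by auto
      then show ?thesis using c[of i j] by (auto simp: mult.commute)
    qed (use mR(1) in \<open>auto simp: pattern_group_def supported_on_def\<close>)
    then show "m \<in> ?L" using d by (auto simp: pattern_group_def supported_on_def)
  qed
  \<comment> \<open>In a factorization \<open>l = m ** u\<close> the factor
    \<open>u = adj3 m ** l\<close> lies both in \<open>?L\<close> and in the unipotent radical,
    hence is trivial.\<close>
  moreover have "?L \<subseteq> M"
  proof
    fix l assume l: "l \<in> ?L"
    have "?L \<subseteq> pattern_group R" by (rule pattern_group_mono) auto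
    then have "l \<in> M <#>\<^bsub>SL3\<^esub> ?U" using l M(3) by blast
    then obtain m u where mu: "m \<in> M" "u \<in> ?U" "l = m ** u" unfolding set_mult_def by auto
    interpret L: subgroup ?L SL3 by (rule pattern_group_subgroup[OF L])
    have d: "det m = 1" using mu(1) Msub pattern_group_det by blast
    have "adj3 m ** l \<in> ?L" using L.m_closed[OF L.m_inv_closed l, of m] mu(1) Msub d by (auto simp: inv_SL3)
    moreover have "adj3 m ** l = u" by (simp add: mu(3) matrix_mul_assoc adj3_mult d)
    ultimately have "u = mat 1" using mu(2) pattern_group_Int_unipotent_pattern[OF R] by auto
    then show "l \<in> M" using mu by simp
  qed
  ultimately show "M = ?L" by blast
qed

lemma pattern_group_connected_reductive:
  assumes "refl R" "trans R" shows "connected_reductive (pattern_group (R \<inter> R\<inverse>))"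
proof -
  note L = sym_part(1)[OF assms(1)] sym_part(2)[OF assms(2)]
  have e: "R \<inter> R\<inverse> - (R \<inter> R\<inverse>)\<inverse> = {}" by auto
  show ?thesis
    unfolding connected_reductive_def unipotent_radical_pattern_group[OF L] e
    using pattern_group_connected_group[OF L] by (simp add: unipotent_pattern_def supported_on_empty)
qed

subsection \<open>Borel subgroups\<close>

definition upper_rel :: "(3 \<times> 3) set"
  where "upper_rel = {(1,1), (1,2), (1,3), (2,2), (2,3), (3,3)}"

lemma upper_rel_props: "refl upper_rel" "trans upper_rel"
proof -
  show "refl upper_rel" using exhaust_3 by (auto simp: refl_on_def upper_rel_def)
  show "trans upper_rel" by (auto simp: trans_def upper_rel_def)
qed

lemma upper_triangular_pattern_group: "upper_triangular = pattern_group upper_rel"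
  by (auto simp: upper_triangular_def pattern_group_def supported_on_def upper_rel_def forall_3)

lemma exp_derived_incl: "subgroup H SL3 \<Longrightarrow> (derived SL3 ^^ n) H \<subseteq> H"
proof (induction n)
  case (Suc n)
  show ?case using SL3.derived_incl[OF Suc.IH[OF Suc.prems] Suc.prems] by simp
qed simp

text \<open>Moves the derived series from the changing group \<open>H\<close> into
  \<open>SL3\<close>, where the derived subgroup is monotone.\<close>

lemma exp_derived_consistent:
  assumes "subgroup H SL3" shows "(derived (SL3\<lparr>carrier := H\<rparr>) ^^ n) H = (derived SL3 ^^ n) H"
  by (induction n) (simp_all add: SL3.derived_consistent[OF exp_derived_incl[OF assms] assms])

lemma solvable_SL3_iff:
  assumes "subgroup H SL3"
  shows "solvable (SL3\<lparr>carrier := H\<rparr>) \<longleftrightarrow> (\<exists>n. (derived SL3 ^^ n) H = {mat 1})"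
proof -
  interpret H: group "SL3\<lparr>carrier := H\<rparr>" by (rule SL3.subgroup_imp_group[OF assms])
  show ?thesis using H.solvable_iff_trivial_derived_seq by (simp add: exp_derived_consistent[OF assms])
qed

text \<open>A commutator minus the identity is \<open>(g ** h - h ** g) ** adj3 (h ** g)\<close>,
  and \<open>S\<close> absorbs upper triangular factors on the right. One application handles one
  step of the derived series.\<close>

lemma derived_subset_unipotent_pattern:
  assumes S: "trans S" "irrefl S" "S O upper_rel \<subseteq> S" and K: "K \<subseteq> pattern_group upper_rel"
    and c: "\<And>g h. g \<in> K \<Longrightarrow> h \<in> K \<Longrightarrow> g ** h - h ** g \<in> supported_on S"
  shows "derived SL3 K \<subseteq> unipotent_pattern S"
  unfolding derived_def
proof (rule SL3.generate_subgroup_incl[OF _ unipotent_pattern_subgroup[OF S(1,2)]])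
  have "g ** h ** adj3 g ** adj3 h \<in> unipotent_pattern S" if gh: "g \<in> K" "h \<in> K" for g h
  proof -
    have d: "det g = 1" "det h = 1" using K gh pattern_group_det by blast+
    have "adj3 (h ** g) \<in> supported_on upper_rel"
      using supported_on_adj3[OF upper_rel_props] supported_on_trans_mult[OF upper_rel_props(2)] gh K by (auto simp: pattern_group_def)
    then have "(g ** h - h ** g) ** adj3 (h ** g) \<in> supported_on S"
      using supported_on_mono[OF S(3) supported_on_mult[OF c[OF gh]]] by blast
    moreover have "(g ** h - h ** g) ** adj3 (h ** g) = g ** h ** adj3 g ** adj3 h - mat 1"
      using adj3_mult(2)[of "h ** g"] by (simp add: mult_diff_distrib det_mul d adj3_product matrix_mul_assoc)
    ultimately show ?thesis by (simp add: unipotent_pattern_def)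
  qed
  moreover have "det g = 1" if "g \<in> K" for g using K that pattern_group_det by blast
  ultimately show "derived_set SL3 K \<subseteq> unipotent_pattern S" by (auto simp: inv_SL3)
qed

lemma solvable_upper:
  assumes K: "subgroup K SL3" "K \<subseteq> pattern_group upper_rel"
  shows "solvable (SL3\<lparr>carrier := K\<rparr>)"
proof -
  \<comment> \<open>\<open>S1\<close> supports the strictly upper triangular matrices and
    \<open>S2\<close> only the corner; each derived subgroup moves one superdiagonal further, and
    the third is trivial.\<close>
  define S1 :: "(3 \<times> 3) set" where "S1 = {(1,2), (1,3), (2,3)}"
  define S2 :: "(3 \<times> 3) set" where "S2 = {(1,3)}"
  have S1: "trans S1" "irrefl S1" "S1 O upper_rel \<subseteq> S1" "unipotent_pattern S1 \<subseteq> pattern_group upper_rel"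
  proof -
    show 1: "trans S1" "irrefl S1" "S1 O upper_rel \<subseteq> S1"
      by (auto simp: trans_def irrefl_def S1_def upper_rel_def)
    show "unipotent_pattern S1 \<subseteq> pattern_group upper_rel"
      by (rule unipotent_pattern_subset_pattern_group[OF 1(1,2) _ upper_rel_props(1)]) (auto simp: S1_def upper_rel_def)
  qed
  have S2: "trans S2" "irrefl S2" "S2 O upper_rel \<subseteq> S2" "unipotent_pattern S2 \<subseteq> pattern_group upper_rel"
  proof -
    show 1: "trans S2" "irrefl S2" "S2 O upper_rel \<subseteq> S2"
      by (auto simp: trans_def irrefl_def S2_def upper_rel_def)
    show "unipotent_pattern S2 \<subseteq> pattern_group upper_rel"
      by (rule unipotent_pattern_subset_pattern_group[OF 1(1,2) _ upper_rel_props(1)]) (auto simp: S2_def upper_rel_def)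
  qed
  have "derived SL3 K \<subseteq> unipotent_pattern S1"
    by (rule derived_subset_unipotent_pattern[OF S1(1-3) K(2)])
      (use K(2) in \<open>auto simp: pattern_group_def supported_on_def upper_rel_def S1_def forall_3 mult_entry subset_iff\<close>)
  then have "derived SL3 (derived SL3 K) \<subseteq> derived SL3 (unipotent_pattern S1)" by (rule SL3.mono_derived)
  also have "\<dots> \<subseteq> unipotent_pattern S2"
    by (rule derived_subset_unipotent_pattern[OF S2(1-3) S1(4)])
      (auto simp: unipotent_pattern_entries supported_on_def S1_def S2_def forall_3 mult_entry)
  finally have "derived SL3 (derived SL3 (derived SL3 K)) \<subseteq> derived SL3 (unipotent_pattern S2)" by (rule SL3.mono_derived)
  also have "\<dots> \<subseteq> unipotent_pattern {}"
    by (rule derived_subset_unipotent_pattern[OF _ _ _ S2(4)])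
      (auto simp: unipotent_pattern_entries supported_on_def S2_def forall_3 mult_entry trans_def irrefl_def)
  finally have "(derived SL3 ^^ 3) K \<subseteq> {mat 1}" by (simp add: eval_nat_numeral unipotent_pattern_def supported_on_empty)
  moreover have "mat 1 \<in> (derived SL3 ^^ 3) K"
    using subgroup.one_closed[OF SL3.exp_of_derived_is_subgroup[OF K(1), of 3]] by simp
  ultimately show ?thesis unfolding solvable_SL3_iff[OF K(1)] by blast
qed

section \<open>Transvections and copies of \<open>SL\<^sub>2\<close>\<close>

definition dot3 :: "complex^3 \<Rightarrow> complex^3 \<Rightarrow> complex"
  where "dot3 \<phi> v = \<phi>$1 * v$1 + \<phi>$2 * v$2 + \<phi>$3 * v$3"

text \<open>The matrix of the map sending \<open>x\<close> to \<open>x + dot3 \<phi> x *s v\<close>;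
  it has determinant one exactly when \<open>v\<close> lies in the kernel of
  \<open>\<phi>\<close>.\<close>

definition transvection :: "complex^3 \<Rightarrow> complex^3 \<Rightarrow> M3"
  where "transvection v \<phi> = (\<chi> i j. (if i = j then 1 else 0) + v$i * \<phi>$j)"

lemma transvection_entry: "transvection v \<phi> $ i $ j = (if i = j then 1 else 0) + v$i * \<phi>$j"
  by (simp add: transvection_def)

lemma dot3_linear:
  "dot3 \<phi> (v + w) = dot3 \<phi> v + dot3 \<phi> w" "dot3 (\<phi> + \<psi>) v = dot3 \<phi> v + dot3 \<psi> v"
  "dot3 \<phi> (- v) = - dot3 \<phi> v" "dot3 \<phi> (v - w) = dot3 \<phi> v - dot3 \<phi> w"
  "dot3 \<phi> (c *s v) = c * dot3 \<phi> v" "dot3 (c *s \<phi>) v = c * dot3 \<phi> v"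
  by (simp_all add: dot3_def algebra_simps)

lemma transvection_mult: "dot3 \<phi> w = 0 \<Longrightarrow> transvection v \<phi> ** transvection w \<phi> = transvection (v + w) \<phi>"
proof -
  assume "dot3 \<phi> w = 0"
  moreover have "(transvection v \<phi> ** transvection w \<phi>)$i$j = transvection (v + w) \<phi> $i$j + v$i * dot3 \<phi> w * \<phi>$j" for i j
    using exhaust_3[of i] exhaust_3[of j]
    by (elim disjE) (simp_all add: mult_entry transvection_entry dot3_def algebra_simps)
  ultimately show ?thesis by (simp add: vec_eq_iff)
qed

lemma transvection_det: "det (transvection v \<phi>) = 1 + dot3 \<phi> v"
  by (simp add: det_3 transvection_entry dot3_def algebra_simps)

lemma transvection_adj3: "dot3 \<phi> v = 0 \<Longrightarrow> adj3 (transvection v \<phi>) = transvection (- v) \<phi>"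
proof -
  assume h: "dot3 \<phi> v = 0"
  then have d: "det (transvection v \<phi>) = 1" by (simp add: transvection_det)
  have h': "dot3 \<phi> (- v) = 0" using h by (simp add: dot3_linear)
  have "transvection v \<phi> ** transvection (- v) \<phi> = mat 1"
    unfolding transvection_mult[OF h'] by (simp add: vec_eq_iff transvection_entry mat_entry)
  then have "adj3 (transvection v \<phi>) ** (transvection v \<phi> ** transvection (- v) \<phi>) = adj3 (transvection v \<phi>)" by simp
  then show ?thesis by (simp add: matrix_mul_assoc adj3_mult d)
qed

lemma transvection_conj:
  assumes "det g = 1"
  shows "g ** transvection v \<phi> ** adj3 g = transvection (g *v v) (\<phi> v* adj3 g)"
proof -
  have "transvection v \<phi> = mat 1 + (\<chi> i j. v$i * \<phi>$j)"
    by (simp add: vec_eq_iff transvection_entry mat_entry)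
  then have "g ** transvection v \<phi> ** adj3 g = g ** adj3 g + g ** (\<chi> i j. v$i * \<phi>$j) ** adj3 g"
    by (simp add: vec_eq_iff mult_entry mat_entry algebra_simps)
  also have "g ** adj3 g = mat 1" by (simp add: adj3_mult assms)
  also have "g ** (\<chi> i j. v$i * \<phi>$j) ** adj3 g = (\<chi> i j. (g *v v)$i * (\<phi> v* adj3 g)$j)"
    by (simp add: vec_eq_iff mult_entry matrix_vector_mult_def vector_matrix_mult_def sum_3 algebra_simps)
  finally show ?thesis by (simp add: vec_eq_iff transvection_entry mat_entry)
qed

lemma transvection_conj_transvection:
  assumes "dot3 \<psi> u = 0"
  shows "transvection u \<psi> ** transvection x \<theta> ** adj3 (transvection u \<psi>) = transvection (x + dot3 \<psi> x *s u) (\<theta> + (- dot3 \<theta> u) *s \<psi>)"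
proof -
  have "transvection u \<psi> *v x = x + dot3 \<psi> x *s u"
    by (simp add: vec_eq_iff forall_3 matrix_vector_mult_def sum_3 transvection_entry dot3_def algebra_simps)
  moreover have "\<theta> v* transvection (- u) \<psi> = \<theta> + (- dot3 \<theta> u) *s \<psi>"
    by (simp add: vec_eq_iff forall_3 vector_matrix_mult_def sum_3 transvection_entry dot3_def algebra_simps)
  ultimately show ?thesis
    using transvection_conj[of "transvection u \<psi>" x \<theta>] assms by (simp add: transvection_det transvection_adj3)
qed

lemma transvection_scale: "transvection (a *s v) (b *s \<phi>) = transvection ((a * b) *s v) \<phi>"
  by (simp add: vec_eq_iff transvection_entry)

text \<open>On the plane with basis \<open>v\<close>, \<open>u\<close> the groups \<open>E\<close>
  and \<open>F\<close> act as the upper and lower unipotent matrices of order two, and they fix the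
  common kernel of the two forms. In this basis \<open>weyl a\<close> has the rows (0, a) and (-1/a,
  0).\<close>

locale transvection_pair =
  fixes v \<phi> u \<psi> :: "complex^3"
  assumes dots: "dot3 \<phi> v = 0" "dot3 \<psi> u = 0" "dot3 \<phi> u = 1" "dot3 \<psi> v = 1"
begin

abbreviation "E c \<equiv> transvection (c *s v) \<phi>"
abbreviation "F c \<equiv> transvection (c *s u) \<psi>"

definition "weyl a = E a ** F (- 1 / a) ** E a"

lemma det_EF: "det (E c) = 1" "det (F c) = 1"
  by (simp_all add: transvection_det dot3_linear dots)

lemma det_weyl: "det (weyl a) = 1"
  by (simp only: weyl_def det_mul det_EF mult_1)

lemma weyl_conj:
  assumes "a \<noteq> 0"
  shows "weyl a ** E c ** adj3 (weyl a) = F (- c / a\<^sup>2)"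
proof -
  have EF0: "dot3 \<phi> (a *s v) = 0" "dot3 \<psi> (a *s u) = 0" for a
    by (simp_all add: dot3_linear dots)
  have "weyl a ** E c ** adj3 (weyl a) =
    E a ** (F (- 1 / a) ** (E a ** E c ** adj3 (E a)) ** adj3 (F (- 1 / a))) ** adj3 (E a)"
    by (simp only: weyl_def adj3_product det_mul det_EF mult_1 matrix_mul_assoc)
  also have "E a ** E c ** adj3 (E a) = E c"
    unfolding transvection_conj_transvection[OF EF0(1)] by (simp add: dot3_linear dots)
  also have "F (- 1 / a) ** E c ** adj3 (F (- 1 / a)) = transvection (c *s v + (- c / a) *s u) (\<phi> + (1 / a) *s \<psi>)"
    unfolding transvection_conj_transvection[OF EF0(2)] by (simp add: dot3_linear dots vec_eq_iff transvection_entry)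
  also have "E a ** transvection (c *s v + (- c / a) *s u) (\<phi> + (1 / a) *s \<psi>) ** adj3 (E a) =
    transvection ((- c / a) *s u) ((1 / a) *s \<psi>)"
    unfolding transvection_conj_transvection[OF EF0(1)] using assms
    by (simp add: dot3_linear dots vec_eq_iff transvection_entry)
  also have "\<dots> = F (- c / a\<^sup>2)"
    unfolding transvection_scale by (simp add: power2_eq_square)
  finally show ?thesis .
qed

end

lemma transvection_pair_swap: "transvection_pair v \<phi> u \<psi> \<Longrightarrow> transvection_pair u \<psi> v \<phi>"
  by (auto simp: transvection_pair_def)

text \<open>The product of two Weyl elements acts on the root group by the factor \<open>4\<close>, so that root
  elements are commutators.\<close>

lemma transvection_pair_derived:
  assumes "transvection_pair v \<phi> u \<psi>" and M: "subgroup M SL3"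
    and EM: "\<And>c. transvection (c *s v) \<phi> \<in> M" and FM: "\<And>c. transvection (c *s u) \<psi> \<in> M"
  shows "transvection (c *s v) \<phi> \<in> derived SL3 M"
proof -
  interpret transvection_pair v \<phi> u \<psi> by fact
  interpret sw: transvection_pair u \<psi> v \<phi> by (rule transvection_pair_swap[OF assms(1)])
  interpret M: subgroup M SL3 by fact
  \<comment> \<open>\<open>weyl 1\<close> takes \<open>E c\<close> to \<open>F (- c)\<close>, and
    the swapped Weyl element with parameter 1/2 takes \<open>F (- c)\<close> to
    \<open>E (4 * c)\<close>, since the parameter enters through its inverse square. The commutator
    of \<open>h\<close> with \<open>E (c / 3)\<close> is then
    \<open>E (4 * (c / 3) - c / 3)\<close>, which is \<open>E c\<close>.\<close>
  define h where "h = sw.weyl (1 / 2) ** weyl 1"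
  have mM: "a \<in> M \<Longrightarrow> b \<in> M \<Longrightarrow> a ** b \<in> M" for a b using M.m_closed by simp
  have hM: "h \<in> M" unfolding h_def weyl_def sw.weyl_def by (intro mM EM FM)
  have dh: "det h = 1" by (simp add: h_def det_mul det_weyl sw.det_weyl)
  have "h ** E (c / 3) ** adj3 h =
    sw.weyl (1 / 2) ** (weyl 1 ** E (c / 3) ** adj3 (weyl 1)) ** adj3 (sw.weyl (1 / 2))"
    by (simp add: h_def adj3_product det_weyl sw.det_weyl matrix_mul_assoc)
  also have "\<dots> = E (4 * (c / 3))"
    by (simp only: weyl_conj[OF one_neq_zero] sw.weyl_conj[of "1/2", simplified]) (simp add: power2_eq_square mult.commute)
  finally have "h ** E (c / 3) ** adj3 h ** adj3 (E (c / 3)) = E (4 * (c / 3)) ** transvection (- ((c / 3) *s v)) \<phi>"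
    by (simp add: transvection_adj3 dot3_linear dots)
  also have "\<dots> = transvection (4 * (c / 3) *s v + - ((c / 3) *s v)) \<phi>"
    by (rule transvection_mult) (simp add: dot3_linear dots)
  also have "4 * (c / 3) *s v + - ((c / 3) *s v) = c *s v"
    by (simp add: vec_eq_iff field_simps)
  finally have "h \<otimes>\<^bsub>SL3\<^esub> E (c / 3) \<otimes>\<^bsub>SL3\<^esub> inv\<^bsub>SL3\<^esub> h \<otimes>\<^bsub>SL3\<^esub> inv\<^bsub>SL3\<^esub> (E (c / 3)) = E c"
    by (simp add: inv_SL3 dh det_EF)
  then have "E c \<in> derived_set SL3 M" using hM EM by (simp; metis)
  then show ?thesis unfolding derived_def by (rule generate.incl)
qed

text \<open>Both root groups persist through the derived series. If the series became trivial,
  \<open>transvection (1 *s v) \<phi>\<close> would be the identity, so \<open>v\<close> or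
  \<open>\<phi>\<close> would be zero and could not pair to 1.\<close>

lemma transvection_pair_not_solvable:
  assumes tp: "transvection_pair v \<phi> u \<psi>" and M: "subgroup M SL3"
    and EM: "\<And>c. transvection (c *s v) \<phi> \<in> M" and FM: "\<And>c. transvection (c *s u) \<psi> \<in> M"
  shows "\<not> solvable (SL3\<lparr>carrier := M\<rparr>)"
proof
  have in_all: "(\<forall>c. transvection (c *s v) \<phi> \<in> (derived SL3 ^^ n) M) \<and> (\<forall>c. transvection (c *s u) \<psi> \<in> (derived SL3 ^^ n) M)" for n
  proof (induction n)
    case (Suc n)
    have s: "subgroup ((derived SL3 ^^ n) M) SL3" by (rule SL3.exp_of_derived_is_subgroup[OF M])
    show ?case
      using transvection_pair_derived[OF tp s] transvection_pair_derived[OF transvection_pair_swap[OF tp] s] Suc by simp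
  qed (use EM FM in simp)
  assume "solvable (SL3\<lparr>carrier := M\<rparr>)"
  then obtain n where "(derived SL3 ^^ n) M = {mat 1}" unfolding solvable_SL3_iff[OF M] ..
  then have "transvection (1 *s v) \<phi> = mat 1" using in_all[of n] by blast
  then have 0: "v$i * \<phi>$j = 0" for i j by (auto simp: vec_eq_iff transvection_entry mat_entry split: if_splits)
  have "dot3 \<phi> u * dot3 \<psi> v = 0"
  proof (cases "v = 0")
    case True then show ?thesis by (simp add: dot3_def)
  next
    case False
    then obtain i where "v$i \<noteq> 0" by (auto simp: vec_eq_iff)
    then have "\<phi>$j = 0" for j using 0[of i j] by simp
    then show ?thesis by (simp add: dot3_def)
  qed
  then show False using tp by (simp add: transvection_pair_def)
qed

lemma elementary_transvection: "i \<noteq> j \<Longrightarrow> elementary i j c = transvection (c *s axis i 1) (axis j 1)"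
  by (auto simp: vec_eq_iff transvection_entry elementary_entry axis_def)

text \<open>Conjugation by \<open>g\<close> turns the root group at \<open>(a, b)\<close> into
  transvections with vector \<open>g *v axis a 1\<close> and form \<open>axis b 1 v* adj3 g\<close>.
  The two inequations in \<open>ex\<close> say that these pair nontrivially with the form
  \<open>axis d 1\<close> and the vector \<open>axis c 1\<close> of the root group at
  \<open>(c, d)\<close>, so a group containing \<open>g\<close> and both root groups is not
  solvable.\<close>

lemma borel_subgroup_pattern_group:
  assumes Q: "refl Q" "trans Q"
    and ex: "\<And>g. g \<in> pattern_group Q \<Longrightarrow> g \<notin> pattern_group upper_rel \<Longrightarrow> \<exists>a b c d. a \<noteq> b \<and> c \<noteq> d \<and> (a, b) \<in> Q \<inter> upper_rel \<and>
      (c, d) \<in> Q \<inter> upper_rel \<and> g$d$a \<noteq> 0 \<and> adj3 g $b$c \<noteq> 0"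
  shows "borel_subgroup (pattern_group (Q \<inter> upper_rel)) (pattern_group Q)"
  unfolding borel_subgroup_def
proof (intro conjI allI impI)
  have r: "refl (Q \<inter> upper_rel)" "trans (Q \<inter> upper_rel)"
    using Q upper_rel_props by (auto simp: refl_on_def intro: trans_Int)
  show "pattern_group (Q \<inter> upper_rel) \<subseteq> pattern_group Q" by (rule pattern_group_mono) auto
  show "connected_group (pattern_group (Q \<inter> upper_rel))" by (rule pattern_group_connected_group[OF r])
  show "solvable (SL3\<lparr>carrier := pattern_group (Q \<inter> upper_rel)\<rparr>)"
    by (rule solvable_upper[OF pattern_group_subgroup[OF r] pattern_group_mono]) auto
  fix K assume K: "pattern_group (Q \<inter> upper_rel) \<subseteq> K \<and> K \<subseteq> pattern_group Q \<and> connected_group K \<and> solvable (SL3\<lparr>carrier := K\<rparr>)"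
  have KQ: "K \<subseteq> pattern_group Q" using K by simp
  have sK: "subgroup K SL3" using K by (simp add: connected_group_def algebraic_group_def)
  interpret K: subgroup K SL3 by (rule sK)
  have "g \<in> pattern_group upper_rel" if g: "g \<in> K" for g
  proof (rule ccontr)
    assume "g \<notin> pattern_group upper_rel"
    from ex[OF subsetD[OF KQ g] this] obtain a b c d where 1: "a \<noteq> b" "c \<noteq> d" "(a, b) \<in> Q \<inter> upper_rel" "(c, d) \<in> Q \<inter> upper_rel"
      "g$d$a \<noteq> 0" "adj3 g $b$c \<noteq> 0" by (elim exE conjE)
    \<comment> \<open>Rescaled so that both mixed pairings are 1.\<close>
    define u \<psi> where "u = (1 / g$d$a) *s (g *v axis a 1)" and "\<psi> = (1 / adj3 g $b$c) *s (axis b 1 v* adj3 g)"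
    have dg: "det g = 1" by (rule pattern_group_det) (use g KQ in blast)
    have col: "(g *v axis a 1)$i = g$i$a" for i
      using exhaust_3[of a] by (auto simp: matrix_vector_mult_def sum_3 axis_def)
    have row: "(axis b 1 v* adj3 g)$i = adj3 g$b$i" for i
      using exhaust_3[of b] by (auto simp: vector_matrix_mult_def sum_3 axis_def)
    \<comment> \<open>An off-diagonal entry of the identity matrix; it gives
      \<open>dot3 \<psi> u = 0\<close>.\<close>
    have "(adj3 g ** g)$b$a = 0" using adj3_mult(1)[of g] 1(1) by (simp add: dg mat_entry)
    then have ba: "adj3 g$b$1 * g$1$a + adj3 g$b$2 * g$2$a + adj3 g$b$3 * g$3$a = 0" by (simp add: mult_entry)
    have ax: "dot3 (axis k 1) x = x$k" "dot3 x (axis k 1) = x$k" for k x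
      using exhaust_3[of k] by (auto simp: dot3_def axis_def)
    have tp: "transvection_pair (axis c 1) (axis d 1) u \<psi>"
    proof
      show "dot3 (axis d 1) (axis c 1) = 0" unfolding ax using 1(2) by (simp add: axis_def)
      show "dot3 \<psi> u = 0"
        unfolding u_def \<psi>_def dot3_linear using ba by (simp add: dot3_def col row)
      show "dot3 (axis d 1) u = 1" unfolding ax using 1(5) by (simp add: u_def col)
      show "dot3 \<psi> (axis c 1) = 1" unfolding ax using 1(6) by (simp add: \<psi>_def row)
    qed
    have e: "elementary k l z \<in> K" if "k \<noteq> l" "(k, l) \<in> Q \<inter> upper_rel" for k l z
      using elementary_pattern_group[OF r(1) that(2,1)] K by blast
    have "\<not> solvable (SL3\<lparr>carrier := K\<rparr>)"
    proof (rule transvection_pair_not_solvable[OF tp sK])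
      show "transvection (z *s axis c 1) (axis d 1) \<in> K" for z
        using e[OF 1(2,4)] elementary_transvection[OF 1(2)] by simp
      fix z
      \<comment> \<open>This parameter undoes the two rescalings in \<open>u\<close> and
        \<open>\<psi>\<close>.\<close>
      define y where "y = z / (g$d$a * adj3 g $b$c)"
      have "g \<otimes>\<^bsub>SL3\<^esub> elementary a b y \<otimes>\<^bsub>SL3\<^esub> inv\<^bsub>SL3\<^esub> g \<in> K"
        by (intro K.m_closed K.m_inv_closed e[OF 1(1,3)] g)
      then have "g ** transvection (y *s axis a 1) (axis b 1) ** adj3 g \<in> K"
        using elementary_transvection[OF 1(1)] by (simp add: inv_SL3 dg)
      moreover have "g ** transvection (y *s axis a 1) (axis b 1) ** adj3 g = transvection (z *s u) \<psi>"
        unfolding transvection_conj[OF dg] using 1(5,6)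
        by (simp add: vec_eq_iff transvection_entry u_def \<psi>_def y_def row col vector_scalar_commute)
      ultimately show "transvection (z *s u) \<psi> \<in> K" by simp
    qed
    then show False using K by blast
  qed
  then have "K \<subseteq> pattern_group Q \<inter> pattern_group upper_rel" using KQ by blast
  also have "pattern_group Q \<inter> pattern_group upper_rel \<subseteq> pattern_group (Q \<inter> upper_rel)" by (auto simp: pattern_group_def supported_on_def)
  finally show "K = pattern_group (Q \<inter> upper_rel)" using K by (intro equalityI) simp_all
qed

subsection \<open>The flag variety and its charts\<close>

abbreviation flag :: "M3 \<Rightarrow> M3 set"
  where "flag g \<equiv> g <#\<^bsub>SL3\<^esub> upper_triangular"

lemma flag_eq_image: "flag g = {g ** b | b. b \<in> pattern_group upper_rel}"
  unfolding l_coset_def upper_triangular_pattern_group by auto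

lemma upper_rel_subgroup: "subgroup (pattern_group upper_rel) SL3"
  by (rule pattern_group_subgroup[OF upper_rel_props])

lemma upper_rel_mult: "a \<in> pattern_group upper_rel \<Longrightarrow> b \<in> pattern_group upper_rel \<Longrightarrow> a ** b \<in> pattern_group upper_rel"
  using subgroup.m_closed[OF upper_rel_subgroup] by simp

lemma upper_rel_adj3: "a \<in> pattern_group upper_rel \<Longrightarrow> adj3 a \<in> pattern_group upper_rel"
  using subgroup.m_inv_closed[OF upper_rel_subgroup, of a] by (simp add: inv_SL3 pattern_group_det)

lemma upper_rel_one: "mat 1 \<in> pattern_group upper_rel"
  using subgroup.one_closed[OF upper_rel_subgroup] by simp

lemma flag_mult: "b \<in> pattern_group upper_rel \<Longrightarrow> flag (g ** b) = flag g"
proof -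
  assume b: "b \<in> pattern_group upper_rel"
  show ?thesis
    unfolding flag_eq_image
  proof (intro equalityI subsetI)
    fix x assume "x \<in> {g ** b ** c | c. c \<in> pattern_group upper_rel}"
    then obtain c where c: "c \<in> pattern_group upper_rel" "x = g ** b ** c" by blast
    then have "x = g ** (b ** c)" by (simp add: matrix_mul_assoc)
    then show "x \<in> {g ** c | c. c \<in> pattern_group upper_rel}" using upper_rel_mult[OF b c(1)] by blast
  next
    fix x assume "x \<in> {g ** c | c. c \<in> pattern_group upper_rel}"
    then obtain c where c: "c \<in> pattern_group upper_rel" "x = g ** c" by blast
    have "g ** b ** (adj3 b ** c) = g ** (b ** adj3 b) ** c" by (simp only: matrix_mul_assoc)
    then have "x = g ** b ** (adj3 b ** c)" by (simp add: c(2) adj3_mult pattern_group_det[OF b])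
    then show "x \<in> {g ** b ** c | c. c \<in> pattern_group upper_rel}"
      using upper_rel_mult[OF upper_rel_adj3[OF b] c(1)] by blast
  qed
qed

lemma flag_eqD:
  assumes "flag g = flag h" "det g = 1"
  obtains b where "b \<in> pattern_group upper_rel" "h = g ** b"
proof -
  have "h ** mat 1 \<in> flag h" unfolding flag_eq_image using upper_rel_one by blast
  then have "h \<in> flag g" using assms(1) by simp
  then show thesis unfolding flag_eq_image using that by blast
qed

lemma flag_eq_iff:
  assumes "det g = 1" shows "flag g = flag h \<longleftrightarrow> adj3 g ** h \<in> pattern_group upper_rel"
proof
  assume "flag g = flag h"
  then obtain b where "b \<in> pattern_group upper_rel" "h = g ** b" by (rule flag_eqD[OF _ assms])
  then show "adj3 g ** h \<in> pattern_group upper_rel" by (simp add: matrix_mul_assoc adj3_mult assms)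
next
  assume "adj3 g ** h \<in> pattern_group upper_rel"
  then have "flag (g ** (adj3 g ** h)) = flag g" by (rule flag_mult)
  then show "flag g = flag h" by (simp add: matrix_mul_assoc adj3_mult assms)
qed

lemma translate_flag: "det g = 1 \<Longrightarrow> det h = 1 \<Longrightarrow> translate g (flag h) = flag (g ** h)"
  unfolding translate_def using SL3.lcos_m_assoc[of upper_triangular g h]
  by (auto simp: upper_triangular_pattern_group pattern_group_def)

abbreviation SLsp :: "M3 fspace" where "SLsp \<equiv> induced (carrier SL3) matrix_space"

lemma ringed_matrix_space: "ringed (matrix_space :: M3 fspace)"
  unfolding matrix_space_3 by (rule ringed_coordinate_space)

lemma ringed_SLsp: "ringed SLsp"
  by (rule ringed.ringed_induced[OF ringed_matrix_space])

lemma flag_variety_quotient: "flag_variety = quotient_space SLsp flag"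
  by (simp add: flag_variety_def)

lemma ringed_flag: "ringed flag_variety"
  unfolding flag_variety_quotient by (rule ringed.ringed_quotient[OF ringed_SLsp])

lemma points_SLsp: "points SLsp = {g. det g = 1}"
  by (simp add: matrix_space_3)

lemma points_flag: "points flag_variety = flag ` {g. det g = 1}"
  unfolding flag_variety_quotient quotient_space_simps topspace_quotient_topology points_SLsp ..

lemma openin_flag_iff:
  "openin (zariski flag_variety) U \<longleftrightarrow> U \<subseteq> points flag_variety \<and>
    openin (zariski SLsp) {g. det g = 1 \<and> flag g \<in> U}"
  unfolding flag_variety_quotient quotient_space_simps openin_quotient_topology
    topspace_quotient_topology points_SLsp by simp

lemma regular_flag_iff:
  "regular flag_variety U f \<longleftrightarrow> openin (zariski flag_variety) U \<and>
    regular SLsp {g. det g = 1 \<and> flag g \<in> U} (\<lambda>g. f (flag g))"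
  unfolding flag_variety_quotient quotient_space_simps points_SLsp by (simp add: o_def)

lemma regular_SLsp_polys:
  assumes "f \<in> polys mcoords" "openin (zariski SLsp) U" shows "regular SLsp U f"
proof -
  have "U \<subseteq> UNIV" by simp
  moreover have "openin (zariski (matrix_space :: M3 fspace)) UNIV"
    using openin_topspace[of "zariski (matrix_space :: M3 fspace)"] by (simp add: matrix_space_3)
  ultimately show ?thesis
    using assms regular_coordinate_polys[OF assms(1), of UNIV UNIV]
    by (intro ringed.regular_induced[OF ringed_matrix_space, of UNIV]) (simp_all add: matrix_space_3)
qed

lemma openin_SLsp_nonzero:
  assumes "f \<in> polys mcoords" shows "openin (zariski SLsp) {g. det g = 1 \<and> f g \<noteq> 0}"
  using ringed.regular_nonzero_open[OF ringed_SLsp regular_SLsp_polys[OF assms openin_topspace]]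
  unfolding points_SLsp by simp

lemma left_mult_polys:
  assumes "f \<in> polys mcoords" shows "(\<lambda>g. f (m ** g)) \<in> polys mcoords"
proof (rule polys_comp[OF assms])
  fix c :: "M3 \<Rightarrow> complex" assume "c \<in> mcoords"
  then obtain i j where c: "c = (\<lambda>A. A$i$j)" by blast
  show "(\<lambda>g. c (m ** g)) \<in> polys mcoords"
    unfolding c mult_entry by (intro polys_intros entry_polys)
qed

lemma polys_if: "f \<in> polys C \<Longrightarrow> g \<in> polys C \<Longrightarrow> (\<lambda>x. if P then f x else g x) \<in> polys C"
  by (cases P) simp_all

lemma adj3_polys: "(\<lambda>A. adj3 A $ i $ j) \<in> polys mcoords"
  using exhaust_3[of i] exhaust_3[of j]
  by (elim disjE; simp only: adj3_entries; intro polys_intros entry_polys)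

section \<open>Coordinates on the opposite big cell\<close>

definition lower_unip :: "(nat \<Rightarrow> complex) \<Rightarrow> M3"
  where "lower_unip x = vector [vector [1, 0, 0], vector [x 0, 1, 0], vector [x 2, x 1, 1]]"

lemma lower_unip_entries:
  "lower_unip x $1$1 = 1" "lower_unip x $1$2 = 0" "lower_unip x $1$3 = 0"
  "lower_unip x $2$1 = x 0" "lower_unip x $2$2 = 1" "lower_unip x $2$3 = 0"
  "lower_unip x $3$1 = x 2" "lower_unip x $3$2 = x 1" "lower_unip x $3$3 = 1"
  by (simp_all add: lower_unip_def vector_3)

lemma det_lower_unip: "det (lower_unip x) = 1"
  by (simp add: det_3 lower_unip_entries)

lemma lower_unip_polys: "(\<lambda>x. lower_unip x $ i $ j) \<in> polys coords3"
  using exhaust_3[of i] exhaust_3[of j]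
  by (elim disjE) (simp_all add: lower_unip_entries polys_intros coord3_polys)

definition minor2 :: "M3 \<Rightarrow> complex" where "minor2 g = g$1$1 * g$2$2 - g$1$2 * g$2$1"

text \<open>Inverse to \<open>lower_unip\<close> modulo \<open>B\<close>; meaningful only where both denominators are nonzero.\<close>

definition coords :: "M3 \<Rightarrow> nat \<Rightarrow> complex"
  where "coords g = (\<lambda>i. if i = 0 then g$2$1 / g$1$1
    else if i = 1 then (g$1$1 * g$3$2 - g$1$2 * g$3$1) / minor2 g
    else if i = 2 then g$3$1 / g$1$1 else undefined)"

lemma coords_A3: "coords g \<in> A3"
  by (auto simp: coords_def PiE_def extensional_def)

lemma coords_lower_unip: "x \<in> A3 \<Longrightarrow> coords (lower_unip x) = x"
  by (rule PiE_ext[of _ "{..<3}" "\<lambda>_. UNIV", OF coords_A3])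
    (auto simp: coords_def lower_unip_entries minor2_def numeral_3_eq_3 less_Suc_eq numeral_2_eq_2)

lemma upper_rel_entries:
  assumes "b \<in> pattern_group upper_rel"
  shows "b$2$1 = 0" "b$3$1 = 0" "b$3$2 = 0" "b$1$1 \<noteq> 0" "b$2$2 \<noteq> 0" "b$3$3 \<noteq> 0"
proof -
  show 0: "b$2$1 = 0" "b$3$1 = 0" "b$3$2 = 0" using assms by (auto simp: pattern_group_def supported_on_def upper_rel_def)
  have "b$1$1 * b$2$2 * b$3$3 = 1" using pattern_group_det[OF assms] by (simp add: det_3 0)
  then show "b$1$1 \<noteq> 0" "b$2$2 \<noteq> 0" "b$3$3 \<noteq> 0" by auto
qed

lemma upper_rel_right:
  assumes "b \<in> pattern_group upper_rel"
  shows "(g ** b)$i$1 = g$i$1 * b$1$1" "(g ** b)$i$2 = g$i$1 * b$1$2 + g$i$2 * b$2$2"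
    "minor2 (g ** b) = minor2 g * (b$1$1 * b$2$2)"
  using upper_rel_entries[OF assms] by (simp_all add: mult_entry minor2_def algebra_simps)

text \<open>Numerator and denominator of each fraction are scaled by the same factor,
  \<open>b$1$1\<close> or \<open>b$1$1 * b$2$2\<close>.\<close>

lemma coords_upper_rel:
  assumes "b \<in> pattern_group upper_rel" shows "coords (g ** b) = coords g"
proof -
  have "(g ** b)$1$1 * (g ** b)$3$2 - (g ** b)$1$2 * (g ** b)$3$1 =
    (g$1$1 * g$3$2 - g$1$2 * g$3$1) * (b$1$1 * b$2$2)"
    by (simp add: upper_rel_right[OF assms] algebra_simps)
  then show ?thesis
    unfolding coords_def using upper_rel_entries[OF assms]
    by (intro ext) (simp add: upper_rel_right[OF assms])
qed

text \<open>This is the LU factorization, available where the first two leading principal minors are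
  nonzero.\<close>

lemma lower_unip_coords:
  assumes "g$1$1 \<noteq> 0" "minor2 g \<noteq> 0" "det g = 1" shows "adj3 (lower_unip (coords g)) ** g \<in> pattern_group upper_rel"
proof -
  define x where "x = coords g"
  have x0: "x 0 * g$1$1 = g$2$1" and x2: "x 2 * g$1$1 = g$3$1"
    and x1: "x 1 * (g$1$1 * g$2$2 - g$1$2 * g$2$1) = g$1$1 * g$3$2 - g$1$2 * g$3$1"
    using assms by (simp_all add: x_def coords_def minor2_def)
  have "(adj3 (lower_unip x) ** g)$2$1 = 0" "(adj3 (lower_unip x) ** g)$3$1 = 0"
    using x0 x2 by (simp_all add: mult_entry adj3_entries lower_unip_entries algebra_simps)
  \<comment> \<open>Multiplying by the nonzero entry \<open>g$1$1\<close> allows \<open>x 0\<close>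
    and \<open>x 2\<close> to be eliminated.\<close>
  moreover have "g$1$1 * (adj3 (lower_unip x) ** g)$3$2 = 0"
  proof -
    have "g$1$1 * (adj3 (lower_unip x) ** g)$3$2 =
      (x 0 * g$1$1) * x 1 * g$1$2 - (x 2 * g$1$1) * g$1$2 - x 1 * g$1$1 * g$2$2 + g$1$1 * g$3$2"
      by (simp add: mult_entry adj3_entries lower_unip_entries algebra_simps)
    also have "\<dots> = - (x 1 * (g$1$1 * g$2$2 - g$1$2 * g$2$1)) + (g$1$1 * g$3$2 - g$1$2 * g$3$1)"
      unfolding x0 x2 by (simp add: algebra_simps)
    finally show ?thesis unfolding x1 by simp
  qed
  ultimately show ?thesis
    using assms(1,3) by (auto simp: pattern_group_def supported_on_def upper_rel_def forall_3 det_mul det_adj3 det_lower_unip x_def)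
qed

text \<open>The translate by \<open>n\<close> of the opposite big cell. \<open>sec\<close> lifts its
  points to the matrices \<open>n ** lower_unip x\<close> and is the local section of the quotient
  map on which separatedness and the action rely.\<close>

locale flag_chart =
  fixes n :: M3
  assumes det_n: "det n = 1"
begin

definition "param x = flag (n ** lower_unip x)"

definition "cell = {g. det g = 1 \<and> (adj3 n ** g)$1$1 * minor2 (adj3 n ** g) \<noteq> 0}"

definition "chart = flag ` cell"

definition "coord x = coords (adj3 n ** (SOME g. det g = 1 \<and> flag g = x))"

definition "sec x = n ** lower_unip (coord x)"

text \<open>The representative picked in \<open>coord\<close> does not matter because
  \<open>coords\<close> is invariant under right multiplication by \<open>B\<close>.\<close>

lemma coord_flag: "det g = 1 \<Longrightarrow> coord (flag g) = coords (adj3 n ** g)"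
proof -
  assume g: "det g = 1"
  define h where "h = (SOME h. det h = 1 \<and> flag h = flag g)"
  have "det h = 1 \<and> flag h = flag g" unfolding h_def by (rule someI[of _ g]) (simp add: g)
  then obtain b where "b \<in> pattern_group upper_rel" "h = g ** b" using flag_eqD[of g h] g by metis
  then show ?thesis
    using coords_upper_rel[of b "adj3 n ** g"] unfolding coord_def h_def[symmetric] by (simp add: matrix_mul_assoc)
qed

lemma cell_upper_rel: "g \<in> cell \<Longrightarrow> b \<in> pattern_group upper_rel \<Longrightarrow> g ** b \<in> cell"
  using upper_rel_right[of b "adj3 n ** g"] upper_rel_entries[of b]
  by (simp add: cell_def det_mul pattern_group_det matrix_mul_assoc)

lemma flag_in_chart: "det g = 1 \<Longrightarrow> flag g \<in> chart \<longleftrightarrow> g \<in> cell"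
proof
  assume g: "det g = 1" "flag g \<in> chart"
  then obtain h where h: "h \<in> cell" "flag h = flag g" unfolding chart_def by auto
  have "det h = 1" using h(1) by (simp add: cell_def)
  then obtain b where "b \<in> pattern_group upper_rel" "g = h ** b" using flag_eqD[OF h(2)] by blast
  then show "g \<in> cell" using cell_upper_rel h(1) by blast
qed (auto simp: chart_def)

lemma lower_unip_in_cell: "n ** lower_unip x \<in> cell"
  by (simp add: cell_def det_mul det_n det_lower_unip matrix_mul_assoc adj3_mult minor2_def lower_unip_entries)

lemma param_in_chart: "param x \<in> chart"
  unfolding param_def chart_def using lower_unip_in_cell by blast

lemma coord_param: "x \<in> A3 \<Longrightarrow> coord (param x) = x"
  unfolding param_def
  by (subst coord_flag) (simp_all add: det_mul det_n det_lower_unip matrix_mul_assoc adj3_mult coords_lower_unip)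

lemma param_coords: "g \<in> cell \<Longrightarrow> flag (n ** lower_unip (coords (adj3 n ** g))) = flag g"
proof -
  assume g: "g \<in> cell"
  let ?l = "lower_unip (coords (adj3 n ** g))"
  have "adj3 ?l ** (adj3 n ** g) \<in> pattern_group upper_rel"
    by (rule lower_unip_coords) (use g in \<open>auto simp: cell_def det_mul det_n det_adj3\<close>)
  then have "adj3 (n ** ?l) ** g \<in> pattern_group upper_rel"
    by (simp add: adj3_product det_n det_lower_unip matrix_mul_assoc)
  then show ?thesis by (subst flag_eq_iff) (simp_all add: det_mul det_n det_lower_unip)
qed

lemma param_coord: "x \<in> chart \<Longrightarrow> param (coord x) = x"
proof -
  assume "x \<in> chart"
  then obtain g where g: "g \<in> cell" "x = flag g" unfolding chart_def by blast
  then show ?thesis using coord_flag[of g] param_coords[of g] by (simp add: param_def cell_def)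
qed

lemma det_sec: "det (sec x) = 1"
  by (simp add: sec_def det_mul det_n det_lower_unip)

lemma flag_sec: "x \<in> chart \<Longrightarrow> flag (sec x) = x"
  using param_coord[of x] by (simp add: param_def sec_def)

lemma cell_polys: "(\<lambda>g. (adj3 n ** g)$1$1 * minor2 (adj3 n ** g)) \<in> polys mcoords"
proof -
  have "(\<lambda>g. g$1$1 * minor2 g) \<in> polys mcoords"
    unfolding minor2_def by (intro polys_intros entry_polys)
  from left_mult_polys[OF this] show ?thesis .
qed

lemma preimage_chart: "{g. det g = 1 \<and> flag g \<in> chart} = cell"
  using flag_in_chart by (auto simp: cell_def)

lemma openin_cell: "openin (zariski SLsp) cell"
  unfolding cell_def by (rule openin_SLsp_nonzero[OF cell_polys])

lemma openin_chart: "openin (zariski flag_variety) chart"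
  unfolding openin_flag_iff preimage_chart points_flag
  using openin_cell by (auto simp: chart_def cell_def)

lemma regular_coord: "i < 3 \<Longrightarrow> regular flag_variety chart (\<lambda>x. coord x i)"
proof -
  assume i: "i < 3"
  interpret SL: ringed SLsp by (rule ringed_SLsp)
  have r: "regular SLsp cell (\<lambda>g. f (adj3 n ** g))" if "f \<in> polys mcoords" for f
    by (rule regular_SLsp_polys[OF left_mult_polys[OF that] openin_cell])
  define p q where "p = (\<lambda>g::M3. if i = 0 then g$2$1 else if i = 1 then g$1$1 * g$3$2 - g$1$2 * g$3$1 else g$3$1)"
    and "q = (\<lambda>g::M3. if i = 1 then minor2 g else g$1$1)"
  have pq: "p \<in> polys mcoords" "q \<in> polys mcoords"
    unfolding p_def q_def minor2_def by (intro polys_if polys_intros entry_polys)+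
  have "regular SLsp cell (\<lambda>g. p (adj3 n ** g) / q (adj3 n ** g))"
    by (rule SL.regular_divide[OF r[OF pq(1)] r[OF pq(2)]]) (auto simp: cell_def q_def)
  then have "regular SLsp cell (\<lambda>g. coord (flag g) i)"
  proof (rule SL.regular_cong)
    fix g assume "g \<in> cell"
    then show "p (adj3 n ** g) / q (adj3 n ** g) = coord (flag g) i"
      using i by (auto simp: coord_flag cell_def coords_def p_def q_def)
  qed
  then show ?thesis unfolding regular_flag_iff preimage_chart using openin_chart by simp
qed

lemma regular_sec: "regular flag_variety chart (\<lambda>x. sec x $ i $ j)"
proof -
  interpret F: ringed flag_variety by (rule ringed_flag)
  have "(\<lambda>x. (n ** lower_unip x)$i$j) \<in> polys coords3"
    unfolding mult_entry by (intro polys_intros lower_unip_polys)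
  then have "regular flag_variety chart (\<lambda>x. (n ** lower_unip (coord x))$i$j)"
    by (rule F.regular_polys[OF _ openin_chart]) (auto intro: regular_coord)
  then show ?thesis by (simp add: sec_def)
qed

lemma regular_sec_polys:
  assumes "f \<in> polys mcoords" shows "regular flag_variety chart (\<lambda>x. f (sec x))"
  by (rule ringed.regular_polys[OF ringed_flag assms openin_chart]) (auto intro: regular_sec)

lemma morphism_coord: "morphism (induced chart flag_variety) (affine_space 3) coord"
proof -
  interpret F: ringed flag_variety by (rule ringed_flag)
  have top: "points (induced chart flag_variety) = chart"
    using openin_subset[OF openin_chart] by auto
  show ?thesis
    unfolding affine_space_3
  proof (rule ringed.morphism_coordinate_space[OF F.ringed_induced])
    show "coord x \<in> A3" for x unfolding coord_def by (rule coords_A3)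
    fix c assume "c \<in> coords3"
    then obtain i where "c = (\<lambda>x. x i)" "i < 3" by auto
    then show "regular (induced chart flag_variety) (points (induced chart flag_variety)) (\<lambda>x. c (coord x))"
      unfolding top F.regular_induced_open[OF openin_chart] using regular_coord by simp
  qed
qed

lemma morphism_param: "morphism (affine_space 3) (induced chart flag_variety) param"
proof -
  interpret A: ringed "affine_space 3" unfolding affine_space_3 by (rule ringed_coordinate_space)
  have "morphism (affine_space 3) matrix_space (\<lambda>x. n ** lower_unip x)"
    unfolding matrix_space_3
  proof (rule A.morphism_coordinate_space)
    fix c :: "M3 \<Rightarrow> complex" assume "c \<in> mcoords"
    then obtain i j where c: "c = (\<lambda>A. A$i$j)" by auto
    have "(\<lambda>x. (n ** lower_unip x)$i$j) \<in> polys coords3"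
      unfolding mult_entry by (intro polys_intros lower_unip_polys)
    then show "regular (affine_space 3) (points (affine_space 3)) (\<lambda>x. c (n ** lower_unip x))"
      using openin_topspace[of "zariski_topology A3 coords3"]
      unfolding c affine_space_3 coordinate_space_simps(1) topspace_zariski
      by (intro regular_coordinate_polys)
  qed simp
  then have "morphism (affine_space 3) SLsp (\<lambda>x. n ** lower_unip x)"
    by (rule A.morphism_corestrict[OF _ _ ringed_matrix_space]) (auto simp: det_mul det_n det_lower_unip)
  from morphism_comp[OF this morphism_quotient[of SLsp flag]]
  have "morphism (affine_space 3) flag_variety param"
    unfolding flag_variety_quotient by (simp add: o_def param_def[abs_def])
  then show ?thesis
    by (rule A.morphism_corestrict[OF _ _ ringed_flag]) (use param_in_chart in auto)
qed

end

subsection \<open>Closed subsets of the flag variety\<close>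

definition signed_perm :: "complex \<Rightarrow> 3 \<Rightarrow> 3 \<Rightarrow> 3 \<Rightarrow> M3"
  where "signed_perm s i j k = (\<chi> r c. if r = (if c = 1 then i else if c = 2 then j else k) then s else 0)"

text \<open>The sign gives the odd permutations determinant one.\<close>

definition weyl_reps :: "M3 set"
  where "weyl_reps = {signed_perm 1 1 2 3, signed_perm 1 2 3 1, signed_perm 1 3 1 2,
    signed_perm (-1) 2 1 3, signed_perm (-1) 1 3 2, signed_perm (-1) 3 2 1}"

lemma det_weyl_reps: "n \<in> weyl_reps \<Longrightarrow> det n = 1"
  by (auto simp: weyl_reps_def signed_perm_def det_3)

text \<open>The six permutations produce the products of an entry of the first column with a minor
  of the first two columns whose rows include that entry. If all of them vanish, the relation
  \<open>r\<close> makes the whole first column or all three minors vanish, and the determinant with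
  them.\<close>

lemma weyl_reps_cover:
  assumes "det g = 1"
  shows "\<exists>n\<in>weyl_reps. (adj3 n ** g)$1$1 * minor2 (adj3 n ** g) \<noteq> 0"
proof (rule ccontr)
  assume "\<not> ?thesis"
  then have 0: "(adj3 n ** g)$1$1 * minor2 (adj3 n ** g) = 0" if "n \<in> weyl_reps" for n using that by blast
  define m12 m13 m23 where "m12 = g$1$1 * g$2$2 - g$1$2 * g$2$1" and "m13 = g$1$1 * g$3$2 - g$1$2 * g$3$1"
    and "m23 = g$2$1 * g$3$2 - g$2$2 * g$3$1"
  note e = adj3_entries mult_entry signed_perm_def minor2_def
  have "g$1$1 * m12 = 0" "g$2$1 * m23 = 0" "g$3$1 * m13 = 0" "g$2$1 * m12 = 0" "g$1$1 * m13 = 0" "g$3$1 * m23 = 0"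
    using 0[of "signed_perm 1 1 2 3"] 0[of "signed_perm 1 2 3 1"] 0[of "signed_perm 1 3 1 2"]
      0[of "signed_perm (-1) 2 1 3"] 0[of "signed_perm (-1) 1 3 2"] 0[of "signed_perm (-1) 3 2 1"]
    by (simp_all add: weyl_reps_def e m12_def m13_def m23_def) (auto simp: algebra_simps)
  moreover have d: "g$1$3 * m23 - g$2$3 * m13 + g$3$3 * m12 = 1"
    using assms by (simp add: det_3 m12_def m13_def m23_def algebra_simps)
  \<comment> \<open>The expansion of the determinant in which the third column of \<open>g\<close>
    is replaced by the first.\<close>
  moreover have r: "g$1$1 * m23 - g$2$1 * m13 + g$3$1 * m12 = 0"
    by (simp add: m12_def m13_def m23_def algebra_simps)
  ultimately have "g$1$1 = 0 \<and> g$2$1 = 0 \<and> g$3$1 = 0 \<or> m12 = 0 \<and> m13 = 0 \<and> m23 = 0"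
    by auto
  then show False using d by (auto simp: m12_def m13_def m23_def)
qed

text \<open>Stability under \<open>B\<close> makes \<open>C\<close> the full preimage of its image,
  and the quotient topology is tested on preimages.\<close>

lemma closedin_flag_image:
  assumes C: "C \<subseteq> {g. det g = 1}" "closedin (zariski matrix_space) C"
    and B: "\<And>g b. g \<in> C \<Longrightarrow> b \<in> pattern_group upper_rel \<Longrightarrow> g ** b \<in> C"
  shows "closedin (zariski flag_variety) (flag ` C)"
    and "\<And>g. det g = 1 \<Longrightarrow> flag g \<in> flag ` C \<longleftrightarrow> g \<in> C"
proof -
  show *: "flag g \<in> flag ` C \<longleftrightarrow> g \<in> C" if g: "det g = 1" for g
  proof
    assume "flag g \<in> flag ` C"
    then obtain h where h: "h \<in> C" "flag h = flag g" by auto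
    have "det h = 1" using h(1) C(1) by blast
    then obtain b where "b \<in> pattern_group upper_rel" "g = h ** b" using flag_eqD[OF h(2)] by blast
    then show "g \<in> C" using B h(1) by blast
  qed auto
  have "openin (zariski SLsp) {g. det g = 1 \<and> flag g \<in> points flag_variety - flag ` C}"
  proof -
    have "{g. det g = 1 \<and> flag g \<in> points flag_variety - flag ` C} = (UNIV - C) \<inter> {g. det g = 1}"
      using * by (auto simp: points_flag)
    moreover have "openin (zariski matrix_space) (UNIV - C)"
      using C(2) by (simp add: closedin_def matrix_space_3)
    ultimately show ?thesis by (auto simp: openin_subtopology)
  qed
  then show "closedin (zariski flag_variety) (flag ` C)"
    unfolding closedin_def openin_flag_iff using C(1) by (auto simp: points_flag)
qed

lemma open_flagE:
  assumes "openin (zariski flag_variety) U"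
  obtains W where "openin (zariski matrix_space) W" "\<And>g. det g = 1 \<Longrightarrow> flag g \<in> U \<longleftrightarrow> g \<in> W"
proof -
  have "openin (zariski SLsp) {g. det g = 1 \<and> flag g \<in> U}" using assms by (simp add: openin_flag_iff)
  then obtain W where W: "openin (zariski matrix_space) W" "{g. det g = 1 \<and> flag g \<in> U} = W \<inter> {g. det g = 1}"
    by (auto simp: openin_subtopology)
  show thesis by (rule that[OF W(1)]) (use W(2) in blast)
qed

text \<open>\<open>S\<close> is the preimage of the subvariety in the group, so irreducibility and
  stability are statements about matrices. A chart may miss the subvariety altogether; this
  alternative is listed because the empty set is not a retract of \<open>A3\<close>.\<close>

locale flag_subvariety =
  fixes S :: "M3 set"
  assumes S_SL: "S \<subseteq> {g. det g = 1}" and S_ne: "S \<noteq> {}"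
    and S_closed: "closedin (zariski matrix_space) S"
    and S_irred: "irred S"
    and S_right: "\<And>g b. g \<in> S \<Longrightarrow> b \<in> pattern_group upper_rel \<Longrightarrow> g ** b \<in> S"
    and S_charts: "\<And>n. n \<in> weyl_reps \<Longrightarrow> {x \<in> A3. n ** lower_unip x \<in> S} = {} \<or> retract3 {x \<in> A3. n ** lower_unip x \<in> S}"
begin

abbreviation "X \<equiv> flag ` S"
abbreviation "Y \<equiv> induced X flag_variety"

lemma X_closed: "closedin (zariski flag_variety) X"
  by (rule closedin_flag_image(1)[OF S_SL S_closed]) (rule S_right)

lemma X_iff: "det g = 1 \<Longrightarrow> flag g \<in> X \<longleftrightarrow> g \<in> S"
  by (rule closedin_flag_image(2)[OF S_SL S_closed]) (rule S_right)

lemma X_points: "X \<subseteq> points flag_variety" using S_SL by (auto simp: points_flag)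

lemma points_Y: "points Y = X" using X_points by auto

lemma ringed_Y: "ringed Y" by (rule ringed.ringed_induced[OF ringed_flag])

lemma det_S: "g \<in> S \<Longrightarrow> det g = 1" using S_SL by blast

lemma open_YE:
  assumes "openin (zariski Y) U"
  obtains W where "openin (zariski matrix_space) W" "\<And>g. g \<in> S \<Longrightarrow> flag g \<in> U \<longleftrightarrow> g \<in> W"
proof -
  obtain U' where U': "openin (zariski flag_variety) U'" "U = U' \<inter> X" using assms by (auto simp: openin_subtopology)
  obtain W where W: "openin (zariski matrix_space) W" "\<And>g. det g = 1 \<Longrightarrow> flag g \<in> U' \<longleftrightarrow> g \<in> W"
    by (rule open_flagE[OF U'(1)]) blast
  show thesis by (rule that[OF W(1)]) (use W(2) U'(2) det_S in auto)
qed

text \<open>Irreducibility of \<open>S\<close>, carried down to the flag variety. It yields both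
  irreducibility of \<open>Y\<close> and density of open orbits.\<close>

lemma open_Y_Int:
  assumes "openin (zariski Y) U" "openin (zariski Y) V" "U \<noteq> {}" "V \<noteq> {}"
  shows "U \<inter> V \<noteq> {}"
proof -
  have UV: "U \<subseteq> X" "V \<subseteq> X" using openin_subset[OF assms(1)] openin_subset[OF assms(2)] by (simp_all add: points_Y)
  obtain W where W: "openin (zariski matrix_space) W" "\<And>g. g \<in> S \<Longrightarrow> flag g \<in> U \<longleftrightarrow> g \<in> W"
    by (rule open_YE[OF assms(1)]) blast
  obtain W' where W': "openin (zariski matrix_space) W'" "\<And>g. g \<in> S \<Longrightarrow> flag g \<in> V \<longleftrightarrow> g \<in> W'"
    by (rule open_YE[OF assms(2)]) blast
  obtain g h where gh: "g \<in> S" "flag g \<in> U" "h \<in> S" "flag h \<in> V" using assms(3,4) UV by blast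
  have "S \<inter> W \<inter> W' \<noteq> {}"
    by (rule irred_open_Int[OF S_irred W(1) gh(1) _ W'(1) gh(3)]) (use W(2) W'(2) gh in auto)
  then obtain k where "k \<in> S" "k \<in> W" "k \<in> W'" by blast
  then have "flag k \<in> U \<inter> V" using W(2) W'(2) by simp
  then show ?thesis by blast
qed

lemma irreducible_Y: "irreducible_topology (zariski Y)"
  unfolding irreducible_topology_def
proof (intro conjI allI impI)
  show "points Y \<noteq> {}" unfolding points_Y using S_ne by blast
  fix A B assume AB: "closedin (zariski Y) A \<and> closedin (zariski Y) B \<and> A \<union> B = points Y"
  show "A = points Y \<or> B = points Y"
  proof (rule ccontr)
    assume "\<not> ?thesis"
    then have "points Y - A \<noteq> {}" "points Y - B \<noteq> {}" using AB by auto
    then have "(points Y - A) \<inter> (points Y - B) \<noteq> {}"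
      using AB by (intro open_Y_Int openin_diff openin_topspace) simp_all
    then show False using AB by auto
  qed
qed

lemma chart_iso:
  assumes n: "n \<in> weyl_reps"
  defines "Z \<equiv> {x \<in> A3. n ** lower_unip x \<in> S}"
  defines "V \<equiv> flag_chart.chart n \<inter> X"
  shows "openin (zariski Y) V"
    and "morphism (induced V Y) (induced Z (affine_space 3)) (flag_chart.coord n)"
    and "morphism (induced Z (affine_space 3)) (induced V Y) (flag_chart.param n)"
    and "\<And>x. x \<in> V \<Longrightarrow> flag_chart.param n (flag_chart.coord n x) = x"
    and "\<And>y. y \<in> A3 \<Longrightarrow> flag_chart.coord n (flag_chart.param n y) = y"
    and "\<And>x. x \<in> V \<Longrightarrow> flag_chart.coord n x \<in> Z"
proof -
  interpret flag_chart n by unfold_locales (rule det_weyl_reps[OF n])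
  interpret F: ringed flag_variety by (rule ringed_flag)
  show "openin (zariski Y) V" using openin_chart by (auto simp: openin_subtopology V_def)
  have top: "points (induced chart flag_variety) = chart" using openin_subset[OF openin_chart] by auto
  \<comment> \<open>\<open>sec x\<close> represents \<open>x\<close> and equals
    \<open>n ** lower_unip (coord x)\<close>, so membership in \<open>X\<close> can be read off in
    coordinates.\<close>
  have Z: "coord x \<in> Z \<longleftrightarrow> x \<in> X" if "x \<in> chart" for x
  proof -
    have "coord x \<in> A3" unfolding coord_def by (rule coords_A3)
    moreover have "flag (sec x) \<in> X \<longleftrightarrow> sec x \<in> S" by (rule X_iff[OF det_sec])
    ultimately show ?thesis using flag_sec[OF that] by (simp add: Z_def sec_def)
  qed
  have e: "induced V Y = induced X (induced chart flag_variety)"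
  proof -
    have "X \<inter> V = chart \<inter> X" by (auto simp: V_def)
    then show ?thesis unfolding F.induced_induced by simp
  qed
  have rA: "ringed (affine_space 3)" unfolding affine_space_3 by (rule ringed_coordinate_space)
  have pA: "points (affine_space 3) = A3" by (simp add: affine_space_3)
  note i = isomorphic_spaces_induced[OF F.ringed_induced rA morphism_coord morphism_param, of X Z]
  show "morphism (induced V Y) (induced Z (affine_space 3)) coord"
    unfolding e by (rule i(1)) (use param_coord coord_param Z top pA in auto)
  show "morphism (induced Z (affine_space 3)) (induced V Y) param"
    unfolding e by (rule i(2)) (use param_coord coord_param Z top pA in auto)
  show "\<And>x. x \<in> V \<Longrightarrow> param (coord x) = x" using param_coord by (simp add: V_def)
  show "\<And>y. y \<in> A3 \<Longrightarrow> coord (param y) = y" by (rule coord_param)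
  show "\<And>x. x \<in> V \<Longrightarrow> coord x \<in> Z" using Z by (simp add: V_def)
qed

lemma chart_cover:
  assumes "x \<in> X" obtains n where "n \<in> weyl_reps" "x \<in> flag_chart.chart n" "flag_chart n"
proof -
  obtain g where g: "g \<in> S" "x = flag g" using assms by blast
  obtain n where n: "n \<in> weyl_reps" "(adj3 n ** g)$1$1 * minor2 (adj3 n ** g) \<noteq> 0"
    using weyl_reps_cover[OF det_S[OF g(1)]] by blast
  interpret flag_chart n by unfold_locales (rule det_weyl_reps[OF n(1)])
  have "g \<in> cell" using n(2) det_S[OF g(1)] by (simp add: cell_def)
  then have "x \<in> chart" unfolding chart_def g(2) by blast
  then show thesis using that[OF n(1)] flag_chart_axioms by blast
qed

text \<open>Two flags with representatives \<open>g\<close> and \<open>h\<close> coincide iff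
  \<open>adj3 g ** h\<close> is upper triangular. For distinct flags some entry below the diagonal
  is nonzero; with local sections as representatives, this entry is a tensor that vanishes on the
  diagonal.\<close>

lemma separated_Y: "closedin (zariski (product_space Y Y)) {(x, x) | x. x \<in> points Y}"
proof (rule closedin_diagonal[OF ringed_Y])
  fix x y assume xy: "x \<in> points Y" "y \<in> points Y" "x \<noteq> y"
  obtain n where n: "n \<in> weyl_reps" "x \<in> flag_chart.chart n" "flag_chart n"
    by (rule chart_cover[of x]) (use xy points_Y in auto)
  obtain m where m: "m \<in> weyl_reps" "y \<in> flag_chart.chart m" "flag_chart m"
    by (rule chart_cover[of y]) (use xy points_Y in auto)
  interpret n: flag_chart n by fact
  interpret m: flag_chart m by fact
  interpret F: ringed flag_variety by (rule ringed_flag)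
  have "flag (n.sec x) \<noteq> flag (m.sec y)" using n.flag_sec[OF n(2)] m.flag_sec[OF m(2)] xy(3) by simp
  then have "adj3 (n.sec x) ** m.sec y \<notin> pattern_group upper_rel" using flag_eq_iff[OF n.det_sec] by blast
  then obtain i j where ij: "(i, j) \<notin> upper_rel" "(adj3 (n.sec x) ** m.sec y)$i$j \<noteq> 0"
    by (auto simp: pattern_group_def supported_on_def det_mul det_adj3 n.det_sec m.det_sec)
  let ?U = "n.chart \<inter> X" and ?V = "m.chart \<inter> X"
  have U: "openin (zariski Y) ?U" "openin (zariski Y) ?V"
    using chart_iso(1)[OF n(1)] chart_iso(1)[OF m(1)] by simp_all
  let ?p = "\<lambda>z. (adj3 (n.sec (fst z)) ** m.sec (snd z))$i$j"
  have p: "?p \<in> tensors Y Y ?U ?V"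
  proof (rule tensorsI[of "UNIV :: 3 set"])
    show "?p z = (\<Sum>k\<in>UNIV. adj3 (n.sec (fst z))$i$k * m.sec (snd z)$k$j)" for z
      by (simp add: matrix_matrix_mult_def)
    show "regular Y ?U (\<lambda>z. adj3 (n.sec z)$i$k)" for k
      by (rule F.regular_induced[OF n.regular_sec_polys[OF adj3_polys]]) (use U in simp_all)
    show "regular Y ?V (\<lambda>z. m.sec z$k$j)" for k
      by (rule F.regular_induced[OF m.regular_sec]) (use U in simp_all)
  qed simp
  have "?p (z, z) = 0" if "z \<in> ?U \<inter> ?V" for z
  proof -
    have "flag (n.sec z) = flag (m.sec z)" using that n.flag_sec m.flag_sec by simp
    then have "adj3 (n.sec z) ** m.sec z \<in> pattern_group upper_rel" using flag_eq_iff[OF n.det_sec] by blast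
    then show ?thesis using ij(1) by (simp add: pattern_group_def supported_on_def)
  qed
  moreover have "x \<in> ?U" "y \<in> ?V" using xy n(2) m(2) points_Y by auto
  ultimately show "\<exists>U V p. openin (zariski Y) U \<and> openin (zariski Y) V \<and> p \<in> tensors Y Y U V \<and> x \<in> U \<and> y \<in> V \<and>
      p (x, y) \<noteq> 0 \<and> (\<forall>z \<in> U \<inter> V. p (z, z) = 0)"
    using U p ij(2) by (intro exI[of _ ?U] exI[of _ ?V] exI[of _ ?p]) simp
qed

lemma variety_Y: "variety Y"
  unfolding variety_def
proof (intro conjI irreducible_Y separated_Y)
  let ?\<U> = "(\<lambda>n. flag_chart.chart n \<inter> X) ` weyl_reps"
  show "\<exists>\<U>. finite \<U> \<and> \<Union>\<U> = points Y \<and> (\<forall>U\<in>\<U>. openin (zariski Y) U \<and> affine_variety (induced U Y))"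
  proof (intro exI[of _ ?\<U>] conjI ballI)
    show "finite ?\<U>" by (simp add: weyl_reps_def)
    show "\<Union>?\<U> = points Y"
      unfolding points_Y using chart_cover by blast
    fix U assume "U \<in> ?\<U>"
    then obtain n where n: "n \<in> weyl_reps" "U = flag_chart.chart n \<inter> X" by blast
    let ?Z = "{x \<in> A3. n ** lower_unip x \<in> S}"
    show o: "openin (zariski Y) U" using chart_iso(1)[OF n(1)] n(2) by simp
    have "closedin (zariski (affine_space 3)) ?Z"
      using S_charts[OF n(1)]
    proof
      assume "?Z = {}"
      then show ?thesis by (simp only: closedin_empty)
    qed (rule closedin_retract3)
    moreover have "isomorphic_spaces (induced U Y) (induced ?Z (affine_space 3))"
      unfolding isomorphic_spaces_def
    proof (intro exI conjI ballI)
      show "morphism (induced U Y) (induced ?Z (affine_space 3)) (flag_chart.coord n)"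
        unfolding n(2) by (rule chart_iso(2)[OF n(1)])
      show "morphism (induced ?Z (affine_space 3)) (induced U Y) (flag_chart.param n)"
        unfolding n(2) by (rule chart_iso(3)[OF n(1)])
      show "flag_chart.param n (flag_chart.coord n x) = x" if "x \<in> points (induced U Y)" for x
        by (rule chart_iso(4)[OF n(1)]) (use that n(2) in simp)
      show "flag_chart.coord n (flag_chart.param n y) = y" if "y \<in> points (induced ?Z (affine_space 3))" for y
        by (rule chart_iso(5)[OF n(1)]) (use that in \<open>simp add: affine_space_3\<close>)
    qed
    ultimately show "affine_variety (induced U Y)"
      unfolding affine_variety_def by blast
  qed
qed

lemma normal_Y: "normal_variety Y"
proof -
  have "normal_points Y"
  proof (rule ringed.normal_points_local[OF ringed_Y irreducible_Y])
    fix x assume "x \<in> points Y"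
    then have x: "x \<in> X" by (simp add: points_Y)
    obtain n where n: "n \<in> weyl_reps" "x \<in> flag_chart.chart n" by (rule chart_cover[OF x]) blast
    let ?Z = "{x \<in> A3. n ** lower_unip x \<in> S}" and ?V = "flag_chart.chart n \<inter> X"
    have xV: "x \<in> ?V" using x n(2) by blast
    then have "?Z \<noteq> {}" using chart_iso(6)[OF n(1) xV] by blast
    then have Z: "retract3 ?Z" using S_charts[OF n(1)] by blast
    have rA: "ringed (affine_space 3)" unfolding affine_space_3 by (rule ringed_coordinate_space)
    show "\<exists>W (Y' :: (nat \<Rightarrow> complex) fspace) \<phi> \<psi>. openin (zariski Y) W \<and> x \<in> W \<and> ringed Y' \<and>
      normal_points Y' \<and> morphism (induced W Y) Y' \<phi> \<and> morphism Y' (induced W Y) \<psi> \<and>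
      (\<forall>x\<in>W. \<psi> (\<phi> x) = x) \<and> (\<forall>y\<in>points Y'. \<phi> (\<psi> y) = y)"
    proof (rule exI[of _ ?V], rule exI[of _ "induced ?Z (affine_space 3)"], rule exI[of _ "flag_chart.coord n"],
        rule exI[of _ "flag_chart.param n"], intro conjI ballI)
      show "openin (zariski Y) ?V" by (rule chart_iso(1)[OF n(1)])
      show "x \<in> ?V" by (rule xV)
      show "ringed (induced ?Z (affine_space 3))" by (rule ringed.ringed_induced[OF rA])
      show "normal_points (induced ?Z (affine_space 3))" by (rule normal_retract3[OF Z])
      show "morphism (induced ?V Y) (induced ?Z (affine_space 3)) (flag_chart.coord n)"
        by (rule chart_iso(2)[OF n(1)])
      show "morphism (induced ?Z (affine_space 3)) (induced ?V Y) (flag_chart.param n)"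
        by (rule chart_iso(3)[OF n(1)])
      show "flag_chart.param n (flag_chart.coord n x) = x" if "x \<in> ?V" for x
        by (rule chart_iso(4)[OF n(1) that])
      show "flag_chart.coord n (flag_chart.param n y) = y" if "y \<in> points (induced ?Z (affine_space 3))" for y
        by (rule chart_iso(5)[OF n(1)]) (use that in \<open>simp add: affine_space_3\<close>)
    qed
  qed
  then show ?thesis
    unfolding normal_variety_def normal_points_def using variety_Y by (rule conjI[rotated])
qed

subsection \<open>The group action\<close>

lemma translate_closed:
  assumes "H \<subseteq> {g. det g = 1}" "\<And>h g. h \<in> H \<Longrightarrow> g \<in> S \<Longrightarrow> h ** g \<in> S" "h \<in> H" "x \<in> X"
  shows "translate h x \<in> X"
  using assms translate_flag[of h] det_S by force

lemma group_action_Y: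
  assumes H: "subgroup H SL3" and HS: "\<And>h g. h \<in> H \<Longrightarrow> g \<in> S \<Longrightarrow> h ** g \<in> S"
  shows "group_action (SL3\<lparr>carrier := H\<rparr>) X (\<lambda>h. restrict (translate h) X)"
proof (rule group_action.intro)
  interpret H: subgroup H SL3 by fact
  have H1: "H \<subseteq> {g. det g = 1}" using H.subset by simp
  have cl: "translate h x \<in> X" if "h \<in> H" "x \<in> X" for h x
    by (rule translate_closed[of H]) (use H1 HS that in blast)+
  have tt: "translate h (translate k x) = translate (h ** k) x" if hkx: "h \<in> H" "k \<in> H" "x \<in> X" for h k x
  proof -
    obtain g where g: "g \<in> S" "x = flag g" using hkx(3) by blast
    have "det h = 1" "det k = 1" "det g = 1" using hkx H1 g(1) det_S by auto
    then show ?thesis unfolding g(2) by (simp add: translate_flag det_mul matrix_mul_assoc)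
  qed
  have t1: "translate (mat 1) x = x" if x: "x \<in> X" for x
  proof -
    obtain g where g: "g \<in> S" "x = flag g" using x by blast
    then show ?thesis by (simp add: translate_flag det_S)
  qed
  have inv: "translate (adj3 h) (translate h x) = x" "translate h (translate (adj3 h) x) = x" "adj3 h \<in> H"
    if h: "h \<in> H" "x \<in> X" for h x
  proof -
    have d: "det h = 1" using h H1 by blast
    show a: "adj3 h \<in> H" using H.m_inv_closed[OF h(1)] d by (simp add: inv_SL3)
    show "translate (adj3 h) (translate h x) = x" "translate h (translate (adj3 h) x) = x"
      using tt[OF a h] tt[OF h(1) a h(2)] t1[OF h(2)] by (simp_all add: adj3_mult d)
  qed
  have bij: "restrict (translate h) X \<in> Bij X" if h: "h \<in> H" for h
  proof -
    have "bij_betw (translate h) X X"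
      by (rule bij_betwI[of _ _ _ "translate (adj3 h)"]) (use h cl inv in auto)
    then show ?thesis by (simp add: Bij_def bij_betw_restrict_eq)
  qed
  show "group_hom (SL3\<lparr>carrier := H\<rparr>) (BijGroup X) (\<lambda>h. restrict (translate h) X)"
  proof (intro group_hom.intro group_hom_axioms.intro homI)
    show "group (SL3\<lparr>carrier := H\<rparr>)" by (rule SL3.subgroup_imp_group[OF H])
    show "group (BijGroup X)" by (rule group_BijGroup)
    show "restrict (translate h) X \<in> carrier (BijGroup X)" if "h \<in> carrier (SL3\<lparr>carrier := H\<rparr>)" for h
      using bij that by (simp add: BijGroup_def)
    fix h k assume "h \<in> carrier (SL3\<lparr>carrier := H\<rparr>)" "k \<in> carrier (SL3\<lparr>carrier := H\<rparr>)"
    then have hk: "h \<in> H" "k \<in> H" by simp_all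
    show "restrict (translate (h \<otimes>\<^bsub>SL3\<lparr>carrier := H\<rparr>\<^esub> k)) X =
      restrict (translate h) X \<otimes>\<^bsub>BijGroup X\<^esub> restrict (translate k) X"
      using bij[OF hk(1)] bij[OF hk(2)] tt[OF hk] cl[OF hk(2)]
      by (auto simp: BijGroup_def compose_def fun_eq_iff)
  qed
qed

text \<open>Over a chart the section \<open>\<sigma>\<close> turns the action into the matrix
  product \<open>h ** \<sigma> y\<close>. Its entries are sums of products of a function of
  \<open>h\<close> and a function of \<open>y\<close>, and polynomials in them remain
  tensors.\<close>

lemma action_local:
  assumes H: "H \<subseteq> {g. det g = 1}" and h: "h0 \<in> H" "y0 \<in> X"
  obtains V \<sigma> where "openin (zariski Y) V" "y0 \<in> V" "V \<subseteq> X" "\<And>y. y \<in> V \<Longrightarrow> det (\<sigma> y) = 1 \<and> flag (\<sigma> y) = y"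
    "\<And>f. f \<in> polys mcoords \<Longrightarrow> (\<lambda>z. f (fst z ** \<sigma> (snd z))) \<in> tensors (induced H matrix_space) Y H V"
    "openin (zariski (induced H matrix_space)) H"
proof -
  obtain n where n: "n \<in> weyl_reps" "y0 \<in> flag_chart.chart n" "flag_chart n" by (rule chart_cover[OF h(2)])
  interpret flag_chart n by (rule n(3))
  interpret F: ringed flag_variety by (rule ringed_flag)
  have V: "openin (zariski Y) (chart \<inter> X)" by (rule chart_iso(1)[OF n(1)])
  have o: "openin (zariski (induced H matrix_space)) H"
    using openin_topspace[of "zariski (induced H (matrix_space :: M3 fspace))"] by (simp add: matrix_space_3)
  have "regular (induced H matrix_space) H (\<lambda>A. A$i$k)" for i k
  proof (rule ringed.regular_induced[OF ringed_matrix_space])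
    show "regular matrix_space UNIV (\<lambda>A::M3. A$i$k)"
      using openin_topspace[of "zariski_topology UNIV mcoords"] unfolding matrix_space_3 topspace_zariski
      by (intro regular_coordinate_polys entry_polys)
    show "openin (subtopology (zariski matrix_space) H) H" using o by simp
  qed simp
  moreover have "regular Y (chart \<inter> X) (\<lambda>y. sec y$k$j)" for k j
    by (rule F.regular_induced[OF regular_sec]) (use V in simp_all)
  ultimately have t: "(\<lambda>z. (fst z ** sec (snd z))$i$j) \<in> tensors (induced H matrix_space) Y H (chart \<inter> X)" for i j
    by (intro tensorsI[of "UNIV :: 3 set" _ _ "\<lambda>k A. A$i$k" _ _ "\<lambda>k y. sec y$k$j"])
      (simp_all add: matrix_matrix_mult_def)
  have "(\<lambda>z. f (fst z ** sec (snd z))) \<in> tensors (induced H matrix_space) Y H (chart \<inter> X)"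
    if f: "f \<in> polys mcoords" for f
    by (rule tensors_polys[OF ringed.ringed_induced[OF ringed_matrix_space] ringed_Y f o V])
      (use t in blast)
  then show thesis
    by (intro that[of "chart \<inter> X" sec] V o) (use n(2) h(2) det_sec flag_sec in auto)
qed

text \<open>Both continuity and regularity are checked near a point in the form
  \<open>flag (h ** \<sigma> y)\<close>, where polynomials in the matrix entries pull back to
  tensors.\<close>

lemma morphism_action:
  assumes H: "H \<subseteq> {g. det g = 1}" and HS: "\<And>h g. h \<in> H \<Longrightarrow> g \<in> S \<Longrightarrow> h ** g \<in> S"
  shows "morphism (product_space (induced H matrix_space) Y) Y (\<lambda>(h, y). translate h y)"
proof -
  let ?H = "induced H (matrix_space :: M3 fspace)"
  let ?a = "\<lambda>(h, y). translate h y"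
  interpret F: ringed flag_variety by (rule ringed_flag)
  have rH: "ringed ?H" by (rule ringed.ringed_induced[OF ringed_matrix_space])
  have top: "points (product_space ?H Y) = H \<times> X"
    unfolding product_space_simps topspace_product_zariski[OF rH ringed_Y] points_Y by (simp add: matrix_space_3)
  have op: "openin (product_zariski ?H Y) {z \<in> H \<times> X. ?a z \<in> V}" if V: "openin (zariski Y) V" for V
  proof (subst openin_subopen, intro ballI)
    fix z assume z: "z \<in> {z \<in> H \<times> X. ?a z \<in> V}"
    then obtain h0 y0 where z0: "z = (h0, y0)" "h0 \<in> H" "y0 \<in> X" "translate h0 y0 \<in> V" by auto
    obtain W where W: "openin (zariski matrix_space) W" "\<And>g. g \<in> S \<Longrightarrow> flag g \<in> V \<longleftrightarrow> g \<in> W"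
      by (rule open_YE[OF V]) blast
    obtain U \<sigma> where U: "openin (zariski Y) U" "y0 \<in> U" "U \<subseteq> X" "\<And>y. y \<in> U \<Longrightarrow> det (\<sigma> y) = 1 \<and> flag (\<sigma> y) = y"
      "\<And>f. f \<in> polys mcoords \<Longrightarrow> (\<lambda>z. f (fst z ** \<sigma> (snd z))) \<in> tensors ?H Y H U" "openin (zariski ?H) H"
      by (rule action_local[OF H z0(2,3)]) blast
    have s: "h ** \<sigma> y \<in> S" "translate h y = flag (h ** \<sigma> y)" if "h \<in> H" "y \<in> U" for h y
    proof -
      have "\<sigma> y \<in> S" using U(3,4) that X_iff[of "\<sigma> y"] by auto
      then show "h ** \<sigma> y \<in> S" using HS that by blast
      show "translate h y = flag (h ** \<sigma> y)" using translate_flag[of h "\<sigma> y"] U(4)[OF that(2)] that H by auto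
    qed
    have "h0 ** \<sigma> y0 \<in> W" using z0 s[of h0 y0] U(2) W(2) by auto
    then obtain f where f: "f \<in> polys mcoords" "f (h0 ** \<sigma> y0) \<noteq> 0" "\<forall>y\<in>UNIV. f y \<noteq> 0 \<longrightarrow> y \<in> W"
      using W(1) unfolding matrix_space_3 coordinate_space_simps openin_zariski_iff by meson
    let ?T = "{z \<in> H \<times> U. f (fst z ** \<sigma> (snd z)) \<noteq> 0}"
    have "openin (product_zariski ?H Y) ?T"
      by (rule openin_product_zariski[OF U(6,1) U(5)[OF f(1)]])
    moreover have "z \<in> ?T" using z0 U(2) f(2) by simp
    moreover have "?T \<subseteq> {z \<in> H \<times> X. ?a z \<in> V}"
      using s W(2) f(3) U(3) by auto
    ultimately show "\<exists>T. openin (product_zariski ?H Y) T \<and> z \<in> T \<and> T \<subseteq> {z \<in> H \<times> X. ?a z \<in> V}" by blast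
  qed
  have tc: "translate h x \<in> X" if "h \<in> H" "x \<in> X" for h x
    by (rule translate_closed[of H]) (use H HS that in blast)+
  have aX: "?a z \<in> X" if "z \<in> H \<times> X" for z using that tc by auto
  show ?thesis
    unfolding morphism_def
  proof (intro conjI allI impI)
    show "continuous_map (zariski (product_space ?H Y)) (zariski Y) ?a"
      unfolding continuous_map top points_Y using op aX by (auto simp: product_space_simps)
    fix V f assume V: "openin (zariski Y) V \<and> regular Y V f"
    let ?W = "{z \<in> H \<times> X. ?a z \<in> V}"
    show "regular (product_space ?H Y) {z \<in> points (product_space ?H Y). ?a z \<in> V} (f \<circ> ?a)"
      unfolding top
      unfolding product_space_simps(2)
    proof (intro conjI ballI)
      show "openin (product_zariski ?H Y) ?W" using op V by blast
      fix z assume z: "z \<in> ?W"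
      then obtain h0 y0 where z0: "z = (h0, y0)" "h0 \<in> H" "y0 \<in> X" "translate h0 y0 \<in> V" by auto
      obtain U \<sigma> where U: "openin (zariski Y) U" "y0 \<in> U" "U \<subseteq> X" "\<And>y. y \<in> U \<Longrightarrow> det (\<sigma> y) = 1 \<and> flag (\<sigma> y) = y"
        "\<And>f. f \<in> polys mcoords \<Longrightarrow> (\<lambda>z. f (fst z ** \<sigma> (snd z))) \<in> tensors ?H Y H U" "openin (zariski ?H) H"
        by (rule action_local[OF H z0(2,3)]) blast
      have s: "det (h ** \<sigma> y) = 1" "translate h y = flag (h ** \<sigma> y)" if "h \<in> H" "y \<in> U" for h y
      proof -
        have d: "det h = 1" "det (\<sigma> y) = 1" "flag (\<sigma> y) = y" using U(4)[OF that(2)] that(1) H by auto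
        show "det (h ** \<sigma> y) = 1" using d by (simp add: det_mul)
        show "translate h y = flag (h ** \<sigma> y)" using translate_flag[OF d(1,2)] d(3) by simp
      qed
      obtain U' g where U': "openin (zariski flag_variety) U'" "translate h0 y0 \<in> U'" "X \<inter> U' \<subseteq> V"
        "regular flag_variety U' g" "\<And>y. y \<in> U' \<inter> X \<Longrightarrow> f y = g y"
        using F.regular_inducedE[OF conjunct2[OF V] z0(4)] by blast
      have r: "regular SLsp {g. det g = 1 \<and> flag g \<in> U'} (\<lambda>k. g (flag k))"
        using U'(4) by (simp add: regular_flag_iff)
      have m0: "h0 ** \<sigma> y0 \<in> {g. det g = 1 \<and> flag g \<in> U'}"
        using s[OF z0(2) U(2)] U'(2) by simp
      \<comment> \<open>Lifted to matrices, the regular function is near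
        \<open>h0 ** \<sigma> y0\<close> a fraction of polynomials in the entries, and both pull
        back to tensors.\<close>
      obtain p q where pq: "p \<in> polys mcoords" "q \<in> polys mcoords" "q (h0 ** \<sigma> y0) \<noteq> 0"
        "\<And>k. k \<in> carrier SL3 \<Longrightarrow> q k \<noteq> 0 \<Longrightarrow> k \<in> {g. det g = 1 \<and> flag g \<in> U'} \<and> g (flag k) = p k / q k"
        using regular_induced_coordinateE[OF r[unfolded matrix_space_3] m0] by blast
      have eq: "(f \<circ> ?a) z = p (fst z ** \<sigma> (snd z)) / q (fst z ** \<sigma> (snd z))"
        if zz: "z \<in> ?W \<inter> H \<times> U" "q (fst z ** \<sigma> (snd z)) \<noteq> 0" for z
      proof -
        obtain h y where hy: "z = (h, y)" "h \<in> H" "y \<in> U" "y \<in> X" using zz(1) by auto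
        have k: "h ** \<sigma> y \<in> carrier SL3" "q (h ** \<sigma> y) \<noteq> 0" using s[OF hy(2,3)] zz(2) hy(1) by auto
        have "flag (h ** \<sigma> y) \<in> U'" "g (flag (h ** \<sigma> y)) = p (h ** \<sigma> y) / q (h ** \<sigma> y)"
          using pq(4)[OF k] by auto
        moreover have "translate h y \<in> X" by (rule tc[OF hy(2,4)])
        ultimately show ?thesis using U'(5)[of "translate h y"] s(2)[OF hy(2,3)] hy(1) by simp
      qed
      show "\<exists>U V p q. openin (zariski ?H) U \<and> openin (zariski Y) V \<and>
          p \<in> tensors ?H Y U V \<and> q \<in> tensors ?H Y U V \<and> z \<in> U \<times> V \<and> q z \<noteq> 0 \<and>
          (\<forall>y \<in> ?W \<inter> U \<times> V. q y \<noteq> 0 \<longrightarrow> (f \<circ> ?a) y = p y / q y)"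
        by (rule exI[of _ H], rule exI[of _ U], rule exI[of _ "\<lambda>z. p (fst z ** \<sigma> (snd z))"],
            rule exI[of _ "\<lambda>z. q (fst z ** \<sigma> (snd z))"])
          (use U(1,2,6) U(5)[OF pq(1)] U(5)[OF pq(2)] z0 pq(3) eq in auto)
    qed
  qed
qed

lemma algebraic_action_Y:
  assumes "subgroup H SL3" "\<And>h g. h \<in> H \<Longrightarrow> g \<in> S \<Longrightarrow> h ** g \<in> S"
  shows "algebraic_action H Y translate"
  unfolding algebraic_action_def points_Y
  using group_action_Y[OF assms] morphism_action[OF _ assms(2), of H] subgroup.subset[OF assms(1)] by simp

text \<open>The locus \<open>f \<noteq> 0\<close> is a single orbit by \<open>orb\<close>, open
  because its complement is the image of a closed \<open>B\<close>-stable set of matrices, and dense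
  because nonempty open sets meet.\<close>

lemma dense_orbit:
  assumes K: "K \<subseteq> {g. det g = 1}" and f: "f \<in> polys mcoords" and g0: "g0 \<in> S" "f g0 \<noteq> 0"
    and orb: "\<And>g. g \<in> S \<Longrightarrow> f g \<noteq> 0 \<Longrightarrow> \<exists>k\<in>K. \<exists>b\<in>pattern_group upper_rel. g = k ** g0 ** b"
    and fK: "\<And>k g. k \<in> K \<Longrightarrow> g \<in> S \<Longrightarrow> f g \<noteq> 0 \<Longrightarrow> k ** g \<in> S \<and> f (k ** g) \<noteq> 0"
    and fB: "\<And>b g. b \<in> pattern_group upper_rel \<Longrightarrow> g \<in> S \<Longrightarrow> f g \<noteq> 0 \<Longrightarrow> f (g ** b) \<noteq> 0"
  shows "orbit (SL3\<lparr>carrier := K\<rparr>) translate (flag g0) = flag ` {g \<in> S. f g \<noteq> 0}" (is ?orbit)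
    and "openin (zariski Y) (flag ` {g \<in> S. f g \<noteq> 0})" (is ?open)
    and "zariski Y closure_of (flag ` {g \<in> S. f g \<noteq> 0}) = X" (is ?dense)
proof -
  show ?orbit
  proof (intro equalityI subsetI)
    fix x assume "x \<in> orbit (SL3\<lparr>carrier := K\<rparr>) translate (flag g0)"
    then obtain k where k: "k \<in> K" "x = translate k (flag g0)" by (auto simp: orbit_def)
    then have "x = flag (k ** g0)" using translate_flag[of k g0] K det_S[OF g0(1)] by auto
    then show "x \<in> flag ` {g \<in> S. f g \<noteq> 0}" using fK[OF k(1) g0] by blast
  next
    fix x assume "x \<in> flag ` {g \<in> S. f g \<noteq> 0}"
    then obtain g where g: "g \<in> S" "f g \<noteq> 0" "x = flag g" by blast
    obtain k b where kb: "k \<in> K" "b \<in> pattern_group upper_rel" "g = k ** g0 ** b" using orb[OF g(1,2)] by blast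
    then have "x = translate k (flag g0)"
      using translate_flag[of k g0] K det_S[OF g0(1)] flag_mult[OF kb(2), of "k ** g0"] g(3) by auto
    then show "x \<in> orbit (SL3\<lparr>carrier := K\<rparr>) translate (flag g0)" using kb(1) by (auto simp: orbit_def)
  qed
  let ?C = "{g \<in> S. f g = 0}"
  have C: "closedin (zariski matrix_space) ?C"
  proof -
    have "?C = S \<inter> {x. \<forall>f\<in>{f}. f x = 0}" by auto
    then show ?thesis using closedin_Int[OF S_closed closedin_polys_zeros[of "{f}"]] f by (simp only: empty_subsetI insert_subset)
  qed
  \<comment> \<open>\<open>fB\<close> propagates non-vanishing; applied with the inverse of
    \<open>b\<close> it propagates vanishing.\<close>
  have CB: "g ** b \<in> ?C" if "g \<in> ?C" "b \<in> pattern_group upper_rel" for g b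
  proof -
    have "f (g ** b) = 0"
    proof (rule ccontr)
      assume n: "f (g ** b) \<noteq> 0"
      have "g ** b \<in> S" using that S_right by blast
      from fB[OF upper_rel_adj3[OF that(2)] this n] have "f (g ** (b ** adj3 b)) \<noteq> 0" by (simp add: matrix_mul_assoc)
      then show False using that by (simp add: adj3_mult pattern_group_det)
    qed
    then show ?thesis using that S_right by auto
  qed
  have CSL: "?C \<subseteq> {g. det g = 1}" using S_SL by blast
  note c = closedin_flag_image[OF CSL C CB]
  have e: "flag ` {g \<in> S. f g \<noteq> 0} = points Y - flag ` ?C"
    unfolding points_Y using c(2) det_S by auto
  have "closedin (zariski Y) (flag ` ?C)"
  proof -
    have "flag ` ?C \<subseteq> X" by auto
    then show ?thesis using c(1) by (simp add: closedin_closed_subtopology X_closed)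
  qed
  then show o: ?open unfolding e by (rule openin_diff[OF openin_topspace])
  show ?dense
  proof (intro equalityI subsetI)
    fix x assume "x \<in> zariski Y closure_of (flag ` {g \<in> S. f g \<noteq> 0})"
    then show "x \<in> X" using closure_of_subset_topspace[of "zariski Y"] points_Y by auto
  next
    fix x assume x: "x \<in> X"
    show "x \<in> zariski Y closure_of (flag ` {g \<in> S. f g \<noteq> 0})"
      unfolding in_closure_of
    proof (intro conjI allI impI)
      show "x \<in> points Y" using x points_Y by simp
      fix T assume T: "x \<in> T \<and> openin (zariski Y) T"
      have "T \<inter> flag ` {g \<in> S. f g \<noteq> 0} \<noteq> {}" by (rule open_Y_Int) (use T o g0 in auto)
      then show "\<exists>y. y \<in> flag ` {g \<in> S. f g \<noteq> 0} \<and> y \<in> T" by blast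
    qed
  qed
qed

end

section \<open>Schubert sets, their stabilizers and a criterion for sphericity\<close>

lemma trans_upper_rel_mult: "b \<in> pattern_group upper_rel \<Longrightarrow> g \<in> pattern_group R \<Longrightarrow> R O upper_rel \<subseteq> R \<Longrightarrow> g ** b \<in> pattern_group R"
  unfolding pattern_group_def using supported_on_mono[OF _ supported_on_mult, of R upper_rel R g b] by (simp add: det_mul)

lemma set_mult_SL3I: "a \<in> A \<Longrightarrow> b \<in> B \<Longrightarrow> a ** b \<in> A <#>\<^bsub>SL3\<^esub> B"
  unfolding set_mult_def by (intro UN_I[of a] UN_I[of b]) simp_all

context flag_subvariety
begin

text \<open>The closure is squeezed: the double coset stays inside \<open>S\<close> by stability
  under \<open>B\<close> on both sides, and its image contains the dense set
  \<open>D\<close>.\<close>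

lemma schubert_set_eq:
  assumes n: "n \<in> S" and w: "w = pattern_group Id #>\<^bsub>SL3\<^esub> n"
    and SB: "\<And>b g. b \<in> pattern_group upper_rel \<Longrightarrow> g \<in> S \<Longrightarrow> b ** g \<in> S"
    and D: "D \<subseteq> flag ` {b ** n ** c | b c. b \<in> pattern_group upper_rel \<and> c \<in> pattern_group upper_rel}" "zariski Y closure_of D = X"
  shows "schubert_set w = X"
proof -
  let ?BwB = "upper_triangular <#>\<^bsub>SL3\<^esub> w <#>\<^bsub>SL3\<^esub> upper_triangular"
  have tor: "pattern_group Id \<subseteq> pattern_group upper_rel" by (rule pattern_group_mono) (use upper_rel_props(1) in \<open>auto simp: refl_on_def\<close>)
  have sub: "flag ` ?BwB \<subseteq> X"
  proof (intro image_mono subsetI)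
    fix g assume "g \<in> ?BwB"
    then obtain b t c where g: "b \<in> pattern_group upper_rel" "t \<in> pattern_group Id" "c \<in> pattern_group upper_rel" "g = b ** (t ** n) ** c"
      by (auto simp: set_mult_def r_coset_def w upper_triangular_pattern_group)
    have "t ** n \<in> S" using SB[OF _ n, of t] g(2) tor by blast
    then show "g \<in> S" unfolding g(4) by (rule S_right[OF SB[OF g(1)] g(3)])
  qed
  have sup: "D \<subseteq> flag ` ?BwB"
  proof -
    have "b ** n ** c \<in> ?BwB" if "b \<in> pattern_group upper_rel" "c \<in> pattern_group upper_rel" for b c
    proof -
      have "mat 1 \<in> pattern_group Id" using supported_on_mat[of Id 1] by (auto simp: pattern_group_def refl_on_def)
      then have "mat 1 ** n \<in> w" unfolding w r_coset_def by (intro UN_I[of "mat 1"]) simp_all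
      then have "b ** n \<in> upper_triangular <#>\<^bsub>SL3\<^esub> w"
        unfolding upper_triangular_pattern_group using set_mult_SL3I[OF that(1)] by simp
      then show ?thesis
        unfolding upper_triangular_pattern_group by (rule set_mult_SL3I[OF _ that(2)])
    qed
    then show ?thesis using D(1) by blast
  qed
  show ?thesis
    unfolding schubert_set_def
  proof (intro equalityI)
    show "zariski flag_variety closure_of (flag ` ?BwB) \<subseteq> X"
      by (rule closure_of_minimal[OF sub X_closed])
    have "X \<subseteq> zariski flag_variety closure_of (X \<inter> D)"
      using D(2)[unfolded induced_simps closure_of_subtopology] by blast
    also have "\<dots> \<subseteq> zariski flag_variety closure_of (flag ` ?BwB)"
      by (rule closure_of_mono) (use sup in blast)
    finally show "X \<subseteq> zariski flag_variety closure_of (flag ` ?BwB)" .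
  qed
qed

text \<open>A flag lies in \<open>X\<close> iff its representatives lie in \<open>S\<close>, so an
  element stabilizing \<open>X\<close> maps \<open>S\<close> into itself. Conversely, the pattern
  group contains inverses, which improves inclusion to equality.\<close>

lemma stabilizer_eq:
  assumes R: "refl R" "trans R" and RS: "\<And>h g. h \<in> pattern_group R \<Longrightarrow> g \<in> S \<Longrightarrow> h ** g \<in> S"
    and stab: "\<And>g. det g = 1 \<Longrightarrow> (\<And>s. s \<in> S \<Longrightarrow> g ** s \<in> S) \<Longrightarrow> g \<in> pattern_group R"
  shows "stabilizer SL3 (\<lambda>g X. translate g ` X) X = pattern_group R"
proof (intro equalityI subsetI)
  fix g assume "g \<in> stabilizer SL3 (\<lambda>g X. translate g ` X) X"
  then have g: "det g = 1" "translate g ` X = X" by (auto simp: stabilizer_def)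
  show "g \<in> pattern_group R"
  proof (rule stab[OF g(1)])
    fix s assume s: "s \<in> S"
    then have "translate g (flag s) \<in> X" using g(2) by blast
    then show "g ** s \<in> S"
      using translate_flag[OF g(1) det_S[OF s]] X_iff[of "g ** s"] by (simp add: det_mul g(1) det_S[OF s])
  qed
next
  fix g assume g: "g \<in> pattern_group R"
  have d: "det g = 1" by (rule pattern_group_det[OF g])
  have tX: "translate h (flag s) = flag (h ** s)" "h ** s \<in> S" if "h \<in> pattern_group R" "s \<in> S" for h s
    using translate_flag[OF pattern_group_det[OF that(1)] det_S[OF that(2)]] RS[OF that] by simp_all
  have a: "adj3 g \<in> pattern_group R"
    using subgroup.m_inv_closed[OF pattern_group_subgroup[OF R] g] by (simp add: inv_SL3 d)
  have "translate g ` X = X"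
  proof (intro equalityI subsetI)
    fix x assume "x \<in> X"
    then obtain s where s: "s \<in> S" "x = flag s" by blast
    have "x = translate g (flag (adj3 g ** s))"
      using tX[OF g tX(2)[OF a s(1)]] by (simp add: s(2) matrix_mul_assoc adj3_mult d)
    then show "x \<in> translate g ` X" using tX(2)[OF a s(1)] by blast
  qed (use tX[OF g] in auto)
  then show "g \<in> stabilizer SL3 (\<lambda>g X. translate g ` X) X" by (simp add: stabilizer_def d)
qed

text \<open>The semi-invariant \<open>f\<close> cuts out the open orbit, \<open>s0\<close> is a normal form for its points, and
  \<open>b1 ** n\<close> is a point of \<open>B w B\<close> in it.\<close>

lemma spherical_case:
  assumes R: "refl R" "trans R" "upper_rel \<subseteq> R"
    and RS: "\<And>h g. h \<in> pattern_group R \<Longrightarrow> g \<in> S \<Longrightarrow> h ** g \<in> S"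
    and stab: "\<And>g. det g = 1 \<Longrightarrow> (\<And>s. s \<in> S \<Longrightarrow> g ** s \<in> S) \<Longrightarrow> g \<in> pattern_group R"
    and z: "z \<in> pattern_group Id" "\<And>i j. (i, j) \<in> R \<Longrightarrow> z$i$i = z$j$j \<longleftrightarrow> (j, i) \<in> R"
    and ex: "\<And>g. g \<in> pattern_group (R \<inter> R\<inverse>) \<Longrightarrow> g \<notin> pattern_group upper_rel \<Longrightarrow> \<exists>a b c d. a \<noteq> b \<and> c \<noteq> d \<and>
      (a, b) \<in> R \<inter> R\<inverse> \<inter> upper_rel \<and> (c, d) \<in> R \<inter> R\<inverse> \<inter> upper_rel \<and> g$d$a \<noteq> 0 \<and> adj3 g $b$c \<noteq> 0"
    and f: "f \<in> polys mcoords"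
    and st: "\<And>g. g \<in> S \<Longrightarrow> f g \<noteq> 0 \<Longrightarrow> \<exists>k\<in>pattern_group (R \<inter> R\<inverse> \<inter> upper_rel). adj3 s0 ** (adj3 k ** g) \<in> pattern_group upper_rel" "det s0 = 1"
    and fK: "\<And>k g. k \<in> pattern_group (R \<inter> R\<inverse> \<inter> upper_rel) \<Longrightarrow> g \<in> S \<Longrightarrow> f g \<noteq> 0 \<Longrightarrow> f (k ** g) \<noteq> 0"
    and fB: "\<And>b g. b \<in> pattern_group upper_rel \<Longrightarrow> g \<in> S \<Longrightarrow> f g \<noteq> 0 \<Longrightarrow> f (g ** b) \<noteq> 0"
    and n: "n \<in> S" "b1 \<in> pattern_group upper_rel" "f (b1 ** n) \<noteq> 0" and w: "w = pattern_group Id #>\<^bsub>SL3\<^esub> n"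
  shows "spherical_variety (schubert_levi w) (schubert_variety w) translate"
proof -
  let ?Q = "R \<inter> R\<inverse>"
  let ?K = "pattern_group (?Q \<inter> upper_rel)"
  define g0 where "g0 = b1 ** n"
  have Q: "refl ?Q" "trans ?Q" using sym_part[of R] R by auto
  have K: "refl (?Q \<inter> upper_rel)" "trans (?Q \<inter> upper_rel)"
    using Q upper_rel_props by (auto simp: refl_on_def intro: trans_Int)
  interpret K: subgroup ?K SL3 by (rule pattern_group_subgroup[OF K])
  have KR: "?K \<subseteq> pattern_group R" "?K \<subseteq> pattern_group upper_rel" "pattern_group upper_rel \<subseteq> pattern_group R" "pattern_group ?Q \<subseteq> pattern_group R" using R(3) by (auto intro!: pattern_group_mono)
  have K1: "?K \<subseteq> {g. det g = 1}" using pattern_group_det by blast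
  have Km: "a \<in> ?K \<Longrightarrow> b \<in> ?K \<Longrightarrow> a ** b \<in> ?K" "a \<in> ?K \<Longrightarrow> adj3 a \<in> ?K" for a b
    using K.m_closed[of a b] K.m_inv_closed[of a] by (auto simp: inv_SL3 pattern_group_det)
  have g0: "g0 \<in> S" "f g0 \<noteq> 0"
    unfolding g0_def using RS[OF subsetD[OF KR(3) n(2)] n(1)] n(3) by simp_all
  have std: "\<exists>k\<in>?K. \<exists>b\<in>pattern_group upper_rel. g = k ** s0 ** b" if g: "g \<in> S" "f g \<noteq> 0" for g
  proof -
    obtain k where k: "k \<in> ?K" "adj3 s0 ** (adj3 k ** g) \<in> pattern_group upper_rel" using st(1)[OF g] by blast
    have "k ** s0 ** (adj3 s0 ** (adj3 k ** g)) = k ** (s0 ** adj3 s0) ** adj3 k ** g"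
      by (simp only: matrix_mul_assoc)
    then have "g = k ** s0 ** (adj3 s0 ** (adj3 k ** g))"
      using pattern_group_det[OF k(1)] st(2) by (simp add: adj3_mult)
    then show ?thesis using k by blast
  qed
  \<comment> \<open>Both \<open>g\<close> and \<open>g0\<close> are reduced to \<open>s0\<close>;
    one reduction followed by the inverse of the other takes \<open>g0\<close> to
    \<open>g\<close>.\<close>
  have orb: "\<exists>k\<in>?K. \<exists>b\<in>pattern_group upper_rel. g = k ** g0 ** b" if g: "g \<in> S" "f g \<noteq> 0" for g
  proof -
    obtain k b where 1: "k \<in> ?K" "b \<in> pattern_group upper_rel" "g = k ** s0 ** b" using std[OF g] by blast
    obtain k0 b0 where 2: "k0 \<in> ?K" "b0 \<in> pattern_group upper_rel" "g0 = k0 ** s0 ** b0" using std[OF g0] by blast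
    have "k ** adj3 k0 ** g0 ** (adj3 b0 ** b) = k ** (adj3 k0 ** k0) ** s0 ** (b0 ** adj3 b0) ** b"
      unfolding 2(3) by (simp only: matrix_mul_assoc)
    then have "g = k ** adj3 k0 ** g0 ** (adj3 b0 ** b)"
      using pattern_group_det[OF 2(1)] pattern_group_det[OF 2(2)] 1(3) by (simp add: adj3_mult)
    moreover have "k ** adj3 k0 \<in> ?K" by (rule Km(1)[OF 1(1) Km(2)[OF 2(1)]])
    moreover have "adj3 b0 ** b \<in> pattern_group upper_rel" by (rule upper_rel_mult[OF upper_rel_adj3[OF 2(2)] 1(2)])
    ultimately show ?thesis by (intro bexI[of _ "k ** adj3 k0"] bexI[of _ "adj3 b0 ** b"])
  qed
  have fKS: "k ** g \<in> S \<and> f (k ** g) \<noteq> 0" if "k \<in> ?K" "g \<in> S" "f g \<noteq> 0" for k g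
    using RS[OF subsetD[OF KR(1) that(1)] that(2)] fK[OF that] by simp
  let ?D = "flag ` {g \<in> S. f g \<noteq> 0}"
  have do: "orbit (SL3\<lparr>carrier := ?K\<rparr>) translate (flag g0) = ?D"
    "openin (zariski Y) ?D" "zariski Y closure_of ?D = X"
    by (rule dense_orbit[OF K1 f g0]; fact orb fKS fB)+
  \<comment> \<open>The acting group lies in \<open>B\<close> and \<open>g0\<close> is
    \<open>b1 ** n\<close>, so its orbit lies in the double coset of \<open>n\<close>.\<close>
  have "?D \<subseteq> flag ` {b ** n ** c | b c. b \<in> pattern_group upper_rel \<and> c \<in> pattern_group upper_rel}"
  proof (intro image_mono subsetI)
    fix g assume "g \<in> {g \<in> S. f g \<noteq> 0}"
    then obtain k b where kb: "k \<in> ?K" "b \<in> pattern_group upper_rel" "g = k ** g0 ** b" using orb by blast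
    then have "g = (k ** b1) ** n ** b" by (simp add: g0_def matrix_mul_assoc)
    moreover have "k ** b1 \<in> pattern_group upper_rel" by (rule upper_rel_mult[OF subsetD[OF KR(2) kb(1)] n(2)])
    ultimately show "g \<in> {b ** n ** c | b c. b \<in> pattern_group upper_rel \<and> c \<in> pattern_group upper_rel}" using kb(2) by blast
  qed
  then have X: "schubert_set w = X"
    using RS[OF subsetD[OF KR(3)]] by (intro schubert_set_eq[OF n(1) w _ _ do(3)])
  have stb: "schubert_stabilizer w = pattern_group R"
    unfolding schubert_stabilizer_def X by (rule stabilizer_eq[OF R(1,2)]) (fact RS stab)+
  have levi: "schubert_levi w = pattern_group ?Q"
    unfolding schubert_levi_def stb by (rule levi_pattern_group[OF R(1,2) z])
  have Y: "schubert_variety w = Y" unfolding schubert_variety_def X ..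
  show ?thesis
    unfolding spherical_variety_def levi Y
  proof (intro conjI exI[of _ ?K] bexI[of _ "flag g0"])
    show "connected_reductive (pattern_group ?Q)" by (rule pattern_group_connected_reductive[OF R(1,2)])
    show "normal_variety Y" by (rule normal_Y)
    show "algebraic_action (pattern_group ?Q) Y translate"
      by (rule algebraic_action_Y[OF pattern_group_subgroup[OF Q]]) (rule RS[OF subsetD[OF KR(4)]])
    show "borel_subgroup ?K (pattern_group ?Q)" by (rule borel_subgroup_pattern_group[OF Q ex])
    show "openin (zariski Y) (orbit (SL3\<lparr>carrier := ?K\<rparr>) translate (flag g0))"
      unfolding do(1) by (rule do(2))
    show "zariski Y closure_of orbit (SL3\<lparr>carrier := ?K\<rparr>) translate (flag g0) = points Y"
      unfolding do(1) points_Y by (rule do(3))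
    show "flag g0 \<in> points Y" unfolding points_Y using g0(1) by blast
  qed
qed

end

subsection \<open>The six Schubert varieties\<close>

definition point3 :: "complex \<Rightarrow> complex \<Rightarrow> complex \<Rightarrow> nat \<Rightarrow> complex"
  where "point3 a b c = (\<lambda>i. if i = 0 then a else if i = 1 then b else if i = 2 then c else undefined)"

lemma point3_simps [simp]:
  "point3 a b c 0 = a" "point3 a b c (Suc 0) = b" "point3 a b c 2 = c"
  by (simp_all add: point3_def)

lemma point3_A3: "point3 a b c \<in> A3"
  by (auto simp: point3_def PiE_def extensional_def)

lemma A3_point3: "x \<in> A3 \<Longrightarrow> point3 (x 0) (x 1) (x 2) = x"
  by (rule PiE_ext[of _ "{..<3}" "\<lambda>_. UNIV", OF point3_A3])
    (auto simp: point3_def numeral_3_eq_3 less_Suc_eq numeral_2_eq_2)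

lemma retract3I:
  assumes "(\<lambda>x. a x) \<in> polys coords3" "(\<lambda>x. b x) \<in> polys coords3" "(\<lambda>x. c x) \<in> polys coords3"
    and "\<And>x. P (point3 (a x) (b x) (c x))"
    and "\<And>x. P x \<Longrightarrow> a x = x 0 \<and> b x = x 1 \<and> c x = x 2"
  shows "retract3 {x \<in> A3. P x}"
  unfolding retract3_def
proof
  show "retraction3 (\<lambda>x. point3 (a x) (b x) (c x)) {x \<in> A3. P x}"
    unfolding retraction3_def
  proof (intro conjI allI impI ballI)
    fix i :: nat assume "i < 3"
    then consider "i = 0" | "i = 1" | "i = 2" by linarith
    then show "(\<lambda>x. point3 (a x) (b x) (c x) i) \<in> polys coords3"
      by cases (simp_all add: assms(1-3))
  next
    show "(\<lambda>x. point3 (a x) (b x) (c x)) ` A3 \<subseteq> {x \<in> A3. P x}"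
      by (intro image_subsetI CollectI conjI point3_A3 assms(4))
    fix x assume "x \<in> {x \<in> A3. P x}"
    then show "point3 (a x) (b x) (c x) = x" using assms(5)[of x] A3_point3[of x] by simp
  qed auto
qed

text \<open>The chart equations of the six subvarieties, in the form in which simplification
  presents them; therefore some occur twice in different arrangements. The quadric is a graph over
  the first two coordinates.\<close>

lemma retracts:
  "retract3 {x \<in> A3. True}"
  "retract3 {x \<in> A3. x 0 = 0}" "retract3 {x \<in> A3. x 1 = 0}" "retract3 {x \<in> A3. x 2 = 0}"
  "retract3 {x \<in> A3. x 0 * x 1 = x 2}" "retract3 {x \<in> A3. x 2 = x 1 * x 0}"
  "retract3 {x \<in> A3. x 0 = 0 \<and> x 2 = 0}" "retract3 {x \<in> A3. x 2 = 0 \<and> x 0 = 0}" "retract3 {x \<in> A3. x 2 = 0 \<and> x 1 = 0}"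
  "retract3 {x \<in> A3. x 0 = 0 \<and> x 2 = 0 \<and> x 1 = 0}"
proof -
  note p = coord3_polys[of 0, simplified] coord3_polys[of 1, simplified] coord3_polys[of 2, simplified]
  note i = polys.const polys.mult p
  show "retract3 {x \<in> A3. True}" by (rule retract3I[where a = "\<lambda>x. x 0" and b = "\<lambda>x. x 1" and c = "\<lambda>x. x 2"]) (use i in auto)
  show "retract3 {x \<in> A3. x 0 = 0}" by (rule retract3I[where a = "\<lambda>x. 0" and b = "\<lambda>x. x 1" and c = "\<lambda>x. x 2"]) (use i in auto)
  show "retract3 {x \<in> A3. x 1 = 0}" by (rule retract3I[where a = "\<lambda>x. x 0" and b = "\<lambda>x. 0" and c = "\<lambda>x. x 2"]) (use i in auto)
  show "retract3 {x \<in> A3. x 2 = 0}" by (rule retract3I[where a = "\<lambda>x. x 0" and b = "\<lambda>x. x 1" and c = "\<lambda>x. 0"]) (use i in auto)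
  show "retract3 {x \<in> A3. x 0 * x 1 = x 2}" by (rule retract3I[where a = "\<lambda>x. x 0" and b = "\<lambda>x. x 1" and c = "\<lambda>x. x 0 * x 1"]) (use i in auto)
  show "retract3 {x \<in> A3. x 2 = x 1 * x 0}" by (rule retract3I[where a = "\<lambda>x. x 0" and b = "\<lambda>x. x 1" and c = "\<lambda>x. x 0 * x 1"]) (use i in auto)
  show "retract3 {x \<in> A3. x 0 = 0 \<and> x 2 = 0}" by (rule retract3I[where a = "\<lambda>x. 0" and b = "\<lambda>x. x 1" and c = "\<lambda>x. 0"]) (use i in auto)
  show "retract3 {x \<in> A3. x 2 = 0 \<and> x 0 = 0}" by (rule retract3I[where a = "\<lambda>x. 0" and b = "\<lambda>x. x 1" and c = "\<lambda>x. 0"]) (use i in auto)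
  show "retract3 {x \<in> A3. x 2 = 0 \<and> x 1 = 0}" by (rule retract3I[where a = "\<lambda>x. x 0" and b = "\<lambda>x. 0" and c = "\<lambda>x. 0"]) (use i in auto)
  show "retract3 {x \<in> A3. x 0 = 0 \<and> x 2 = 0 \<and> x 1 = 0}" by (rule retract3I[where a = "\<lambda>x. 0" and b = "\<lambda>x. 0" and c = "\<lambda>x. 0"]) (use i in auto)
qed

lemma signed_perm_lower_unip_entries:
  "(signed_perm s i j k ** lower_unip x) $ r $ 1 = (if r = i then s else 0) + (if r = j then s * x 0 else 0) + (if r = k then s * x 2 else 0)"
  "(signed_perm s i j k ** lower_unip x) $ r $ 2 = (if r = j then s else 0) + (if r = k then s * x 1 else 0)"
  "(signed_perm s i j k ** lower_unip x) $ r $ 3 = (if r = k then s else 0)"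
  by (simp_all add: mult_entry signed_perm_def lower_unip_entries)

section \<open>The six sets of matrices and their chart equations\<close>

definition para1_rel :: "(3 \<times> 3) set" where "para1_rel = insert (2, 1) upper_rel"
definition para2_rel :: "(3 \<times> 3) set" where "para2_rel = insert (3, 2) upper_rel"

lemma para_props: "refl para1_rel" "trans para1_rel" "refl para2_rel" "trans para2_rel" "upper_rel \<subseteq> para1_rel" "upper_rel \<subseteq> para2_rel"
proof -
  show "refl para1_rel" "refl para2_rel" using upper_rel_props(1) by (auto simp: refl_on_def para1_rel_def para2_rel_def)
  show "trans para1_rel" "trans para2_rel" by (auto simp: trans_def para1_rel_def para2_rel_def upper_rel_def)
qed (auto simp: para1_rel_def para2_rel_def)

lemma para_levi: "upper_rel \<inter> upper_rel\<inverse> = Id" "para1_rel \<inter> para1_rel\<inverse> = Id \<union> {(1,2), (2,1)}" "para2_rel \<inter> para2_rel\<inverse> = Id \<union> {(2,3), (3,2)}"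
proof -
  have Id: "(Id :: (3 \<times> 3) set) = {(1,1), (2,2), (3,3)}" using exhaust_3 by auto
  show "upper_rel \<inter> upper_rel\<inverse> = Id" "para1_rel \<inter> para1_rel\<inverse> = Id \<union> {(1,2), (2,1)}" "para2_rel \<inter> para2_rel\<inverse> = Id \<union> {(2,3), (3,2)}"
    unfolding Id by (auto simp: upper_rel_def para1_rel_def para2_rel_def)
qed

lemma pattern_group_iff:
  "A \<in> pattern_group upper_rel \<longleftrightarrow> det A = 1 \<and> A$2$1 = 0 \<and> A$3$1 = 0 \<and> A$3$2 = 0"
  "A \<in> pattern_group para1_rel \<longleftrightarrow> det A = 1 \<and> A$3$1 = 0 \<and> A$3$2 = 0"
  "A \<in> pattern_group para2_rel \<longleftrightarrow> det A = 1 \<and> A$2$1 = 0 \<and> A$3$1 = 0"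
  "A \<in> pattern_group (UNIV - {(3,1)}) \<longleftrightarrow> det A = 1 \<and> A$3$1 = 0"
  "A \<in> pattern_group UNIV \<longleftrightarrow> det A = 1"
  "A \<in> pattern_group Id \<longleftrightarrow> det A = 1 \<and> A$2$1 = 0 \<and> A$3$1 = 0 \<and> A$3$2 = 0 \<and> A$1$2 = 0 \<and> A$1$3 = 0 \<and> A$2$3 = 0"
  "A \<in> pattern_group (Id \<union> {(1,2), (2,1)}) \<longleftrightarrow> det A = 1 \<and> A$3$1 = 0 \<and> A$3$2 = 0 \<and> A$1$3 = 0 \<and> A$2$3 = 0"
  "A \<in> pattern_group (Id \<union> {(2,3), (3,2)}) \<longleftrightarrow> det A = 1 \<and> A$2$1 = 0 \<and> A$3$1 = 0 \<and> A$1$2 = 0 \<and> A$1$3 = 0"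
  "A \<in> pattern_group ((Id \<union> {(1,2), (2,1)}) \<inter> upper_rel) \<longleftrightarrow> det A = 1 \<and> A$2$1 = 0 \<and> A$3$1 = 0 \<and> A$3$2 = 0 \<and> A$1$3 = 0 \<and> A$2$3 = 0"
  "A \<in> pattern_group ((Id \<union> {(2,3), (3,2)}) \<inter> upper_rel) \<longleftrightarrow> det A = 1 \<and> A$2$1 = 0 \<and> A$3$1 = 0 \<and> A$3$2 = 0 \<and> A$1$2 = 0 \<and> A$1$3 = 0"
  by (auto simp: pattern_group_def supported_on_def upper_rel_def para1_rel_def para2_rel_def forall_3)

lemma flag_subvariety_pattern_group:
  assumes "refl P \<or> P = UNIV - {(3,1)}" "P O upper_rel \<subseteq> P"
    and "\<And>n. n \<in> weyl_reps \<Longrightarrow> {x \<in> A3. n ** lower_unip x \<in> pattern_group P} = {} \<or> retract3 {x \<in> A3. n ** lower_unip x \<in> pattern_group P}"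
  shows "flag_subvariety (pattern_group P)"
proof
  show "pattern_group P \<subseteq> {g. det g = 1}" using pattern_group_det by blast
  have "mat 1 \<in> pattern_group P" using assms(1) by (auto simp: pattern_group_def supported_on_def mat_entry refl_on_def)
  then show "pattern_group P \<noteq> {}" by blast
  show "g ** b \<in> pattern_group P" if "g \<in> pattern_group P" "b \<in> pattern_group upper_rel" for g b
    by (rule trans_upper_rel_mult[OF that(2,1) assms(2)])
qed (fact closedin_pattern_group irred_pattern_group assms(3))+

lemma weyl_repsE:
  assumes "n \<in> weyl_reps"
  obtains "n = signed_perm 1 1 2 3" | "n = signed_perm 1 2 3 1" | "n = signed_perm 1 3 1 2"
    | "n = signed_perm (-1) 2 1 3" | "n = signed_perm (-1) 1 3 2" | "n = signed_perm (-1) 3 2 1"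
  using assms unfolding weyl_reps_def by blast

lemma subvariety_point: "flag_subvariety (pattern_group upper_rel)"
proof (rule flag_subvariety_pattern_group)
  fix n assume n: "n \<in> weyl_reps"
  have d: "det (n ** lower_unip x) = 1" for x using det_weyl_reps[OF n] by (simp add: det_mul det_lower_unip)
  from n show "{x \<in> A3. n ** lower_unip x \<in> pattern_group upper_rel} = {} \<or> retract3 {x \<in> A3. n ** lower_unip x \<in> pattern_group upper_rel}"
    by (cases rule: weyl_repsE) (use d retracts in \<open>simp_all add: pattern_group_iff signed_perm_lower_unip_entries\<close>)
qed (use upper_rel_props in \<open>auto simp: trans_O_subset\<close>)

text \<open>A coset of \<open>B\<close> is the flag formed by the line of the first column and the
  plane of the first two columns. Here the plane is spanned by the first two basis vectors and the
  line in it varies.\<close>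

lemma subvariety_line1: "flag_subvariety (pattern_group para1_rel)"
proof (rule flag_subvariety_pattern_group)
  fix n assume n: "n \<in> weyl_reps"
  have d: "det (n ** lower_unip x) = 1" for x using det_weyl_reps[OF n] by (simp add: det_mul det_lower_unip)
  from n show "{x \<in> A3. n ** lower_unip x \<in> pattern_group para1_rel} = {} \<or> retract3 {x \<in> A3. n ** lower_unip x \<in> pattern_group para1_rel}"
    by (cases rule: weyl_repsE) (use d retracts in \<open>simp_all add: pattern_group_iff signed_perm_lower_unip_entries\<close>)
qed (use para_props in \<open>auto simp: para1_rel_def upper_rel_def\<close>)

text \<open>The flags whose line is spanned by the first basis vector, with varying plane.\<close>

lemma subvariety_line2: "flag_subvariety (pattern_group para2_rel)"
proof (rule flag_subvariety_pattern_group)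
  fix n assume n: "n \<in> weyl_reps"
  have d: "det (n ** lower_unip x) = 1" for x using det_weyl_reps[OF n] by (simp add: det_mul det_lower_unip)
  from n show "{x \<in> A3. n ** lower_unip x \<in> pattern_group para2_rel} = {} \<or> retract3 {x \<in> A3. n ** lower_unip x \<in> pattern_group para2_rel}"
    by (cases rule: weyl_repsE) (use d retracts in \<open>simp_all add: pattern_group_iff signed_perm_lower_unip_entries\<close>)
qed (use para_props in \<open>auto simp: para2_rel_def upper_rel_def\<close>)

text \<open>The flags whose line lies in the span of the first two basis vectors. The pattern is not
  transitive, but it absorbs \<open>upper_rel\<close> on the right, which suffices for stability
  under \<open>B\<close>.\<close>

lemma subvariety_surface1: "flag_subvariety (pattern_group (UNIV - {(3,1)}))"
proof (rule flag_subvariety_pattern_group)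
  fix n assume n: "n \<in> weyl_reps"
  have d: "det (n ** lower_unip x) = 1" for x using det_weyl_reps[OF n] by (simp add: det_mul det_lower_unip)
  from n show "{x \<in> A3. n ** lower_unip x \<in> pattern_group (UNIV - {(3,1)})} = {} \<or> retract3 {x \<in> A3. n ** lower_unip x \<in> pattern_group (UNIV - {(3,1)})}"
    by (cases rule: weyl_repsE) (use d retracts in \<open>simp_all add: pattern_group_iff signed_perm_lower_unip_entries\<close>)
qed (auto simp: upper_rel_def)

lemma subvariety_flag: "flag_subvariety (pattern_group UNIV)"
proof (rule flag_subvariety_pattern_group)
  fix n assume n: "n \<in> weyl_reps"
  have d: "det (n ** lower_unip x) = 1" for x using det_weyl_reps[OF n] by (simp add: det_mul det_lower_unip)
  show "{x \<in> A3. n ** lower_unip x \<in> pattern_group UNIV} = {} \<or> retract3 {x \<in> A3. n ** lower_unip x \<in> pattern_group UNIV}"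
    using retracts(1) d by (simp add: pattern_group_iff)
qed auto

text \<open>The flags whose plane contains the first basis vector. The equation is a minor and not
  an entry; inversion carries the set to the pattern \<open>UNIV - {(3,1)}\<close>, from which it
  inherits irreducibility.\<close>

definition surface2 :: "M3 set"
  where "surface2 = {g. det g = 1 \<and> adj3 g $3$1 = 0}"

lemma subvariety_surface2: "flag_subvariety surface2"
proof
  show "surface2 \<subseteq> {g. det g = 1}" by (auto simp: surface2_def)
  have "mat 1 \<in> surface2" by (simp add: surface2_def adj3_entries mat_entry)
  then show "surface2 \<noteq> {}" by blast
  have e: "surface2 = adj3 ` pattern_group (UNIV - {(3,1)})"
  proof (intro equalityI subsetI)
    fix g assume "g \<in> surface2"
    then have g: "det g = 1" "adj3 g $3$1 = 0" by (auto simp: surface2_def)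
    then have "adj3 g \<in> pattern_group (UNIV - {(3,1)})" "g = adj3 (adj3 g)" by (simp_all add: pattern_group_iff det_adj3 adj3_adj3)
    then show "g \<in> adj3 ` pattern_group (UNIV - {(3,1)})" by blast
  next
    fix g assume "g \<in> adj3 ` pattern_group (UNIV - {(3,1)})"
    then obtain h where "det h = 1" "h$3$1 = 0" "g = adj3 h" by (auto simp: pattern_group_iff)
    then show "g \<in> surface2" by (simp add: surface2_def det_adj3 adj3_adj3)
  qed
  show "irred surface2" unfolding e by (rule irred_image[OF irred_pattern_group adj3_polys])
  let ?F = "{\<lambda>A. det A - 1, \<lambda>A. adj3 A $3$1}"
  have F: "?F \<subseteq> polys mcoords" using polys_diff[OF det_polys polys.const] adj3_polys by blast
  have "surface2 = {x. \<forall>f\<in>?F. f x = 0}" by (auto simp: surface2_def)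
  then show "closedin (zariski matrix_space) surface2" using closedin_polys_zeros[OF F] by (simp only:)
  show "g ** b \<in> surface2" if "g \<in> surface2" "b \<in> pattern_group upper_rel" for g b
  proof -
    have "adj3 b $3$1 = 0" "adj3 b $3$2 = 0" using upper_rel_adj3[OF that(2)] by (auto simp: pattern_group_iff)
    then show ?thesis
      using that pattern_group_det[OF that(2)] by (simp add: surface2_def det_mul adj3_product mult_entry)
  qed
  fix n assume n: "n \<in> weyl_reps"
  have d: "det (n ** lower_unip x) = 1" for x using det_weyl_reps[OF n] by (simp add: det_mul det_lower_unip)
  from n show "{x \<in> A3. n ** lower_unip x \<in> surface2} = {} \<or> retract3 {x \<in> A3. n ** lower_unip x \<in> surface2}"
    by (cases rule: weyl_repsE) (use d retracts in \<open>simp_all add: surface2_def adj3_entries signed_perm_lower_unip_entries\<close>)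
qed

lemma diag_pattern_group_Id:
  assumes "a * b * c = 1"
  shows "(\<chi> i j. if i = j then if i = 1 then a else if i = 2 then b else c else 0) \<in> pattern_group Id"
  using assms by (simp add: pattern_group_iff det_3)

section \<open>Pairs of roots for the maximality of the Borel subgroups\<close>

abbreviation "levi1 \<equiv> Id \<union> {(1, 2), (2, 1)} :: (3 \<times> 3) set"
abbreviation "levi2 \<equiv> Id \<union> {(2, 3), (3, 2)} :: (3 \<times> 3) set"

lemma inversion_levi1:
  assumes g: "g \<in> pattern_group levi1" "g \<notin> pattern_group upper_rel"
  shows "\<exists>a b c d. a \<noteq> b \<and> c \<noteq> d \<and> (a, b) \<in> levi1 \<inter> upper_rel \<and> (c, d) \<in> levi1 \<inter> upper_rel \<and>
    g$d$a \<noteq> 0 \<and> adj3 g $b$c \<noteq> 0"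
proof (intro exI conjI)
  show "(1::3) \<noteq> 2" "(1::3) \<noteq> 2" "(1::3, 2::3) \<in> levi1 \<inter> upper_rel" "(1::3, 2::3) \<in> levi1 \<inter> upper_rel"
    by (simp_all add: upper_rel_def)
  show "g$2$1 \<noteq> 0" using g unfolding pattern_group_iff by auto
  moreover have "g$3$3 \<noteq> 0" using g(1) unfolding pattern_group_iff by (auto simp: det_3)
  ultimately show "adj3 g $2$1 \<noteq> 0" using g(1) unfolding pattern_group_iff by (auto simp: adj3_entries)
qed

lemma inversion_levi2:
  assumes g: "g \<in> pattern_group levi2" "g \<notin> pattern_group upper_rel"
  shows "\<exists>a b c d. a \<noteq> b \<and> c \<noteq> d \<and> (a, b) \<in> levi2 \<inter> upper_rel \<and> (c, d) \<in> levi2 \<inter> upper_rel \<and>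
    g$d$a \<noteq> 0 \<and> adj3 g $b$c \<noteq> 0"
proof (intro exI conjI)
  show "(2::3) \<noteq> 3" "(2::3) \<noteq> 3" "(2::3, 3::3) \<in> levi2 \<inter> upper_rel" "(2::3, 3::3) \<in> levi2 \<inter> upper_rel"
    by (simp_all add: upper_rel_def)
  show "g$3$2 \<noteq> 0" using g unfolding pattern_group_iff by auto
  moreover have "g$1$1 \<noteq> 0" using g(1) unfolding pattern_group_iff by (auto simp: det_3)
  ultimately show "adj3 g $3$2 \<noteq> 0" using g(1) unfolding pattern_group_iff by (auto simp: adj3_entries)
qed

text \<open>\<open>g$d$a\<close> is the lowest nonzero entry below the diagonal in the first column,
  or \<open>g$3$2\<close> if there is none. In the first case invertibility of \<open>adj3 g\<close>
  supplies \<open>b\<close> and \<open>c\<close>.\<close>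

lemma inversion_UNIV:
  assumes g: "det g = 1" "g \<notin> pattern_group upper_rel"
  shows "\<exists>a b c d. a \<noteq> b \<and> c \<noteq> d \<and> (a, b) \<in> upper_rel \<and> (c, d) \<in> upper_rel \<and> g$d$a \<noteq> 0 \<and> adj3 g $b$c \<noteq> 0"
proof -
  have u: "(1::3, 2::3) \<in> upper_rel" "(1::3, 3::3) \<in> upper_rel" "(2::3, 3::3) \<in> upper_rel" by (simp_all add: upper_rel_def)
  have I: ?thesis if "(a, b) \<in> upper_rel" "(c, d) \<in> upper_rel" "a \<noteq> b" "c \<noteq> d" "g$d$a \<noteq> 0" "adj3 g $b$c \<noteq> 0" for a b c d
    using that by blast
  have da: "det (adj3 g) = 1" by (rule det_adj3[OF g(1)])
  have ag: "adj3 g ** g = mat 1" using adj3_mult(1)[of g] g(1) by simp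
  show ?thesis
  proof (cases "g$3$1 = 0")
    case False
    \<comment> \<open>A block of zeros in the rows 2, 3 and the columns 1, 2 would make the
      determinant of \<open>adj3 g\<close> vanish.\<close>
    have "adj3 g$2$1 \<noteq> 0 \<or> adj3 g$2$2 \<noteq> 0 \<or> adj3 g$3$1 \<noteq> 0 \<or> adj3 g$3$2 \<noteq> 0"
      using da by (auto simp: det_3)
    then show ?thesis
      using I[OF u(1) u(2), of ] I[OF u(1) u(3)] I[OF u(2) u(2)] I[OF u(2) u(3)] False by auto
  next
    case 31: True
    show ?thesis
    proof (cases "g$2$1 = 0")
      case False
      \<comment> \<open>If \<open>adj3 g$2$1\<close> and \<open>adj3 g$3$1\<close> were both 0,
        these entries of \<open>adj3 g ** g = mat 1\<close> would force the whole block in the rows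
        2, 3 and the columns 1, 2 to vanish.\<close>
      have "adj3 g$2$1 * g$1$1 + adj3 g$2$2 * g$2$1 = 0" "adj3 g$3$1 * g$1$1 + adj3 g$3$2 * g$2$1 = 0"
        using ag 31 by (auto simp: M3_eq_iff mult_entry mat_entry)
      then have "adj3 g$2$1 \<noteq> 0 \<or> adj3 g$3$1 \<noteq> 0" using False da by (auto simp: det_3)
      then show ?thesis using I[OF u(1) u(1)] I[OF u(2) u(1)] False by auto
    next
      case True
      then have 32: "g$3$2 \<noteq> 0" using g 31 by (simp add: pattern_group_iff)
      have "g$1$1 \<noteq> 0" using g(1) 31 True by (auto simp: det_3)
      then have "adj3 g$3$2 \<noteq> 0" using 31 32 True by (simp add: adj3_entries)
      then show ?thesis using I[OF u(3) u(3)] 32 by simp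
    qed
  qed
qed

lemma pattern_group_stable:
  assumes "refl P" "trans P" "upper_rel \<subseteq> P"
  shows "h \<in> pattern_group P \<Longrightarrow> g \<in> pattern_group P \<Longrightarrow> h ** g \<in> pattern_group P"
    and "det g = 1 \<Longrightarrow> (\<And>s. s \<in> pattern_group P \<Longrightarrow> g ** s \<in> pattern_group P) \<Longrightarrow> g \<in> pattern_group P"
proof -
  show "h \<in> pattern_group P \<Longrightarrow> g \<in> pattern_group P \<Longrightarrow> h ** g \<in> pattern_group P"
    using subgroup.m_closed[OF pattern_group_subgroup[OF assms(1,2)]] by simp
  assume h: "\<And>s. s \<in> pattern_group P \<Longrightarrow> g ** s \<in> pattern_group P"
  have "mat 1 \<in> pattern_group P" using subgroup.one_closed[OF pattern_group_subgroup[OF assms(1,2)]] by simp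
  from h[OF this] show "g \<in> pattern_group P" by simp
qed

section \<open>The open orbit in each of the six cases\<close>

lemma spherical_point:
  assumes n: "n \<in> pattern_group upper_rel" and w: "w = pattern_group Id #>\<^bsub>SL3\<^esub> n"
  shows "spherical_variety (schubert_levi w) (schubert_variety w) translate"
proof -
  interpret flag_subvariety "pattern_group upper_rel" by (rule subvariety_point)
  have u: "upper_rel \<subseteq> upper_rel" by simp
  \<comment> \<open>Pairwise different diagonal entries with product 1: the Levi subgroup is the
    torus itself.\<close>
  let ?z = "(\<chi> i j. if i = j then if i = 1 then 4 else if i = 2 then 1 else 1/4 else 0) :: M3"
  show ?thesis
  proof (rule spherical_case[where R = upper_rel and f = "\<lambda>_. 1" and z = ?z and ?s0.0 = "mat 1" and ?b1.0 = "mat 1", OF upper_rel_props u])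
    show "?z \<in> pattern_group Id" by (rule diag_pattern_group_Id) simp
    show "(?z$i$i = ?z$j$j) = ((j, i) \<in> upper_rel)" if "(i, j) \<in> upper_rel" for i j
      using that by (auto simp: upper_rel_def)
    show "\<exists>k\<in>pattern_group (upper_rel \<inter> upper_rel\<inverse> \<inter> upper_rel). adj3 (mat 1) ** (adj3 k ** g) \<in> pattern_group upper_rel" if "g \<in> pattern_group upper_rel" for g
    proof (rule bexI[of _ "mat 1"])
      show "mat 1 \<in> pattern_group (upper_rel \<inter> upper_rel\<inverse> \<inter> upper_rel)"
        using supported_on_mat[of "upper_rel \<inter> upper_rel\<inverse> \<inter> upper_rel"] upper_rel_props(1) by (auto simp: pattern_group_def refl_on_def)
      have "adj3 (mat 1) = mat 1" by (simp add: M3_eq_iff adj3_entries mat_entry)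
      then show "adj3 (mat 1) ** (adj3 (mat 1) ** g) \<in> pattern_group upper_rel" using that by simp
    qed
    show "g \<in> pattern_group (upper_rel \<inter> upper_rel\<inverse>) \<Longrightarrow> g \<notin> pattern_group upper_rel \<Longrightarrow> \<exists>a b c d. a \<noteq> b \<and> c \<noteq> d \<and>
      (a, b) \<in> upper_rel \<inter> upper_rel\<inverse> \<inter> upper_rel \<and> (c, d) \<in> upper_rel \<inter> upper_rel\<inverse> \<inter> upper_rel \<and> g$d$a \<noteq> 0 \<and> adj3 g $b$c \<noteq> 0" for g
      using pattern_group_mono[of "upper_rel \<inter> upper_rel\<inverse>" upper_rel] by blast
    show "h ** g \<in> pattern_group upper_rel" if "h \<in> pattern_group upper_rel" "g \<in> pattern_group upper_rel" for h g
      by (rule pattern_group_stable(1)[OF upper_rel_props u that])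
    show "g \<in> pattern_group upper_rel" if "det g = 1" "\<And>s. s \<in> pattern_group upper_rel \<Longrightarrow> g ** s \<in> pattern_group upper_rel" for g
      by (rule pattern_group_stable(2)[OF upper_rel_props u that])
    show "(\<lambda>_. 1) \<in> polys mcoords" by (rule polys.const)
  qed (use n w upper_rel_one in simp_all)
qed

text \<open>The open orbit is an affine line in a projective line; \<open>g$2$1 \<noteq> 0\<close>
  says that the line of the flag is not the one fixed by \<open>B\<close>.\<close>

lemma spherical_line1:
  assumes n: "n \<in> pattern_group para1_rel" "n$2$1 \<noteq> 0" and w: "w = pattern_group Id #>\<^bsub>SL3\<^esub> n"
  shows "spherical_variety (schubert_levi w) (schubert_variety w) translate"
proof -
  interpret flag_subvariety "pattern_group para1_rel" by (rule subvariety_line1)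
  \<comment> \<open>Scalar on the block of the indices 1 and 2, different at 3, with product
    1.\<close>
  let ?z = "(\<chi> i j. if i = j then if i = 1 then 2 else if i = 2 then 2 else 1/4 else 0) :: M3"
  show ?thesis
  proof (rule spherical_case[where R = para1_rel and f = "\<lambda>g. g$2$1" and z = ?z and ?s0.0 = "signed_perm (-1) 2 1 3" and ?b1.0 = "mat 1",
        OF para_props(1,2,5), unfolded para_levi])
    show "?z \<in> pattern_group Id" by (rule diag_pattern_group_Id) simp
    show "(?z$i$i = ?z$j$j) = ((j, i) \<in> para1_rel)" if "(i, j) \<in> para1_rel" for i j
      using that by (auto simp: upper_rel_def para1_rel_def)
    show "\<exists>k\<in>pattern_group ((Id \<union> {(1, 2), (2, 1)}) \<inter> upper_rel). adj3 (signed_perm (-1) 2 1 3) ** (adj3 k ** g) \<in> pattern_group upper_rel"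
      if g: "g \<in> pattern_group para1_rel" "g$2$1 \<noteq> 0" for g
    \<comment> \<open>Subtracting this multiple of the second row from the first clears the entry
      \<open>(1, 1)\<close>; the permutation then makes the matrix upper triangular.\<close>
    proof (rule bexI[of _ "elementary 1 2 (g$1$1 / g$2$1)"])
      have d: "det (signed_perm (-1) 2 1 3) = 1" by (simp add: det_weyl_reps weyl_reps_def)
      show "elementary 1 2 (g$1$1 / g$2$1) \<in> pattern_group ((Id \<union> {(1, 2), (2, 1)}) \<inter> upper_rel)"
        unfolding pattern_group_iff by (simp add: elementary_det elementary_entry)
      have "det g = 1" "g$3$1 = 0" "g$3$2 = 0" using g by (simp_all add: pattern_group_iff)
      then show "adj3 (signed_perm (-1) 2 1 3) ** (adj3 (elementary 1 2 (g$1$1 / g$2$1)) ** g) \<in> pattern_group upper_rel"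
        using g(2) by (simp add: pattern_group_iff det_mul det_adj3 d elementary_det elementary_adj3)
          (simp add: mult_entry adj3_entries elementary_entry signed_perm_def)
    qed
    show "(k ** g)$2$1 \<noteq> 0" if "k \<in> pattern_group ((Id \<union> {(1, 2), (2, 1)}) \<inter> upper_rel)" "g \<in> pattern_group para1_rel" "g$2$1 \<noteq> 0" for k g
    proof -
      have "k \<in> pattern_group upper_rel" using that(1) unfolding pattern_group_iff by simp
      from upper_rel_entries[OF this] show ?thesis using that unfolding pattern_group_iff by (simp add: mult_entry)
    qed
    show "(g ** b)$2$1 \<noteq> 0" if "b \<in> pattern_group upper_rel" "g \<in> pattern_group para1_rel" "g$2$1 \<noteq> 0" for b g
      using that upper_rel_entries[OF that(1)] by (simp add: upper_rel_right)
    show "det (signed_perm (-1) 2 1 3) = 1" by (simp add: det_weyl_reps weyl_reps_def)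
    show "h ** g \<in> pattern_group para1_rel" if "h \<in> pattern_group para1_rel" "g \<in> pattern_group para1_rel" for h g
      by (rule pattern_group_stable(1)[OF para_props(1,2,5) that])
    show "g \<in> pattern_group para1_rel" if "det g = 1" "\<And>s. s \<in> pattern_group para1_rel \<Longrightarrow> g ** s \<in> pattern_group para1_rel" for g
      by (rule pattern_group_stable(2)[OF para_props(1,2,5) that])
    show "\<exists>a b c d. a \<noteq> b \<and> c \<noteq> d \<and> (a, b) \<in> levi1 \<inter> upper_rel \<and> (c, d) \<in> levi1 \<inter> upper_rel \<and>
      g$d$a \<noteq> 0 \<and> adj3 g $b$c \<noteq> 0" if "g \<in> pattern_group levi1" "g \<notin> pattern_group upper_rel" for g
      by (rule inversion_levi1[OF that])
    show "(\<lambda>g::M3. g$2$1) \<in> polys mcoords" by (rule entry_polys)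
  qed (use n w upper_rel_one in simp_all)
qed

text \<open>Here \<open>g$3$2 \<noteq> 0\<close> says that the plane of the flag is not the one
  fixed by \<open>B\<close>.\<close>

lemma spherical_line2:
  assumes n: "n \<in> pattern_group para2_rel" "n$3$2 \<noteq> 0" and w: "w = pattern_group Id #>\<^bsub>SL3\<^esub> n"
  shows "spherical_variety (schubert_levi w) (schubert_variety w) translate"
proof -
  interpret flag_subvariety "pattern_group para2_rel" by (rule subvariety_line2)
  let ?z = "(\<chi> i j. if i = j then if i = 1 then 4 else if i = 2 then 1/2 else 1/2 else 0) :: M3"
  show ?thesis
  proof (rule spherical_case[where R = para2_rel and f = "\<lambda>g. g$3$2" and z = ?z and ?s0.0 = "signed_perm (-1) 1 3 2" and ?b1.0 = "mat 1",
        OF para_props(3,4,6), unfolded para_levi])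
    show "?z \<in> pattern_group Id" by (rule diag_pattern_group_Id) simp
    show "(?z$i$i = ?z$j$j) = ((j, i) \<in> para2_rel)" if "(i, j) \<in> para2_rel" for i j
      using that by (auto simp: upper_rel_def para2_rel_def)
    show "\<exists>k\<in>pattern_group ((Id \<union> {(2, 3), (3, 2)}) \<inter> upper_rel). adj3 (signed_perm (-1) 1 3 2) ** (adj3 k ** g) \<in> pattern_group upper_rel"
      if g: "g \<in> pattern_group para2_rel" "g$3$2 \<noteq> 0" for g
    proof (rule bexI[of _ "elementary 2 3 (g$2$2 / g$3$2)"])
      have d: "det (signed_perm (-1) 1 3 2) = 1" by (simp add: det_weyl_reps weyl_reps_def)
      show "elementary 2 3 (g$2$2 / g$3$2) \<in> pattern_group ((Id \<union> {(2, 3), (3, 2)}) \<inter> upper_rel)"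
        unfolding pattern_group_iff by (simp add: elementary_det elementary_entry)
      have "det g = 1" "g$2$1 = 0" "g$3$1 = 0" using g by (simp_all add: pattern_group_iff)
      then show "adj3 (signed_perm (-1) 1 3 2) ** (adj3 (elementary 2 3 (g$2$2 / g$3$2)) ** g) \<in> pattern_group upper_rel"
        using g(2) by (simp add: pattern_group_iff det_mul det_adj3 d elementary_det elementary_adj3)
          (simp add: mult_entry adj3_entries elementary_entry signed_perm_def)
    qed
    show "(k ** g)$3$2 \<noteq> 0" if "k \<in> pattern_group ((Id \<union> {(2, 3), (3, 2)}) \<inter> upper_rel)" "g \<in> pattern_group para2_rel" "g$3$2 \<noteq> 0" for k g
    proof -
      have "k \<in> pattern_group upper_rel" using that(1) unfolding pattern_group_iff by simp
      from upper_rel_entries[OF this] show ?thesis using that unfolding pattern_group_iff by (simp add: mult_entry)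
    qed
    show "(g ** b)$3$2 \<noteq> 0" if "b \<in> pattern_group upper_rel" "g \<in> pattern_group para2_rel" "g$3$2 \<noteq> 0" for b g
      using that upper_rel_entries[of b] by (simp add: upper_rel_right pattern_group_iff(3))
    show "det (signed_perm (-1) 1 3 2) = 1" by (simp add: det_weyl_reps weyl_reps_def)
    show "h ** g \<in> pattern_group para2_rel" if "h \<in> pattern_group para2_rel" "g \<in> pattern_group para2_rel" for h g
      by (rule pattern_group_stable(1)[OF para_props(3,4,6) that])
    show "g \<in> pattern_group para2_rel" if "det g = 1" "\<And>s. s \<in> pattern_group para2_rel \<Longrightarrow> g ** s \<in> pattern_group para2_rel" for g
      by (rule pattern_group_stable(2)[OF para_props(3,4,6) that])
    show "\<exists>a b c d. a \<noteq> b \<and> c \<noteq> d \<and> (a, b) \<in> levi2 \<inter> upper_rel \<and> (c, d) \<in> levi2 \<inter> upper_rel \<and>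
      g$d$a \<noteq> 0 \<and> adj3 g $b$c \<noteq> 0" if "g \<in> pattern_group levi2" "g \<notin> pattern_group upper_rel" for g
      by (rule inversion_levi2[OF that])
    show "(\<lambda>g::M3. g$3$2) \<in> polys mcoords" by (rule entry_polys)
  qed (use n w upper_rel_one in simp_all)
qed

text \<open>The Borel subgroup of the Levi subgroup fixes the first and the third basis line and the
  plane of the first two basis vectors. On this surface the factors of \<open>?f\<close> say that
  the line of the flag is not that first line, that its plane is not that plane, and that its plane
  does not contain the third basis vector.\<close>

lemma spherical_surface1:
  assumes n: "det n = 1" "n$1$1 = 0" "n$3$1 = 0" "n$2$1 \<noteq> 0" "n$3$2 \<noteq> 0"
    and n0: "n$1$2 = 0" "n$2$2 = 0" and w: "w = pattern_group Id #>\<^bsub>SL3\<^esub> n"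
  shows "spherical_variety (schubert_levi w) (schubert_variety w) translate"
proof -
  interpret flag_subvariety "pattern_group (UNIV - {(3,1)})" by (rule subvariety_surface1)
  let ?z = "(\<chi> i j. if i = j then if i = 1 then 2 else if i = 2 then 2 else 1/4 else 0) :: M3"
  let ?f = "\<lambda>g::M3. g$2$1 * g$3$2 * minor2 g"
  \<comment> \<open>The line is spanned by the second basis vector, and the plane also contains the
    difference of the first and the third; all three conditions hold.\<close>
  define s0 :: M3 where "s0 = vector [vector [0, 1, 0], vector [1, 0, 0], vector [0, -1, -1]]"
  have s0: "s0$1$1 = 0" "s0$1$2 = 1" "s0$1$3 = 0" "s0$2$1 = 1" "s0$2$2 = 0" "s0$2$3 = 0"
    "s0$3$1 = 0" "s0$3$2 = -1" "s0$3$3 = -1" by (simp_all add: s0_def vector_3)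
  have d0: "det s0 = 1" by (simp add: det_3 s0)
  show ?thesis
  proof (rule spherical_case[where R = para1_rel and f = ?f and z = ?z and ?s0.0 = s0 and ?b1.0 = "elementary 1 3 1",
        OF para_props(1,2,5), unfolded para_levi])
    show "?z \<in> pattern_group Id" by (rule diag_pattern_group_Id) simp
    show "(?z$i$i = ?z$j$j) = ((j, i) \<in> para1_rel)" if "(i, j) \<in> para1_rel" for i j
      using that by (auto simp: upper_rel_def para1_rel_def)
    show "\<exists>k\<in>pattern_group (levi1 \<inter> upper_rel). adj3 s0 ** (adj3 k ** g) \<in> pattern_group upper_rel"
      if g: "g \<in> pattern_group (UNIV - {(3,1)})" "?f g \<noteq> 0" for g
    proof -
      \<comment> \<open>\<open>k ** s0\<close> must define the same flag as \<open>g\<close>. The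
        ratio \<open>x / q\<close> is forced by the line, \<open>r\<close> by the plane having to
        contain the second column of \<open>k ** s0\<close>, and \<open>q\<close> by the determinant
        of \<open>k\<close>.\<close>
      define r q x where "r = g$2$1 * g$3$2 / minor2 g" and "q = minor2 g / (g$2$1 * g$3$2)" and "x = q * g$1$1 / g$2$1"
      define k :: M3 where "k = vector [vector [1, x, 0], vector [0, q, 0], vector [0, 0, r]]"
      have k: "k$1$1 = 1" "k$1$2 = x" "k$1$3 = 0" "k$2$1 = 0" "k$2$2 = q" "k$2$3 = 0"
        "k$3$1 = 0" "k$3$2 = 0" "k$3$3 = r" by (simp_all add: k_def vector_3)
      have g': "det g = 1" "g$3$1 = 0" "g$2$1 \<noteq> 0" "g$3$2 \<noteq> 0" "minor2 g \<noteq> 0" using g by (simp_all add: pattern_group_iff)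
      have e: "q * r = 1" "x * g$2$1 = q * g$1$1" "r * minor2 g = g$2$1 * g$3$2"
        using g' by (simp_all add: r_def q_def x_def)
      have dk: "det k = 1" using e(1) by (simp add: det_3 k)
      have "g$1$1 - (x * g$2$1) * r = 0" unfolding e(2) using e(1) by (simp add: algebra_simps)
      then have 1: "g$1$1 = x * r * g$2$1" by (simp add: algebra_simps)
      have "g$2$1 * (g$1$2 - x * r * g$2$2 + q * g$3$2) =
        g$1$2 * g$2$1 - (x * g$2$1) * r * g$2$2 + q * (g$2$1 * g$3$2)" by (simp add: algebra_simps)
      also have "\<dots> = g$1$2 * g$2$1 - (q * r) * g$1$1 * g$2$2 + (q * r) * minor2 g"
        unfolding e(2) e(3)[symmetric] by (simp add: algebra_simps)
      also have "\<dots> = 0" unfolding e(1) by (simp add: minor2_def)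
      finally have 2: "g$1$2 - x * r * g$2$2 + q * g$3$2 = 0" using g'(3) by simp
      have "k \<in> pattern_group (levi1 \<inter> upper_rel)" unfolding pattern_group_iff using dk k by simp
      moreover have "adj3 s0 ** (adj3 k ** g) \<in> pattern_group upper_rel"
        unfolding pattern_group_iff
        using 1 2 g' by (simp add: det_mul det_adj3 d0 dk)
          (simp add: mult_entry adj3_entries s0 k e(1) algebra_simps)
      ultimately show ?thesis by blast
    qed
    show "h ** g \<in> pattern_group (UNIV - {(3,1)})" if "h \<in> pattern_group para1_rel" "g \<in> pattern_group (UNIV - {(3,1)})" for h g
      using that unfolding pattern_group_iff by (simp add: det_mul mult_entry)
    \<comment> \<open>Two test matrices suffice: the identity shows that \<open>g$3$1\<close>
      vanishes, the permutation exchanging the first two columns that \<open>g$3$2\<close>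
      does.\<close>
    show "g \<in> pattern_group para1_rel" if g: "det g = 1" "\<And>s. s \<in> pattern_group (UNIV - {(3,1)}) \<Longrightarrow> g ** s \<in> pattern_group (UNIV - {(3,1)})" for g
    proof -
      have "mat 1 \<in> pattern_group (UNIV - {(3,1)})" "signed_perm (-1) 2 1 3 \<in> pattern_group (UNIV - {(3,1)})"
        unfolding pattern_group_iff by (simp_all add: mat_entry det_weyl_reps weyl_reps_def) (simp add: signed_perm_def)
      from g(2)[OF this(1)] g(2)[OF this(2)] show ?thesis
        unfolding pattern_group_iff by (simp add: mult_entry signed_perm_def)
    qed
    show "?f (k ** g) \<noteq> 0" if "k \<in> pattern_group (levi1 \<inter> upper_rel)" "g \<in> pattern_group (UNIV - {(3,1)})" "?f g \<noteq> 0" for k g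
    proof -
      have "k \<in> pattern_group upper_rel" using that(1) unfolding pattern_group_iff by simp
      note k = upper_rel_entries(4-6)[OF this]
      have "?f (k ** g) = k$2$2 * k$3$3 * (k$1$1 * k$2$2) * ?f g"
        using that(1,2) unfolding pattern_group_iff by (simp add: minor2_def mult_entry algebra_simps)
      then show ?thesis using k that(3) by simp
    qed
    show "?f (g ** b) \<noteq> 0" if "b \<in> pattern_group upper_rel" "g \<in> pattern_group (UNIV - {(3,1)})" "?f g \<noteq> 0" for b g
      using that upper_rel_entries[OF that(1)] by (simp add: upper_rel_right[OF that(1)] pattern_group_iff(4))
    show "?f \<in> polys mcoords" unfolding minor2_def by (intro polys_intros entry_polys)
    show "elementary 1 3 1 \<in> pattern_group upper_rel" by (rule elementary_pattern_group[OF upper_rel_props(1)]) (simp_all add: upper_rel_def)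
    \<comment> \<open>\<open>minor2 n\<close> is 0, so \<open>n\<close> is not in the open orbit;
      adding its third row to the first repairs this and keeps it in the double coset.\<close>
    show "?f (elementary 1 3 1 ** n) \<noteq> 0" using n n0 by (simp add: minor2_def mult_entry elementary_entry)
    show "\<exists>a b c d. a \<noteq> b \<and> c \<noteq> d \<and> (a, b) \<in> levi1 \<inter> upper_rel \<and> (c, d) \<in> levi1 \<inter> upper_rel \<and>
      g$d$a \<noteq> 0 \<and> adj3 g $b$c \<noteq> 0" if "g \<in> pattern_group levi1" "g \<notin> pattern_group upper_rel" for g
      by (rule inversion_levi1[OF that])
  qed (use n w d0 in \<open>simp_all add: pattern_group_iff(4)\<close>)
qed

text \<open>The factors of \<open>?f\<close> say that the line of the flag lies neither in the span
  of the last two nor in that of the first two basis vectors, both of which are fixed by the Borel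
  subgroup of the Levi subgroup. Such a line determines the plane, which contains the first basis
  vector as well.\<close>

lemma spherical_surface2:
  assumes n: "det n = 1" "n$1$1 = 0" "n$2$1 = 0" "n$2$2 = 0" "n$3$1 \<noteq> 0" and w: "w = pattern_group Id #>\<^bsub>SL3\<^esub> n"
  shows "spherical_variety (schubert_levi w) (schubert_variety w) translate"
proof -
  interpret flag_subvariety surface2 by (rule subvariety_surface2)
  let ?z = "(\<chi> i j. if i = j then if i = 1 then 4 else if i = 2 then 1/2 else 1/2 else 0) :: M3"
  let ?f = "\<lambda>g::M3. g$1$1 * g$3$1"
  define s0 :: M3 where "s0 = vector [vector [1, 0, 0], vector [0, 0, -1], vector [1, 1, 0]]"
  have s0: "s0$1$1 = 1" "s0$1$2 = 0" "s0$1$3 = 0" "s0$2$1 = 0" "s0$2$2 = 0" "s0$2$3 = -1"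
    "s0$3$1 = 1" "s0$3$2 = 1" "s0$3$3 = 0" by (simp_all add: s0_def vector_3)
  have d0: "det s0 = 1" by (simp add: det_3 s0)
  show ?thesis
  proof (rule spherical_case[where R = para2_rel and f = ?f and z = ?z and ?s0.0 = s0 and ?b1.0 = "elementary 1 3 1",
        OF para_props(3,4,6), unfolded para_levi])
    show "?z \<in> pattern_group Id" by (rule diag_pattern_group_Id) simp
    show "(?z$i$i = ?z$j$j) = ((j, i) \<in> para2_rel)" if "(i, j) \<in> para2_rel" for i j
      using that by (auto simp: upper_rel_def para2_rel_def)
    show "\<exists>k\<in>pattern_group (levi2 \<inter> upper_rel). adj3 s0 ** (adj3 k ** g) \<in> pattern_group upper_rel"
      if g: "g \<in> surface2" "?f g \<noteq> 0" for g
    proof -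
      \<comment> \<open>The first column of \<open>k ** s0\<close> is (1, x, r) and must be
        proportional to that of \<open>g\<close>; \<open>q\<close> is then given by the determinant
        of \<open>k\<close>.\<close>
      define r q x where "r = g$3$1 / g$1$1" and "q = g$1$1 / g$3$1" and "x = g$2$1 / g$1$1"
      define k :: M3 where "k = vector [vector [1, 0, 0], vector [0, q, x], vector [0, 0, r]]"
      have k: "k$1$1 = 1" "k$1$2 = 0" "k$1$3 = 0" "k$2$1 = 0" "k$2$2 = q" "k$2$3 = x"
        "k$3$1 = 0" "k$3$2 = 0" "k$3$3 = r" by (simp_all add: k_def vector_3)
      have g': "det g = 1" "g$2$1 * g$3$2 = g$2$2 * g$3$1" "g$1$1 \<noteq> 0" "g$3$1 \<noteq> 0"
        using g by (simp_all add: surface2_def adj3_entries)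
      have e: "q * r = 1" "q * g$3$1 = g$1$1" "r * g$1$1 = g$3$1" "x * g$1$1 = g$2$1"
        using g' by (simp_all add: r_def q_def x_def)
      have dk: "det k = 1" using e(1) by (simp add: det_3 k)
      have 1: "r * g$2$1 - x * g$3$1 = 0" "r * g$2$2 - x * g$3$2 = 0"
        using g' by (simp_all add: r_def x_def field_simps)
      have "k \<in> pattern_group (levi2 \<inter> upper_rel)" unfolding pattern_group_iff using dk k by simp
      moreover have "adj3 s0 ** (adj3 k ** g) \<in> pattern_group upper_rel"
        unfolding pattern_group_iff
        using 1 g' e by (simp add: det_mul det_adj3 d0 dk)
          (simp add: mult_entry adj3_entries s0 k algebra_simps)
      ultimately show ?thesis by blast
    qed
    show "h ** g \<in> surface2" if h: "h \<in> pattern_group para2_rel" "g \<in> surface2" for h g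
    proof -
      have "adj3 h \<in> pattern_group para2_rel"
        using subgroup.m_inv_closed[OF pattern_group_subgroup[OF para_props(3,4)] h(1)] pattern_group_det[OF h(1)] by (simp add: inv_SL3)
      then have "adj3 h$2$1 = 0" "adj3 h$3$1 = 0" unfolding pattern_group_iff by simp_all
      then show ?thesis
        using h(2) pattern_group_det[OF h(1)] by (simp add: surface2_def det_mul adj3_product mult_entry)
    qed
    \<comment> \<open>Tested on the identity and on one permutation matrix. The equation of
      \<open>surface2\<close> is linear in the inverse, so both tests give vanishing entries of
      \<open>adj3 g\<close>.\<close>
    show "g \<in> pattern_group para2_rel" if g: "det g = 1" "\<And>s. s \<in> surface2 \<Longrightarrow> g ** s \<in> surface2" for g
    proof -
      have d: "det (signed_perm (-1) 1 3 2) = 1" by (simp add: det_weyl_reps weyl_reps_def)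
      have "mat 1 \<in> surface2" "signed_perm (-1) 1 3 2 \<in> surface2"
        by (simp_all add: surface2_def mat_entry adj3_entries d) (simp add: signed_perm_def)
      from g(2)[OF this(1)] g(2)[OF this(2)]
      have "adj3 g $3$1 = 0" "(adj3 (signed_perm (-1) 1 3 2) ** adj3 g)$3$1 = 0"
        using g(1) d by (simp_all add: surface2_def flip: adj3_product)
      then have "adj3 g$2$1 = 0" "adj3 g$3$1 = 0" by (simp_all add: mult_entry adj3_entries signed_perm_def)
      then have "adj3 g \<in> pattern_group para2_rel" unfolding pattern_group_iff by (simp add: det_adj3 g(1))
      from subgroup.m_inv_closed[OF pattern_group_subgroup[OF para_props(3,4)] this] show ?thesis
        by (simp add: inv_SL3 det_adj3 adj3_adj3 g(1))
    qed
    show "?f (k ** g) \<noteq> 0" if "k \<in> pattern_group (levi2 \<inter> upper_rel)" "g \<in> surface2" "?f g \<noteq> 0" for k g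
    proof -
      have "k \<in> pattern_group upper_rel" using that(1) unfolding pattern_group_iff by simp
      note k = upper_rel_entries(4-6)[OF this]
      have "?f (k ** g) = k$1$1 * k$3$3 * ?f g"
        using that(1) unfolding pattern_group_iff by (simp add: mult_entry algebra_simps)
      then show ?thesis using k that(3) by simp
    qed
    show "?f (g ** b) \<noteq> 0" if "b \<in> pattern_group upper_rel" "g \<in> surface2" "?f g \<noteq> 0" for b g
      using that upper_rel_entries[OF that(1)] by (simp add: upper_rel_right[OF that(1)])
    show "?f \<in> polys mcoords" by (intro polys_intros entry_polys)
    show "elementary 1 3 1 \<in> pattern_group upper_rel" by (rule elementary_pattern_group[OF upper_rel_props(1)]) (simp_all add: upper_rel_def)
    \<comment> \<open>\<open>n$1$1\<close> is 0, so \<open>n\<close> is not in the open orbit;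
      adding the third row to the first makes this entry nonzero.\<close>
    show "?f (elementary 1 3 1 ** n) \<noteq> 0" using n by (simp add: mult_entry elementary_entry)
    show "\<exists>a b c d. a \<noteq> b \<and> c \<noteq> d \<and> (a, b) \<in> levi2 \<inter> upper_rel \<and> (c, d) \<in> levi2 \<inter> upper_rel \<and>
      g$d$a \<noteq> 0 \<and> adj3 g $b$c \<noteq> 0" if "g \<in> pattern_group levi2" "g \<notin> pattern_group upper_rel" for g
      by (rule inversion_levi2[OF that])
  qed (use n w d0 in \<open>simp_all add: surface2_def adj3_entries\<close>)
qed

text \<open>The Levi subgroup is the whole group and the open orbit is the big cell, given by the
  minors of orders one and two in the lower left corner, \<open>g$3$1\<close> and
  \<open>adj3 g$3$1\<close>.\<close>

lemma spherical_flag: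
  assumes n: "det n = 1" "n$2$1 = 0" "n$2$2 \<noteq> 0" "n$3$1 \<noteq> 0" and w: "w = pattern_group Id #>\<^bsub>SL3\<^esub> n"
  shows "spherical_variety (schubert_levi w) (schubert_variety w) translate"
proof -
  interpret flag_subvariety "pattern_group UNIV" by (rule subvariety_flag)
  let ?f = "\<lambda>g::M3. g$3$1 * adj3 g$3$1"
  have rt: "refl (UNIV :: (3 \<times> 3) set)" "trans (UNIV :: (3 \<times> 3) set)" "upper_rel \<subseteq> UNIV" by (auto simp: refl_on_def trans_def)
  have un: "(UNIV :: (3 \<times> 3) set)\<inverse> = UNIV" by auto
  have ds: "det (signed_perm (-1) 3 2 1) = 1" by (simp add: det_weyl_reps weyl_reps_def)
  show ?thesis
  proof (rule spherical_case[where R = UNIV and f = ?f and z = "mat 1" and ?s0.0 = "signed_perm (-1) 3 2 1" and ?b1.0 = "mat 1",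
        OF rt, unfolded un Int_UNIV_left])
    show "mat 1 \<in> pattern_group Id" unfolding pattern_group_iff by (simp add: mat_entry)
    show "\<exists>k\<in>pattern_group upper_rel. adj3 (signed_perm (-1) 3 2 1) ** (adj3 k ** g) \<in> pattern_group upper_rel"
      if g: "g \<in> pattern_group UNIV" "?f g \<noteq> 0" for g
    proof -
      \<comment> \<open>The third column of \<open>k\<close> must span the line of \<open>g\<close>,
        which gives \<open>a\<close> and \<open>c\<close>; its second column must lie in the plane
        of \<open>g\<close>, which gives \<open>y\<close>.\<close>
      define a c y where "a = g$1$1 / g$3$1" and "c = g$2$1 / g$3$1" and "y = - adj3 g$3$2 / adj3 g$3$1"
      define k :: M3 where "k = vector [vector [1, y, a], vector [0, 1, c], vector [0, 0, 1]]"
      have k: "k$1$1 = 1" "k$1$2 = y" "k$1$3 = a" "k$2$1 = 0" "k$2$2 = 1" "k$2$3 = c"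
        "k$3$1 = 0" "k$3$2 = 0" "k$3$3 = 1" by (simp_all add: k_def vector_3)
      have dk: "det k = 1" by (simp add: det_3 k)
      have g': "det g = 1" "g$3$1 \<noteq> 0" "adj3 g$3$1 \<noteq> 0" using g by (simp_all add: pattern_group_iff)
      have e: "g$1$1 = a * g$3$1" "g$2$1 = c * g$3$1" "y * adj3 g$3$1 + adj3 g$3$2 = 0"
        using g' by (simp_all add: a_def c_def y_def)
      have "g$3$1 * (g$1$2 - y * g$2$2 + (y * c - a) * g$3$2) = y * adj3 g$3$1 + adj3 g$3$2"
        unfolding adj3_entries e(1,2) by (simp add: algebra_simps)
      then have "g$3$1 * (g$1$2 - y * g$2$2 + (y * c - a) * g$3$2) = 0" unfolding e(3) .
      then have 1: "g$1$2 - y * g$2$2 + (y * c - a) * g$3$2 = 0" using g'(2) by simp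
      have "k \<in> pattern_group upper_rel" unfolding pattern_group_iff using dk k by simp
      moreover have "adj3 (signed_perm (-1) 3 2 1) ** (adj3 k ** g) \<in> pattern_group upper_rel"
        unfolding pattern_group_iff
        using 1 g' e(1,2) by (simp add: det_mul det_adj3 ds dk)
          (simp add: mult_entry adj3_entries signed_perm_def k algebra_simps)
      ultimately show ?thesis by blast
    qed
    show "?f (k ** g) \<noteq> 0" if "k \<in> pattern_group upper_rel" "?f g \<noteq> 0" for k g
    proof -
      note k = upper_rel_entries[OF that(1)]
      have "?f (k ** g) = k$3$3 * (k$2$2 * k$3$3) * ?f g"
        using k by (simp add: mult_entry adj3_entries algebra_simps)
      then show ?thesis using k that(2) by simp
    qed
    show "?f (g ** b) \<noteq> 0" if "b \<in> pattern_group upper_rel" "?f g \<noteq> 0" for b g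
    proof -
      note b = upper_rel_entries[OF that(1)]
      have "?f (g ** b) = b$1$1 * (b$1$1 * b$2$2) * ?f g"
        using b by (simp add: mult_entry adj3_entries algebra_simps)
      then show ?thesis using b that(2) by simp
    qed
    show "?f \<in> polys mcoords" by (intro polys_intros entry_polys adj3_polys)
    show "?f (mat 1 ** n) \<noteq> 0" using n by (simp add: adj3_entries)
    show "h ** g \<in> pattern_group UNIV" if "h \<in> pattern_group UNIV" "g \<in> pattern_group UNIV" for h g
      using that unfolding pattern_group_iff by (simp add: det_mul)
    show "\<exists>a b c d. a \<noteq> b \<and> c \<noteq> d \<and> (a, b) \<in> upper_rel \<and> (c, d) \<in> upper_rel \<and> g$d$a \<noteq> 0 \<and> adj3 g $b$c \<noteq> 0"
      if "g \<in> pattern_group UNIV" "g \<notin> pattern_group upper_rel" for g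
      using inversion_UNIV that unfolding pattern_group_iff(5) by blast
  qed (use n w ds upper_rel_one in \<open>simp_all add: pattern_group_iff(5) mat_entry\<close>)
qed

subsection \<open>The Weyl group\<close>

lemma normalizer_torus_monomial:
  assumes "n \<in> normalizer SL3 diagonal_torus"
  shows "det n = 1" "\<And>i j k. j \<noteq> k \<Longrightarrow> n$i$j * n$i$k = 0"
proof -
  have T: "diagonal_torus \<subseteq> carrier SL3" by (auto simp: diagonal_torus_def)
  show d: "det n = 1" using assms by (simp add: normalizer_def stabilizer_def)
  have eq: "n <#\<^bsub>SL3\<^esub> diagonal_torus #>\<^bsub>SL3\<^esub> (inv\<^bsub>SL3\<^esub> n) = diagonal_torus"
    using assms T by (simp add: normalizer_def stabilizer_def)
  \<comment> \<open>The diagonal entries differ and have product 1. Comparing \<open>n ** t\<close>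
    with \<open>t' ** n\<close> for a diagonal \<open>t'\<close> shows that two nonzero entries in
    one row of \<open>n\<close> would identify two of them.\<close>
  define t :: M3 where "t = (\<chi> i j. if i = j then if i = 1 then 2 else if i = 2 then 3 else 1/6 else 0)"
  have t: "t \<in> diagonal_torus" unfolding diagonal_torus_pattern_group t_def by (rule diag_pattern_group_Id) simp
  have "n ** t ** adj3 n \<in> n <#\<^bsub>SL3\<^esub> diagonal_torus #>\<^bsub>SL3\<^esub> (inv\<^bsub>SL3\<^esub> n)"
    unfolding r_coset_def l_coset_def using t by (auto simp: inv_SL3 d)
  then have t': "n ** t ** adj3 n \<in> diagonal_torus" using eq by simp
  define t' where "t' = n ** t ** adj3 n"
  have "n ** t ** adj3 n ** n = n ** t ** (adj3 n ** n)" by (simp only: matrix_mul_assoc)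
  then have nt: "n ** t = t' ** n" by (simp add: t'_def adj3_mult d)
  have off: "t'$i$j = 0" if "i \<noteq> j" for i j using t' that by (simp add: t'_def diagonal_torus_def)
  have e: "n$i$j * t$j$j = t'$i$i * n$i$j" for i j
  proof -
    have a: "(n ** t)$i$j = n$i$j * t$j$j" using exhaust_3[of j] by (auto simp: mult_entry t_def)
    have b: "(t' ** n)$i$j = t'$i$i * n$i$j" using exhaust_3[of i] by (auto simp: mult_entry off)
    from trans[OF sym[OF a[unfolded nt]] b] show ?thesis .
  qed
  fix i j k :: 3 assume jk: "j \<noteq> k"
  show "n$i$j * n$i$k = 0"
  proof (rule ccontr)
    assume "n$i$j * n$i$k \<noteq> 0"
    then have "t$j$j = t'$i$i" "t$k$k = t'$i$i" using e[of i j] e[of i k] by (auto simp: mult.commute)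
    then show False using jk exhaust_3[of j] exhaust_3[of k] by (auto simp: t_def)
  qed
qed

lemma weyl_group_cases:
  assumes "w \<in> carrier weyl_group"
  obtains n where "w = pattern_group Id #>\<^bsub>SL3\<^esub> n" "det n = 1" "\<And>i j k. j \<noteq> k \<Longrightarrow> n$i$j * n$i$k = 0"
proof -
  obtain n where "n \<in> normalizer SL3 diagonal_torus" "w = diagonal_torus #>\<^bsub>SL3\<^esub> n"
    using assms by (auto simp: weyl_group_def FactGroup_def RCOSETS_def r_coset_def)
  then show thesis using that normalizer_torus_monomial unfolding diagonal_torus_pattern_group by blast
qed

theorem theorem6p2:
  assumes "w \<in> carrier weyl_group"
  shows "spherical_variety (schubert_levi w) (schubert_variety w) translate"
proof -
  obtain n where w: "w = pattern_group Id #>\<^bsub>SL3\<^esub> n" and d: "det n = 1" and m: "\<And>i j k. j \<noteq> k \<Longrightarrow> n$i$j * n$i$k = 0"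
    by (rule weyl_group_cases[OF assms]) blast
  have row: "n$i$k = 0" if "n$i$j \<noteq> 0" "j \<noteq> k" for i j k
    using m[OF that(2), of i] that(1) by simp
  show ?thesis
  \<comment> \<open>\<open>n\<close> is monomial: its rows have at most one nonzero entry each and
    its determinant is 1. The zeros among a few entries in its lower left part tell the six
    permutations apart.\<close>
  proof (cases "n$3$1 = 0")
    case False
    have 3: "n$3$2 = 0" "n$3$3 = 0" using row[OF False] by simp_all
    have 21: "n$2$1 = 0"
    proof (rule ccontr)
      assume h: "n$2$1 \<noteq> 0"
      have "n$2$2 = 0" "n$2$3 = 0" using row[OF h] by simp_all
      then show False using d 3 by (simp add: det_3)
    qed
    show ?thesis
    proof (cases "n$2$2 = 0")
      case 22: True
      have "n$1$1 = 0"
      proof (rule ccontr)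
        assume h: "n$1$1 \<noteq> 0"
        have "n$1$2 = 0" "n$1$3 = 0" using row[OF h] by simp_all
        then show False using d 3 by (simp add: det_3)
      qed
      then show ?thesis by (rule spherical_surface2[OF d _ 21 22 False w])
    qed (rule spherical_flag[OF d 21 _ False w])
  next
    case 31: True
    show ?thesis
    proof (cases "n$3$2 = 0")
      case 32: True
      show ?thesis
      proof (cases "n$2$1 = 0")
        case True
        then have "n \<in> pattern_group upper_rel" unfolding pattern_group_iff using d 31 32 by simp
        then show ?thesis by (rule spherical_point[OF _ w])
      next
        case False
        have "n \<in> pattern_group para1_rel" unfolding pattern_group_iff using d 31 32 by simp
        then show ?thesis by (rule spherical_line1[OF _ False w])
      qed
    next
      case 32: False
      show ?thesis
      proof (cases "n$2$1 = 0")
        case True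
        then have "n \<in> pattern_group para2_rel" unfolding pattern_group_iff using d 31 by simp
        then show ?thesis by (rule spherical_line2[OF _ 32 w])
      next
        case 21: False
        have 2: "n$2$2 = 0" "n$2$3 = 0" "n$3$3 = 0" using row[OF 21] row[OF 32] by simp_all
        then have 13: "n$1$3 \<noteq> 0" using d 31 by (auto simp: det_3)
        have 1: "n$1$1 = 0" "n$1$2 = 0" using row[OF 13] by simp_all
        show ?thesis by (rule spherical_surface1[OF d 1(1) 31 21 32 1(2) 2(1) w])
      qed
    qed
  qed
qed

end
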